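(* Let $0<p\le q\le\infty$, let $\omega=\omega_1\cdots\omega_s$ with $\omega_i\in\Omega$ for $i=1,\dots,s$, and let $u\in\mathcal{R}_{int}(q)$. (A) Let $q<\infty$ and $u^{p/q}\in\mathcal{R}_{int}(p)$. Suppose there is a constant $C_0=C_0(u,p,q)$ such that for every $n\ge1$ and every trigonometric polynomial $T_n$ of degree at most $n$, $$\left(\int_{\mathbb{T}}|T_n|^qu\right)^{1/q}\le C_0\,n^{1/p-1/q}\left(\int_{\mathbb{T}}|T_n|^pu^{p/q}\right)^{1/p}.$$ Then there is a constant $C=C(\omega,u,p,q)$ such that for every $n\ge1$ and every trigonometric polynomial $T_n$ of degree at most $n$, $$\|T_n\|_{L_q(\omega u)}\le C\,n^{1/p-1/q}\,\|T_n\|_{L_p((\omega u)^{p/q})}.$$ (B) Let $p<q=\infty$ and $u^p\in\mathcal{R}_{int}(p)$. Suppose there is a constant $C_0=C_0(u,p)$ such that for every $n\ge1$ and every trigonometric polynomial $T_n$ of degree at most $n$, $$\|T_nu\|_{L_\infty(\mathbb{T})}\le C_0\,n^{1/p}\left(\int_{\mathbb{T}}|T_n|^pu^p\right)^{1/p}.$$ Then there is a constant $C=C(\omega,u,p)$ such that for every $n\ge1$ and every trigonometric polynomial $T_n$ of degree at most $n$, $$\|T_n\|_{L_\infty(\omega u)}\le C\,n^{1/p}\,\|T_n\|_{L_p((\omega u)^p)}.$$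
   Context: $\mathbb{T}=\mathbb{R}/2\pi\mathbb{Z}$; $|E|$ is Lebesgue measure. A weight is a nonnegative integrable function on $\mathbb{T}$. For a weight $w$ and measurable $E\subset\mathbb{T}$: $\|f\|_{L_p(w,E)}=\left(\int_E|f|^pw\right)^{1/p}$ if $0<p<\infty$, $\|f\|_{L_\infty(w,E)}=\operatorname{ess\,sup}_{t\in E}|f(t)w(t)|$, and $\|f\|_{L_p(w)}=\|f\|_{L_p(w,\mathbb{T})}$. Class $\mathcal{R}_{int}(p)$, $0<p\le\infty$: a weight $u$ belongs to $\mathcal{R}_{int}(p)$ if there is $C=C(p,u)>0$ such that for every $n\ge1$ and every trigonometric polynomial $T_n$ of degree at most $n$, $\|T_n\|_{L_p(u,\mathbb{T})}\le\exp(Cn|E|)\|T_n\|_{L_p(u,\mathbb{T}\setminus E)}$ for all sets $E\subset\mathbb{T}$ which are a finite union of intervals of length $\ge1/n$ and such that $|E|\le1$. Class $\Omega$: $\omega\in\Omega$ if $\omega(t)=\exp(-F(g(t)))$, $t\in\mathbb{T}$ (with $\omega(t)=0$ where $g(t)=0$), where for some $A>0$: - $g:\mathbb{T}\to[-A,A]$ is real analytic, i.e. for some $D>0$, $|g^{(n)}(t)|\le D^n n!$ for all $t\in\mathbb{T}$, $n\ge 1$; each zero of $g$ has multiplicity one; and $g$ has at least one zero on $\mathbb{T}$; - $F:[-A,A]\setminus\{0\}\to(0,\infty)$ is even, $C^\infty$ on $(0,A]$, and satisfies: (F1) $F(x)\to\infty$ as $x\to0+$; (F2) $F$ is decreasing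 on $(0,A]$; (F3) for some $B>0$, $|F^{(n)}(x)|\le B^n n^n F(x)/x^n$ for $x\in(0,A]$, $n=1,2,\dots$; (F4) there exist $A_1,A_2>0$ with $A_2\le |F'(x)|x/F(x)\le A_1$ for $x\in(0,A]$. *)

theory Defs
  imports "HOL-Analysis.Analysis" "HOL-Probability.Essential_Supremum"
begin

(* Functions on the circle R/(2 pi Z) are 2 pi-periodic functions on the real line. Subsets of the
   circle are subsets of the fundamental domain [0, 2 pi). *)

definition torus :: "real set" where
  "torus = {0..<2 * pi}"

definition periodic_2pi :: "(real \<Rightarrow> 'a) \<Rightarrow> bool" where
  "periodic_2pi f \<longleftrightarrow> (\<forall>t. f (t + 2 * pi) = f t)"

definition weight :: "(real \<Rightarrow> real) \<Rightarrow> bool" where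
  "weight w \<longleftrightarrow> periodic_2pi w \<and> (\<forall>t. 0 \<le> w t) \<and> w absolutely_integrable_on torus"

definition trig_poly :: "nat \<Rightarrow> (real \<Rightarrow> complex) \<Rightarrow> bool" where
  "trig_poly n T \<longleftrightarrow>
     (\<exists>c :: int \<Rightarrow> complex. \<forall>t. T t = (\<Sum>k = - int n..int n. c k * cis (of_int k * t)))"

(* Extension of the real power to [0, \<infinity>], only meant for positive exponents. *)
definition ennreal_powr :: "ennreal \<Rightarrow> real \<Rightarrow> ennreal" where
  "ennreal_powr x a = (if x = \<infinity> then \<infinity> else ennreal (enn2real x powr a))"

(* The weight enters the integrand to the first power also for p = \<infinity>. The value lies in
   [0, \<infinity>]: for an unbounded weight the norm with p = \<infinity> may be infinite. *)
definition Lp_norm :: "ennreal \<Rightarrow> (real \<Rightarrow> real) \<Rightarrow> real set \<Rightarrow> (real \<Rightarrow> complex) \<Rightarrow> ennreal" where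
  "Lp_norm p w E f =
     (if p = \<infinity> then esssup (lebesgue_on E) (\<lambda>t. ennreal \<bar>norm (f t) * w t\<bar>)
      else ennreal_powr
             (\<integral>\<^sup>+ t. ennreal (norm (f t) powr enn2real p * w t) \<partial>lebesgue_on E)
             (1 / enn2real p))"

(* Image in the circle of a set of reals; an interval may wrap around the endpoint 0 = 2 pi. *)
definition proj_torus :: "real set \<Rightarrow> real set" where
  "proj_torus I = {t \<in> torus. \<exists>k :: int. t + 2 * pi * of_int k \<in> I}"

definition finite_union_of_intervals :: "nat \<Rightarrow> real set \<Rightarrow> bool" where
  "finite_union_of_intervals n E \<longleftrightarrow>
     (\<exists>J. finite J \<and>
          (\<forall>I\<in>J. is_interval I \<and> bounded I \<and> 1 / real n \<le> measure lebesgue I) \<and>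
          E = (\<Union>I\<in>J. proj_torus I))"

definition R_int :: "ennreal \<Rightarrow> (real \<Rightarrow> real) set" where
  "R_int p = {u. weight u \<and>
     (\<exists>C>0. \<forall>n\<ge>1. \<forall>T E.
        trig_poly n T \<longrightarrow> finite_union_of_intervals n E \<longrightarrow> measure lebesgue E \<le> 1 \<longrightarrow>
        Lp_norm p u torus T
          \<le> ennreal (exp (C * real n * measure lebesgue E)) * Lp_norm p u (torus - E) T)}"

(* d n is the n-th derivative of f on S. Derivatives are taken within S, hence one-sided at an
   endpoint belonging to an interval S; existence of such a d means that f is C^infinity on S. *)
definition successive_derivs_on ::
    "real set \<Rightarrow> (real \<Rightarrow> real) \<Rightarrow> (nat \<Rightarrow> real \<Rightarrow> real) \<Rightarrow> bool" where
  "successive_derivs_on S f d \<longleftrightarrow>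
     (\<forall>x\<in>S. d 0 x = f x) \<and>
     (\<forall>n. \<forall>x\<in>S. (d n has_real_derivative d (Suc n) x) (at x within S))"

definition Omega_inner :: "real \<Rightarrow> (real \<Rightarrow> real) \<Rightarrow> bool" where
  "Omega_inner A g \<longleftrightarrow>
     periodic_2pi g \<and> (\<forall>t. g t \<in> {-A..A}) \<and>
     (\<exists>d. successive_derivs_on UNIV g d \<and>
          (\<exists>D>0. \<forall>t. \<forall>n\<ge>1. \<bar>d n t\<bar> \<le> D ^ n * fact n) \<and>
          (\<forall>t. g t = 0 \<longrightarrow> d 1 t \<noteq> 0)) \<and>
     (\<exists>t. g t = 0)"

(* Only the values of F on [-A, A] - {0} matter. *)
definition Omega_outer :: "real \<Rightarrow> (real \<Rightarrow> real) \<Rightarrow> bool" where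
  "Omega_outer A F \<longleftrightarrow>
     (\<forall>x\<in>{-A..A} - {0}. 0 < F x \<and> F (- x) = F x) \<and>
     filterlim F at_top (at_right 0) \<and>
     antimono_on {0<..A} F \<and>
     (\<exists>d. successive_derivs_on {0<..A} F d \<and>
          (\<exists>B>0. \<forall>x\<in>{0<..A}. \<forall>n\<ge>1. \<bar>d n x\<bar> \<le> B ^ n * real n ^ n * F x / x ^ n) \<and>
          (\<exists>A1>0. \<exists>A2>0. \<forall>x\<in>{0<..A}. A2 \<le> \<bar>d 1 x\<bar> * x / F x \<and> \<bar>d 1 x\<bar> * x / F x \<le> A1))"

definition Omega :: "(real \<Rightarrow> real) set" where
  "Omega = {\<omega>. \<exists>A>0. \<exists>g F. Omega_inner A g \<and> Omega_outer A F \<and>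
     (\<forall>t. \<omega> t = (if g t = 0 then 0 else exp (- F (g t))))}"

end

theory Submission
  imports Defs "HOL-Complex_Analysis.Complex_Analysis" "HOL-Real_Asymp.Real_Asymp"
begin

text \<open>Write \<open>\<rho> = \<omega> powr (1 / q)\<close> (and \<open>\<rho> = \<omega>\<close> for \<open>q = \<infinity>\<close>). The
  \<open>q\<close>-norm of \<open>T\<close> with weight \<open>\<omega> u\<close> is the \<open>q\<close>-norm of \<open>T \<rho>\<close> with weight \<open>u\<close>, and the \<open>p\<close>-norm on the
  right is a \<open>p\<close>-norm of the same function \<open>T \<rho>\<close>, with weight \<open>u powr (p / q)\<close> or \<open>u powr p\<close>. Positive
  powers of weights in \<open>Omega\<close> are in \<open>Omega\<close>, so for one factor \<open>\<rho> = exp (- F \<circ> g)\<close>. If \<open>\<rho>\<close> could be replaced by a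
  trigonometric polynomial \<open>Q\<close> of degree \<open>O(n)\<close> comparable to it, the hypothesis on \<open>u\<close> applied to
  \<open>T Q\<close> would finish the proof. Near its zeros \<open>\<rho>\<close> is far too small to be imitated, but
  there the Remez inequality for \<open>u\<close> helps.

  The right scale is the \<open>\<delta>\<close> with \<open>F \<delta> = M n \<delta>\<close>, where \<open>M\<close> is large compared with the Remez constant.
  Put \<open>B = {\<bar>g\<bar> < \<delta>}\<close>, where \<open>\<rho> \<le> exp (- F \<delta>)\<close>, and let \<open>U\<close> be a union of \<open>O(1)\<close> intervals of
  total length \<open>O(\<delta>)\<close> that contains \<open>{\<bar>g\<bar> < 2 \<delta>}\<close>. By the Remez inequality \<open>T\<close> gains at most a factor
  \<open>exp (O(n \<delta>))\<close> when passing from outside \<open>U\<close> into \<open>B\<close>, while the power growth of \<open>F\<close> makes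
  \<open>F \<delta> - F (2 \<delta>)\<close> a fixed fraction of \<open>F \<delta> = M n \<delta>\<close>. So the contribution of \<open>B\<close> to the norm of \<open>T h\<close> is
  dominated by the norm of \<open>T \<rho>\<close> off \<open>B\<close> whenever \<open>\<bar>h\<bar> \<le> 2 exp (- F \<delta>)\<close> on \<open>B\<close>. This is
  \<open>core_is_negligible\<close>; it is applied to \<open>h = \<rho>\<close> and to \<open>h = Q\<close>.

  Off \<open>B\<close> one has \<open>\<rho> \<ge> exp (- F \<delta>)\<close>, so it is enough that \<open>\<bar>Q - \<rho>\<bar> \<le> exp (- 2 F \<delta>)\<close> everywhere. The
  function \<open>\<rho>\<close> extends holomorphically to the disc of radius \<open>c \<bar>g t\<bar>\<close> around \<open>t\<close> and is bounded there by
  \<open>exp (- F (g t) / 2)\<close>; Cauchy's estimates show that \<open>\<rho>\<close> is smooth, with a \<open>k\<close>-th derivative of size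
  \<open>(C k / \<delta>) ^ k\<close> for \<open>k\<close> of order \<open>F \<delta>\<close> (\<open>Omega_smooth\<close>, \<open>derivative_bound_at_scale\<close>). With
  \<open>k \<approx> 2 F \<delta>\<close> the Fourier sum of degree \<open>D n\<close> has the required accuracy (\<open>fourier_sum_error\<close>), because
  \<open>k / \<delta>\<close> is of order \<open>n\<close>. This gives \<open>Omega_mimicked\<close>.

  For a product of \<open>s\<close> weights the argument is iterated: \<open>remez_times_norm\<close> shows that a Remez inequality
  survives multiplication of the weight by a factor in \<open>Omega\<close>, and \<open>nikolskii_times_norm\<close> transfers the
  inequality between the norms. Both are proved for abstract monotone quasi-additive functionals, which
  treats all exponents, including \<open>\<infinity>\<close>, at once.\<close>

section \<open>Trigonometric polynomials and unions of intervals on the circle\<close>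

lemma trig_poly_continuous: "trig_poly n T \<Longrightarrow> continuous_on UNIV T"
proof -
  assume "trig_poly n T"
  then obtain c where "T = (\<lambda>t. \<Sum>k = - int n..int n. c k * cis (of_int k * t))"
    unfolding trig_poly_def by auto
  then show ?thesis by (auto intro!: continuous_intros)
qed

lemma trig_poly_monomial:
  assumes "\<bar>k\<bar> \<le> int n" shows "trig_poly n (\<lambda>t. a * cis (of_int k * t))"
proof -
  have "a * cis (of_int k * t) = (\<Sum>j = - int n..int n. (if j = k then a else 0) * cis (of_int j * t))" for t
  proof -
    have "(\<Sum>j = - int n..int n. (if j = k then a else 0) * cis (of_int j * t))
        = (\<Sum>j = - int n..int n. if k = j then a * cis (of_int k * t) else 0)"
      by (intro sum.cong) auto
    then show ?thesis using assms by (auto simp: sum.delta')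
  qed
  then show ?thesis unfolding trig_poly_def by (intro exI[of _ "\<lambda>j. if j = k then a else 0"]) blast
qed

lemma trig_poly_add:
  assumes "trig_poly n S" "trig_poly n T" shows "trig_poly n (\<lambda>t. S t + T t)"
proof -
  obtain c d where "\<And>t. S t = (\<Sum>k = - int n..int n. c k * cis (of_int k * t))"
    "\<And>t. T t = (\<Sum>k = - int n..int n. d k * cis (of_int k * t))"
    using assms unfolding trig_poly_def by auto
  then have "S t + T t = (\<Sum>k = - int n..int n. (c k + d k) * cis (of_int k * t))" for t
    by (simp add: sum.distrib distrib_right)
  then show ?thesis unfolding trig_poly_def by (intro exI[of _ "\<lambda>k. c k + d k"]) blast
qed

lemma trig_poly_zero: "trig_poly n (\<lambda>t. 0)"
  unfolding trig_poly_def by (intro exI[of _ "\<lambda>k. 0"]) simp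

lemma trig_poly_sum:
  assumes "\<And>i. i \<in> I \<Longrightarrow> trig_poly n (T i)" shows "trig_poly n (\<lambda>t. \<Sum>i\<in>I. T i t)"
  using assms by (induction I rule: infinite_finite_induct) (auto intro: trig_poly_zero trig_poly_add)

lemma trig_poly_mono:
  assumes "trig_poly n T" "n \<le> m" shows "trig_poly m T"
proof -
  obtain c where "\<And>t. T t = (\<Sum>k = - int n..int n. c k * cis (of_int k * t))"
    using assms unfolding trig_poly_def by auto
  then have "T = (\<lambda>t. \<Sum>k = - int n..int n. c k * cis (of_int k * t))" by auto
  then show ?thesis using assms(2) by (auto intro!: trig_poly_sum trig_poly_monomial)
qed

lemma trig_poly_mult:
  assumes "trig_poly n S" "trig_poly m T" shows "trig_poly (n + m) (\<lambda>t. S t * T t)"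
proof -
  obtain c d where "\<And>t. S t = (\<Sum>k = - int n..int n. c k * cis (of_int k * t))"
    "\<And>t. T t = (\<Sum>k = - int m..int m. d k * cis (of_int k * t))"
    using assms unfolding trig_poly_def by auto
  then have "(\<lambda>t. S t * T t) = (\<lambda>t. \<Sum>k = - int n..int n. \<Sum>j = - int m..int m. (c k * d j) * cis (of_int (k + j) * t))"
    by (auto simp: sum_product cis_mult algebra_simps)
  moreover have "trig_poly (n + m) (\<lambda>t. \<Sum>k = - int n..int n. \<Sum>j = - int m..int m. (c k * d j) * cis (of_int (k + j) * t))"
    by (intro trig_poly_sum trig_poly_monomial) auto
  ultimately show ?thesis by simp
qed

lemma proj_torus_measurable:
  assumes "is_interval I" shows "proj_torus I \<in> sets borel"
proof -
  have I: "I \<in> sets borel" using assms by (rule real_interval_borel_measurable)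
  have "proj_torus I = torus \<inter> (\<Union>k. (\<lambda>t. t + 2 * pi * of_int k) -` I)"
    by (auto simp: proj_torus_def)
  moreover have "(\<lambda>t. t + 2 * pi * of_int k) -` I \<in> sets borel" for k :: int
    using measurable_sets[of "\<lambda>t. t + 2 * pi * of_int k" borel borel I] I by auto
  ultimately show ?thesis by (auto simp: torus_def)
qed

lemma finite_union_of_intervals_measurable:
  "finite_union_of_intervals n E \<Longrightarrow> E \<in> sets lebesgue"
proof -
  assume "finite_union_of_intervals n E"
  then obtain J where "finite J" "\<forall>I\<in>J. is_interval I" "E = (\<Union>I\<in>J. proj_torus I)"
    unfolding finite_union_of_intervals_def by auto
  then have "E \<in> sets borel" using proj_torus_measurable by auto
  then show ?thesis by auto
qed

lemma finite_union_of_intervals_subset: "finite_union_of_intervals n E \<Longrightarrow> E \<subseteq> torus"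
  by (auto simp: finite_union_of_intervals_def proj_torus_def)

lemma finite_union_of_intervals_Un:
  assumes "finite_union_of_intervals n E" "finite_union_of_intervals n E'"
  shows "finite_union_of_intervals n (E \<union> E')"
proof -
  obtain J J' where "finite J" "finite J'" "E = (\<Union>I\<in>J. proj_torus I)" "E' = (\<Union>I\<in>J'. proj_torus I)"
    "\<forall>I\<in>J. is_interval I \<and> bounded I \<and> 1 / real n \<le> measure lebesgue I"
    "\<forall>I\<in>J'. is_interval I \<and> bounded I \<and> 1 / real n \<le> measure lebesgue I"
    using assms unfolding finite_union_of_intervals_def by auto
  then show ?thesis
    unfolding finite_union_of_intervals_def by (intro exI[of _ "J \<union> J'"]) auto
qed

lemma finite_union_of_intervals_empty: "finite_union_of_intervals n {}"
  unfolding finite_union_of_intervals_def by (intro exI[of _ "{}"]) auto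

lemma finite_union_of_intervals_mono:
  assumes "finite_union_of_intervals n E" "1 \<le> n" "n \<le> m"
  shows "finite_union_of_intervals m E"
proof -
  have "1 / real m \<le> 1 / real n" using assms by (intro divide_left_mono) auto
  moreover obtain J where "finite J" "E = (\<Union>I\<in>J. proj_torus I)"
    "\<forall>I\<in>J. is_interval I \<and> bounded I \<and> 1 / real n \<le> measure lebesgue I"
    using assms(1) unfolding finite_union_of_intervals_def by auto
  ultimately show ?thesis unfolding finite_union_of_intervals_def by (intro exI[of _ J]) auto
qed

section \<open>Transferring Remez and Nikolskii inequalities to a multiplied norm\<close>

lemma ennreal_mult_trans:
  assumes "x \<le> ennreal a * y" "y \<le> ennreal b * z" "0 \<le> a" "0 \<le> b"
  shows "x \<le> ennreal (a * b) * z"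
proof -
  have "x \<le> ennreal a * (ennreal b * z)" using assms by (meson mult_left_mono order_trans zero_le)
  then show ?thesis using assms by (simp add: ennreal_mult mult.assoc)
qed

lemma ennreal_split_bound:
  assumes "x \<le> ennreal K * (y + z)" "y \<le> ennreal b * w" "z \<le> ennreal c * w" "0 \<le> K" "0 \<le> b" "0 \<le> c"
  shows "x \<le> ennreal (K * (b + c)) * w"
proof -
  have "y + z \<le> ennreal (b + c) * w"
    using add_mono[OF assms(2,3)] assms by (simp add: ennreal_plus distrib_right)
  then show ?thesis using ennreal_mult_trans[OF assms(1)] assms by auto
qed

lemma ennreal_const_mono:
  assumes "x \<le> ennreal a * y" "a \<le> b" shows "x \<le> ennreal b * y"
  using assms by (meson ennreal_leI mult_right_mono order_trans zero_le)

text \<open>The two properties of weighted \<open>L\<^sub>p\<close> norms, \<open>0 < p \<le> \<infinity>\<close>, on which the transfer of inequalities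
  depends. Only continuous functions occur: trigonometric polynomials times powers of weights in \<open>Omega\<close>.\<close>

definition lattice_norm :: "(real set \<Rightarrow> (real \<Rightarrow> complex) \<Rightarrow> ennreal) \<Rightarrow> bool" where
  "lattice_norm N \<longleftrightarrow>
     (\<forall>E E' f h. \<forall>c>0. E \<in> sets lebesgue \<longrightarrow> E' \<in> sets lebesgue \<longrightarrow> E \<subseteq> E' \<longrightarrow> E' \<subseteq> torus \<longrightarrow>
        continuous_on UNIV f \<longrightarrow> continuous_on UNIV h \<longrightarrow>
        (\<forall>t\<in>E. norm (f t) \<le> c * norm (h t)) \<longrightarrow> N E f \<le> ennreal c * N E' h) \<and>
     (\<exists>K>0. \<forall>E E' f. E \<in> sets lebesgue \<longrightarrow> E' \<in> sets lebesgue \<longrightarrow> E \<subseteq> torus \<longrightarrow> E' \<subseteq> torus \<longrightarrow>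
        continuous_on UNIV f \<longrightarrow> N (E \<union> E') f \<le> ennreal K * (N E f + N E' f))"

lemma lattice_norm_mono:
  assumes "lattice_norm N" "E \<in> sets lebesgue" "E' \<in> sets lebesgue" "E \<subseteq> E'" "E' \<subseteq> torus"
    "continuous_on UNIV f" "continuous_on UNIV h" "0 < c"
    "\<And>t. t \<in> E \<Longrightarrow> norm (f t) \<le> c * norm (h t)"
  shows "N E f \<le> ennreal c * N E' h"
proof -
  note * = conjunct1[OF assms(1)[unfolded lattice_norm_def], rule_format]
  show ?thesis by (rule *) (use assms(2-) in auto)
qed

definition times_norm ::
  "(real set \<Rightarrow> (real \<Rightarrow> complex) \<Rightarrow> ennreal) \<Rightarrow> (real \<Rightarrow> real) \<Rightarrow> real set \<Rightarrow> (real \<Rightarrow> complex) \<Rightarrow> ennreal" where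
  "times_norm N \<rho> E f = N E (\<lambda>t. f t * of_real (\<rho> t))"

lemma lattice_norm_times_norm:
  assumes N: "lattice_norm N" and \<rho>: "continuous_on UNIV \<rho>"
  shows "lattice_norm (times_norm N \<rho>)"
proof -
  have c: "continuous_on UNIV (\<lambda>t. f t * of_real (\<rho> t))" if "continuous_on UNIV f" for f :: "real \<Rightarrow> complex"
    using that \<rho> by (intro continuous_intros)
  obtain K where K: "K > 0" "\<And>E E' f. E \<in> sets lebesgue \<Longrightarrow> E' \<in> sets lebesgue \<Longrightarrow> E \<subseteq> torus \<Longrightarrow> E' \<subseteq> torus \<Longrightarrow>
        continuous_on UNIV f \<Longrightarrow> N (E \<union> E') f \<le> ennreal K * (N E f + N E' f)"
    using N unfolding lattice_norm_def by meson
  show ?thesis unfolding lattice_norm_def times_norm_def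
  proof (intro conjI allI impI)
    fix E E' and f h :: "real \<Rightarrow> complex" and a :: real
    assume *: "a > 0" "E \<in> sets lebesgue" "E' \<in> sets lebesgue" "E \<subseteq> E'" "E' \<subseteq> torus"
      "continuous_on UNIV f" "continuous_on UNIV h" "\<forall>t\<in>E. norm (f t) \<le> a * norm (h t)"
    show "N E (\<lambda>t. f t * of_real (\<rho> t)) \<le> ennreal a * N E' (\<lambda>t. h t * of_real (\<rho> t))"
    proof (rule lattice_norm_mono[OF N *(2-5) c[OF *(6)] c[OF *(7)] *(1)])
      fix t assume "t \<in> E"
      then have "norm (f t) * \<bar>\<rho> t\<bar> \<le> (a * norm (h t)) * \<bar>\<rho> t\<bar>" using *(8) by (intro mult_right_mono) auto
      then show "norm (f t * of_real (\<rho> t)) \<le> a * norm (h t * of_real (\<rho> t))" by (simp add: norm_mult mult.assoc)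
    qed
  next
    show "\<exists>K>0. \<forall>E E' f. E \<in> sets lebesgue \<longrightarrow> E' \<in> sets lebesgue \<longrightarrow> E \<subseteq> torus \<longrightarrow> E' \<subseteq> torus \<longrightarrow>
        continuous_on UNIV f \<longrightarrow> N (E \<union> E') (\<lambda>t. f t * of_real (\<rho> t))
          \<le> ennreal K * (N E (\<lambda>t. f t * of_real (\<rho> t)) + N E' (\<lambda>t. f t * of_real (\<rho> t)))"
      using K c by (intro exI[of _ K]) auto
  qed
qed

text \<open>Compared with the inequality that defines \<open>R_int\<close> there is a prefactor, and \<open>m\<close> replaces the bound
  \<open>1\<close> on the measure. Multiplying the weight by a factor in \<open>Omega\<close> costs a constant and forces the
  exceptional set to be enlarged, so this weaker form is the one that is stable under multiplication.\<close>

definition remez_with :: "(real set \<Rightarrow> (real \<Rightarrow> complex) \<Rightarrow> ennreal) \<Rightarrow> real \<Rightarrow> real \<Rightarrow> real \<Rightarrow> bool" where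
  "remez_with N C\<^sub>0 C m \<longleftrightarrow> (\<forall>n\<ge>1. \<forall>T E. trig_poly n T \<longrightarrow> finite_union_of_intervals n E \<longrightarrow>
      measure lebesgue E \<le> m \<longrightarrow>
      N torus T \<le> ennreal (C\<^sub>0 * exp (C * real n * measure lebesgue E)) * N (torus - E) T)"

definition remez :: "(real set \<Rightarrow> (real \<Rightarrow> complex) \<Rightarrow> ennreal) \<Rightarrow> bool" where
  "remez N \<longleftrightarrow> (\<exists>C\<^sub>0>0. \<exists>C>0. \<exists>m>0. remez_with N C\<^sub>0 C m)"

definition nikolskii ::
  "(real set \<Rightarrow> (real \<Rightarrow> complex) \<Rightarrow> ennreal) \<Rightarrow> (real set \<Rightarrow> (real \<Rightarrow> complex) \<Rightarrow> ennreal) \<Rightarrow> real \<Rightarrow> bool" where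
  "nikolskii N N' \<gamma> \<longleftrightarrow>
     (\<exists>C>0. \<forall>n\<ge>1. \<forall>T. trig_poly n T \<longrightarrow> N torus T \<le> ennreal (C * real n powr \<gamma>) * N' torus T)"

lemma remez_with_weaken:
  assumes "remez_with N C\<^sub>0 C m" "C\<^sub>0 \<le> C\<^sub>0'" "C \<le> C'" "m' \<le> m" "0 \<le> C\<^sub>0"
  shows "remez_with N C\<^sub>0' C' m'"
  unfolding remez_with_def
proof (intro allI impI)
  fix n T E assume *: "1 \<le> n" "trig_poly n T" "finite_union_of_intervals n E" "measure lebesgue E \<le> m'"
  have le: "C\<^sub>0 * exp (C * real n * measure lebesgue E) \<le> C\<^sub>0' * exp (C' * real n * measure lebesgue E)"
    using assms by (intro mult_mono) (auto intro!: mult_right_mono)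
  show "N torus T \<le> ennreal (C\<^sub>0' * exp (C' * real n * measure lebesgue E)) * N (torus - E) T"
    using assms(1,4) * by (intro ennreal_const_mono[OF _ le]) (auto simp: remez_with_def)
qed

text \<open>A polynomial of degree \<open>n\<close> also has degree \<open>n0 * n\<close>, and intervals of length at least \<open>1 / n\<close> are
  long enough for the larger degree; only the constant in the exponent changes.\<close>

lemma remez_from_large_degrees:
  assumes "\<And>n T E. n0 \<le> n \<Longrightarrow> 1 \<le> n \<Longrightarrow> trig_poly n T \<Longrightarrow> finite_union_of_intervals n E \<Longrightarrow>
      measure lebesgue E \<le> m \<Longrightarrow>
      N torus T \<le> ennreal (C\<^sub>0 * exp (C * real n * measure lebesgue E)) * N (torus - E) T"
    and "1 \<le> n0" "0 \<le> C" "0 \<le> C\<^sub>0"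
  shows "remez_with N C\<^sub>0 (C * real n0) m"
  unfolding remez_with_def
proof (intro allI impI)
  fix n T E assume *: "1 \<le> n" "trig_poly n T" "finite_union_of_intervals n E" "measure lebesgue E \<le> m"
  let ?k = "n0 * n"
  have k: "n0 \<le> ?k" "1 \<le> ?k" "n \<le> ?k" using * assms(2) by auto
  have "N torus T \<le> ennreal (C\<^sub>0 * exp (C * real ?k * measure lebesgue E)) * N (torus - E) T"
    using * k trig_poly_mono finite_union_of_intervals_mono by (intro assms(1)) blast+
  then show "N torus T \<le> ennreal (C\<^sub>0 * exp (C * real n0 * real n * measure lebesgue E)) * N (torus - E) T"
    by (simp add: mult.assoc)
qed

text \<open>\<open>B\<close> is the core around the zeros of \<open>\<rho>\<close> in which no polynomial can follow \<open>\<rho>\<close>, and \<open>\<Lambda>\<close> its size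
  there. The last clause says that outside the slightly larger set \<open>U\<close> the function is bigger than in the
  core by a factor that beats any Remez inequality with constant below \<open>M\<close>; since \<open>M\<close> is given first,
  the degree factor \<open>D\<close> may depend on it.\<close>

definition mimicked :: "(real \<Rightarrow> real) \<Rightarrow> bool" where
  "mimicked \<rho> \<longleftrightarrow> (\<forall>M>0. \<forall>\<eta>>0. \<exists>D n0. 1 \<le> n0 \<and> (\<forall>n\<ge>n0. \<exists>\<tau> \<Lambda> B U Q.
     B \<in> sets lebesgue \<and> B \<subseteq> U \<and> finite_union_of_intervals n U \<and>
     measure lebesgue U \<le> \<tau> \<and> \<tau> \<le> \<eta> \<and> 0 < \<Lambda> \<and> trig_poly (D * n) Q \<and>
     (\<forall>t\<in>B. \<rho> t \<le> \<Lambda> \<and> norm (Q t) \<le> 2 * \<Lambda>) \<and>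
     (\<forall>t\<in>torus - B. \<rho> t \<le> 2 * norm (Q t) \<and> norm (Q t) \<le> 2 * \<rho> t) \<and>
     (\<forall>t\<in>torus - U. \<Lambda> * exp (M * real n * \<tau>) \<le> \<rho> t)))"

text \<open>The smallness \<open>2 * \<Lambda>\<close> of \<open>h\<close> on \<open>B\<close>, the loss \<open>exp (2 * C * n * \<tau>)\<close> in the Remez inequality for the
  exceptional set \<open>U \<union> E\<close>, and the lower bound for \<open>\<rho>\<close> off \<open>U\<close> cancel up to a constant. The Remez inequality is
  applied to \<open>T\<close> alone, so its cost does not depend on the degree of \<open>h\<close>.\<close>

lemma core_is_negligible:
  assumes N: "lattice_norm N" "remez_with N C\<^sub>0 C m" "0 < C\<^sub>0" "0 < C"
    and n: "1 \<le> n" "trig_poly n T"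
    and E: "finite_union_of_intervals n E" "measure lebesgue E \<le> \<tau>"
    and U: "finite_union_of_intervals n U" "measure lebesgue U \<le> \<tau>" "2 * \<tau> \<le> m"
    and B: "B \<in> sets lebesgue" "B \<subseteq> U"
    and h: "continuous_on UNIV h" "\<And>t. t \<in> B \<Longrightarrow> norm (h t) \<le> 2 * \<Lambda>" "0 < \<Lambda>"
    and \<rho>: "continuous_on UNIV \<rho>" "\<And>t. t \<in> torus - U \<Longrightarrow> \<Lambda> * exp (2 * C * real n * \<tau>) \<le> \<rho> t"
  shows "N B (\<lambda>t. T t * h t) \<le> ennreal (2 * C\<^sub>0) * N (torus - (E \<union> B)) (\<lambda>t. T t * of_real (\<rho> t))"
proof -
  have cT: "continuous_on UNIV T" using n trig_poly_continuous by auto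
  have EU: "finite_union_of_intervals n (U \<union> E)" using finite_union_of_intervals_Un E U by auto
  have meas: "E \<in> sets lebesgue" "U \<in> sets lebesgue" using E U finite_union_of_intervals_measurable by auto
  have tor: "torus \<in> sets lebesgue" by (simp add: torus_def)
  have sub: "U \<subseteq> torus" using U finite_union_of_intervals_subset by auto
  have mEU: "measure lebesgue (U \<union> E) \<le> 2 * \<tau>" using measure_Un_le[OF meas(2,1)] E U by auto
  have 1: "N B (\<lambda>t. T t * h t) \<le> ennreal (2 * \<Lambda>) * N torus T"
  proof (rule lattice_norm_mono[OF N(1) B(1) tor])
    show "norm (T t * h t) \<le> 2 * \<Lambda> * norm (T t)" if "t \<in> B" for t
      using mult_left_mono[OF h(2)[OF that], of "norm (T t)"] by (simp add: norm_mult mult.commute)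
  qed (use B sub h cT in \<open>auto intro!: continuous_intros\<close>)
  have 2: "N torus T \<le> ennreal (C\<^sub>0 * exp (C * real n * measure lebesgue (U \<union> E))) * N (torus - (U \<union> E)) T"
    using N(2) EU mEU U(3) n unfolding remez_with_def by auto
  have "C * real n * measure lebesgue (U \<union> E) \<le> C * real n * (2 * \<tau>)"
    using mEU N(4) by (intro mult_left_mono) auto
  then have "C\<^sub>0 * exp (C * real n * measure lebesgue (U \<union> E)) \<le> C\<^sub>0 * exp (2 * C * real n * \<tau>)"
    using N(3) by (auto simp: mult_ac)
  note 2 = ennreal_const_mono[OF 2 this]
  let ?e = "exp (2 * C * real n * \<tau>)"
  have 3: "N (torus - (U \<union> E)) T \<le> ennreal (1 / (\<Lambda> * ?e)) * N (torus - (E \<union> B)) (\<lambda>t. T t * of_real (\<rho> t))"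
  proof (rule lattice_norm_mono[OF N(1)])
    fix t assume t: "t \<in> torus - (U \<union> E)"
    then have "\<Lambda> * ?e \<le> \<rho> t" using \<rho>(2) by auto
    moreover have "0 < \<Lambda> * ?e" using h by auto
    ultimately have "1 \<le> 1 / (\<Lambda> * ?e) * \<bar>\<rho> t\<bar>" by (auto simp: field_simps)
    from mult_left_mono[OF this, of "norm (T t)"]
    show "norm (T t) \<le> 1 / (\<Lambda> * ?e) * norm (T t * of_real (\<rho> t))" by (simp add: norm_mult mult_ac)
  qed (use meas tor B cT \<rho>(1) h in \<open>auto intro!: continuous_intros\<close>)
  have "N B (\<lambda>t. T t * h t) \<le> ennreal (2 * \<Lambda> * (C\<^sub>0 * ?e * (1 / (\<Lambda> * ?e)))) * N (torus - (E \<union> B)) (\<lambda>t. T t * of_real (\<rho> t))"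
    using N h by (intro ennreal_mult_trans[OF 1 ennreal_mult_trans[OF 2 3]]) auto
  moreover have "2 * \<Lambda> * (C\<^sub>0 * ?e * (1 / (\<Lambda> * ?e))) = 2 * C\<^sub>0" using h by (simp add: field_simps)
  ultimately show ?thesis by simp
qed

lemma lattice_norm_mono_mult:
  assumes "lattice_norm N" "S \<in> sets lebesgue" "S' \<in> sets lebesgue" "S \<subseteq> S'" "S' \<subseteq> torus"
    "continuous_on UNIV T" "continuous_on UNIV a" "continuous_on UNIV b" "0 < c"
    "\<And>t. t \<in> S \<Longrightarrow> norm (a t) \<le> c * norm (b t)"
  shows "N S (\<lambda>t. T t * a t) \<le> ennreal c * N S' (\<lambda>t. T t * b t)"
proof (rule lattice_norm_mono[OF assms(1-5)])
  show "norm (T t * a t) \<le> c * norm (T t * b t)" if "t \<in> S" for t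
    using mult_left_mono[OF assms(10)[OF that], of "norm (T t)"] by (simp add: norm_mult mult_ac)
qed (use assms in \<open>auto intro!: continuous_intros\<close>)

lemma lattice_norm_split:
  assumes "lattice_norm N"
  obtains K where "K > 0"
    "\<And>S B f. S \<in> sets lebesgue \<Longrightarrow> B \<in> sets lebesgue \<Longrightarrow> S \<subseteq> torus \<Longrightarrow> B \<subseteq> torus \<Longrightarrow>
        continuous_on UNIV f \<Longrightarrow> N S f \<le> ennreal K * (N (S - B) f + N B f)"
proof -
  obtain K where K: "K > 0" "\<And>E E' f. E \<in> sets lebesgue \<Longrightarrow> E' \<in> sets lebesgue \<Longrightarrow> E \<subseteq> torus \<Longrightarrow> E' \<subseteq> torus \<Longrightarrow>
        continuous_on UNIV f \<Longrightarrow> N (E \<union> E') f \<le> ennreal K * (N E f + N E' f)"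
    using assms unfolding lattice_norm_def by meson
  have "N S f \<le> ennreal K * (N (S - B) f + N B f)"
    if "S \<in> sets lebesgue" "B \<in> sets lebesgue" "S \<subseteq> torus" "B \<subseteq> torus" "continuous_on UNIV f" for S B f
  proof -
    have "N S f \<le> ennreal 1 * N ((S - B) \<union> B) f"
      using that by (intro lattice_norm_mono[OF assms]) auto
    also have "\<dots> \<le> ennreal 1 * (ennreal K * (N (S - B) f + N B f))"
      using that by (intro mult_left_mono K(2)) auto
    finally show ?thesis by simp
  qed
  then show thesis using that K(1) by blast
qed

text \<open>Off \<open>B\<close> the functions \<open>T \<rho>\<close> and \<open>T Q\<close> are comparable, and the Remez inequality holds for the
  polynomial \<open>T Q\<close>. The values on \<open>B\<close> are absorbed in one of two ways. If \<open>E\<close> is at most as large as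
  \<open>\<tau>\<close>, they are negligible even against the norm off \<open>E \<union> B\<close>. Otherwise \<open>U\<close> can be added to \<open>E\<close>, which at
  most doubles its measure.\<close>

theorem remez_times_norm:
  assumes N: "lattice_norm N" "remez N" and \<rho>: "mimicked \<rho>" "continuous_on UNIV \<rho>" "\<And>t. 0 \<le> \<rho> t"
  shows "remez (times_norm N \<rho>)"
proof -
  obtain C\<^sub>0 C m where C: "C\<^sub>0 > 0" "C > 0" "m > 0" "remez_with N C\<^sub>0 C m"
    using N(2) unfolding remez_def by auto
  obtain K where K: "K > 0"
    "\<And>S B f. S \<in> sets lebesgue \<Longrightarrow> B \<in> sets lebesgue \<Longrightarrow> S \<subseteq> torus \<Longrightarrow> B \<subseteq> torus \<Longrightarrow>
        continuous_on UNIV f \<Longrightarrow> N S f \<le> ennreal K * (N (S - B) f + N B f)"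
    using lattice_norm_split[OF N(1)] by blast
  \<comment> \<open>The gap constant is twice the Remez constant because \<open>U\<close> and \<open>E\<close> together may have measure \<open>2 * \<tau>\<close>;
  \<open>m / 4\<close> leaves room for their union.\<close>
  have "2 * C > 0" "m / 4 > 0" using C by auto
  from \<rho>(1)[unfolded mimicked_def, rule_format, OF this]
  obtain D n0 where n0: "1 \<le> n0" and data: "\<And>n. n0 \<le> n \<Longrightarrow> \<exists>\<tau> \<Lambda> B U Q.
     B \<in> sets lebesgue \<and> B \<subseteq> U \<and> finite_union_of_intervals n U \<and>
     measure lebesgue U \<le> \<tau> \<and> \<tau> \<le> m / 4 \<and> 0 < \<Lambda> \<and> trig_poly (D * n) Q \<and>
     (\<forall>t\<in>B. \<rho> t \<le> \<Lambda> \<and> norm (Q t) \<le> 2 * \<Lambda>) \<and>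
     (\<forall>t\<in>torus - B. \<rho> t \<le> 2 * norm (Q t) \<and> norm (Q t) \<le> 2 * \<rho> t) \<and>
     (\<forall>t\<in>torus - U. \<Lambda> * exp (2 * C * real n * \<tau>) \<le> \<rho> t)"
    by auto
  have tor: "torus \<in> sets lebesgue" by (simp add: torus_def)
  let ?C1 = "K * (2 * C\<^sub>0 * (K * (2 + 2 * C\<^sub>0)) + 2 * C\<^sub>0)" and ?C2 = "K * (1 + 2 * C\<^sub>0) * (4 * C\<^sub>0)"
  let ?C' = "2 * C * (1 + real D)"
  have "remez_with (times_norm N \<rho>) (?C1 + ?C2) (?C' * real n0) (m / 2)"
  proof (rule remez_from_large_degrees)
    fix n T E
    assume n: "n0 \<le> n" "1 \<le> n" and T: "trig_poly n T" and E: "finite_union_of_intervals n E" "measure lebesgue E \<le> m / 2"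
    obtain \<tau> \<Lambda> B U Q where B: "B \<in> sets lebesgue" "B \<subseteq> U" and U: "finite_union_of_intervals n U"
      "measure lebesgue U \<le> \<tau>" "\<tau> \<le> m / 4" and \<Lambda>: "0 < \<Lambda>" and Q: "trig_poly (D * n) Q" and
      onB: "\<And>t. t\<in>B \<Longrightarrow> \<rho> t \<le> \<Lambda> \<and> norm (Q t) \<le> 2 * \<Lambda>" and
      offB: "\<And>t. t\<in>torus - B \<Longrightarrow> \<rho> t \<le> 2 * norm (Q t) \<and> norm (Q t) \<le> 2 * \<rho> t" and
      offU: "\<And>t. t\<in>torus - U \<Longrightarrow> \<Lambda> * exp (2 * C * real n * \<tau>) \<le> \<rho> t"
      using data[OF n(1)] by auto
    have sub: "U \<subseteq> torus" "E \<subseteq> torus" "B \<subseteq> torus" using U E B finite_union_of_intervals_subset by blast+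
    have meas: "E \<in> sets lebesgue" "U \<in> sets lebesgue" using E U finite_union_of_intervals_measurable by auto
    have \<tau>: "0 \<le> \<tau>" using order_trans[OF measure_nonneg U(2)] .
    have cont: "continuous_on UNIV T" "continuous_on UNIV Q" "continuous_on UNIV (\<lambda>t. complex_of_real (\<rho> t))"
      using T Q \<rho> trig_poly_continuous by (auto intro!: continuous_intros)
    define F where "F = (\<lambda>t. T t * of_real (\<rho> t))"
    define G where "G = (\<lambda>t. T t * Q t)"
    have cF: "continuous_on UNIV F" and cG: "continuous_on UNIV G"
      unfolding F_def G_def using cont by (auto intro!: continuous_intros)
    have G: "trig_poly (n + D * n) G" unfolding G_def by (rule trig_poly_mult[OF T Q])
    have FG: "N S F \<le> ennreal 2 * N S' G" "N S G \<le> ennreal 2 * N S' F"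
      if "S \<in> sets lebesgue" "S' \<in> sets lebesgue" "S \<subseteq> S'" "S' \<subseteq> torus" "S \<inter> B = {}" for S S'
      unfolding F_def G_def using offB that \<rho>(3)
      by (intro lattice_norm_mono_mult[OF N(1)] cont; fastforce)+
    have FF: "N S F \<le> ennreal 1 * N S' F"
      if "S \<in> sets lebesgue" "S' \<in> sets lebesgue" "S \<subseteq> S'" "S' \<subseteq> torus" for S S'
      using that cF by (intro lattice_norm_mono[OF N(1)]) auto
    have core: "N B F \<le> ennreal (2 * C\<^sub>0) * N (torus - (E' \<union> B)) F" "N B G \<le> ennreal (2 * C\<^sub>0) * N (torus - (E' \<union> B)) F"
      if "finite_union_of_intervals n E'" "measure lebesgue E' \<le> \<tau>" for E'
      unfolding F_def G_def using onB \<rho>(3) \<Lambda> U C n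
      by (intro core_is_negligible[OF N(1) C(4,1,2) n(2) T that U(1,2) _ B _ _ \<Lambda> \<rho>(2)] cont offU; fastforce)+
    have remG: "N torus G \<le> ennreal (C\<^sub>0 * exp (C * real (n + D * n) * measure lebesgue E')) * N (torus - E') G"
      if "finite_union_of_intervals n E'" "measure lebesgue E' \<le> m" for E'
      using C(4)[unfolded remez_with_def, rule_format, OF _ G _ that(2)] that(1) n finite_union_of_intervals_mono by auto
    define e where "e = exp (?C' * real n * measure lebesgue E)"
    have e1: "1 \<le> e" unfolding e_def using C by auto
    have "N torus F \<le> ennreal ((?C1 + ?C2) * e) * N (torus - E) F"
    proof (cases "measure lebesgue E \<le> \<tau>")
      case True
      have "C * real (n + D * n) * measure lebesgue E \<le> ?C' * real n * measure lebesgue E"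
        using C by (intro mult_right_mono) (auto simp: algebra_simps)
      then have "C\<^sub>0 * exp (C * real (n + D * n) * measure lebesgue E) \<le> C\<^sub>0 * e"
        unfolding e_def using C by simp
      note 1 = ennreal_const_mono[OF remG[OF E(1)] this]
      have 2: "N (torus - E) G \<le> ennreal K * (N (torus - E - B) G + N B G)"
        using K(2) meas tor B sub cG by auto
      have eq: "torus - E - B = torus - (E \<union> B)" by auto
      have 3: "N (torus - E - B) G \<le> ennreal 2 * N (torus - E) F"
        using meas tor B by (intro FG(2)) auto
      have 4: "N (torus - (E \<union> B)) F \<le> ennreal 1 * N (torus - E) F"
        using meas tor B by (intro FF) auto
      have 5: "N B G \<le> ennreal (2 * C\<^sub>0) * N (torus - E) F" "N B F \<le> ennreal (2 * C\<^sub>0) * N (torus - E) F"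
        using ennreal_mult_trans[OF core(2)[OF E(1) True] 4] ennreal_mult_trans[OF core(1)[OF E(1) True] 4] C by auto
      have 6: "N (torus - E) G \<le> ennreal (K * (2 + 2 * C\<^sub>0)) * N (torus - E) F"
        using K C by (intro ennreal_split_bound[OF 2 3 5(1)]) auto
      have 7: "N (torus - B) F \<le> ennreal 2 * N torus G" using tor B by (intro FG) auto
      have 8: "N (torus - B) F \<le> ennreal (2 * (C\<^sub>0 * e * (K * (2 + 2 * C\<^sub>0)))) * N (torus - E) F"
        using C K e1 E by (intro ennreal_mult_trans[OF 7 ennreal_mult_trans[OF 1 6]]) auto
      have "N torus F \<le> ennreal K * (N (torus - B) F + N B F)" using K(2) tor B sub cF by auto
      then have "N torus F \<le> ennreal (K * (2 * (C\<^sub>0 * e * (K * (2 + 2 * C\<^sub>0))) + 2 * C\<^sub>0)) * N (torus - E) F"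
        using K C e1 by (intro ennreal_split_bound[OF _ 8 5(2)]) auto
      moreover have "K * (2 * (C\<^sub>0 * e * (K * (2 + 2 * C\<^sub>0))) + 2 * C\<^sub>0) \<le> (?C1 + ?C2) * e"
      proof -
        have "K * (2 * C\<^sub>0) * 1 \<le> K * (2 * C\<^sub>0) * e" using e1 K C by (intro mult_left_mono) auto
        moreover have "0 \<le> ?C2 * e" using e1 K C by auto
        ultimately show ?thesis by (simp add: algebra_simps)
      qed
      ultimately show ?thesis by (rule ennreal_const_mono)
    next
      case False
      have EU: "finite_union_of_intervals n (E \<union> U)" using finite_union_of_intervals_Un E U by auto
      have mEU: "measure lebesgue (E \<union> U) \<le> 2 * measure lebesgue E"
        using measure_Un_le[OF meas] U False by auto
      have 0: "N torus F \<le> ennreal K * (N (torus - B) F + N B F)" using K(2) tor B sub cF by auto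
      have 1: "N (torus - B) F \<le> ennreal 1 * N (torus - B) F" by simp
      have 2: "N B F \<le> ennreal (2 * C\<^sub>0) * N (torus - B) F"
        using core(1)[OF finite_union_of_intervals_empty] \<tau> by auto
      have 3: "N torus F \<le> ennreal (K * (1 + 2 * C\<^sub>0)) * N (torus - B) F"
        using K C by (intro ennreal_split_bound[OF 0 1 2]) auto
      have 4: "N (torus - B) F \<le> ennreal 2 * N torus G" using tor B by (intro FG) auto
      have 5: "N torus G \<le> ennreal (C\<^sub>0 * exp (C * real (n + D * n) * measure lebesgue (E \<union> U))) * N (torus - (E \<union> U)) G"
        using remG[OF EU] mEU E by auto
      have "C * real (n + D * n) * measure lebesgue (E \<union> U) \<le> C * real (n + D * n) * (2 * measure lebesgue E)"
        using C mEU by (intro mult_left_mono) auto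
      also have "\<dots> = ?C' * real n * measure lebesgue E" by (simp add: algebra_simps)
      finally have "C\<^sub>0 * exp (C * real (n + D * n) * measure lebesgue (E \<union> U)) \<le> C\<^sub>0 * e"
        unfolding e_def using C by simp
      note 5 = ennreal_const_mono[OF 5 this]
      have 6: "N (torus - (E \<union> U)) G \<le> ennreal 2 * N (torus - E) F"
        using meas tor B by (intro FG) auto
      have "N torus F \<le> ennreal (K * (1 + 2 * C\<^sub>0) * (2 * (C\<^sub>0 * e * 2))) * N (torus - E) F"
        using C K e1 by (intro ennreal_mult_trans[OF 3 ennreal_mult_trans[OF 4 ennreal_mult_trans[OF 5 6]]]) auto
      moreover have "K * (1 + 2 * C\<^sub>0) * (2 * (C\<^sub>0 * e * 2)) = ?C2 * e" by simp
      moreover have "?C2 * e \<le> (?C1 + ?C2) * e" using C K e1 by (intro mult_right_mono) auto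
      ultimately show ?thesis by (metis ennreal_const_mono)
    qed
    then show "times_norm N \<rho> torus T
        \<le> ennreal ((?C1 + ?C2) * exp (?C' * real n * measure lebesgue E)) * times_norm N \<rho> (torus - E) T"
      unfolding times_norm_def F_def e_def .
  qed (use n0 C K in auto)
  then show ?thesis unfolding remez_def using C K n0
    by (intro exI[of _ "?C1 + ?C2"] exI[of _ "?C' * real n0"] exI[of _ "m / 2"] conjI) (auto intro!: mult_pos_pos add_pos_nonneg)
qed

text \<open>The assumed inequality is applied to \<open>T Q\<close>; the core is discarded before (for \<open>T \<rho>\<close> in the first
  norm) and after (for \<open>T Q\<close> in the second).\<close>

theorem nikolskii_times_norm:
  assumes N: "lattice_norm N" "remez N" and N': "lattice_norm N'" "remez N'"
    and nik: "nikolskii N N' \<gamma>" "0 \<le> \<gamma>"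
    and \<rho>: "mimicked \<rho>" "continuous_on UNIV \<rho>" "\<And>t. 0 \<le> \<rho> t"
  shows "nikolskii (times_norm N \<rho>) (times_norm N' \<rho>) \<gamma>"
proof -
  obtain c0 c m1 where c: "c0 > 0" "c > 0" "m1 > 0" "remez_with N c0 c m1"
    using N(2) unfolding remez_def by auto
  obtain d0 d m2 where d: "d0 > 0" "d > 0" "m2 > 0" "remez_with N' d0 d m2"
    using N'(2) unfolding remez_def by auto
  \<comment> \<open>One mimicking polynomial has to serve both norms, so their Remez constants are merged.\<close>
  define C\<^sub>0 C m where "C\<^sub>0 = max c0 d0" and "C = max c d" and "m = min m1 m2"
  have C: "C\<^sub>0 > 0" "C > 0" "m > 0" "remez_with N C\<^sub>0 C m" "remez_with N' C\<^sub>0 C m"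
    using c d remez_with_weaken[OF c(4), of C\<^sub>0 C m] remez_with_weaken[OF d(4), of C\<^sub>0 C m]
    unfolding C\<^sub>0_def C_def m_def by auto
  obtain L where L: "L > 0" "\<And>n T. 1 \<le> n \<Longrightarrow> trig_poly n T \<Longrightarrow> N torus T \<le> ennreal (L * real n powr \<gamma>) * N' torus T"
    using nik(1) unfolding nikolskii_def by auto
  obtain K where K: "K > 0"
    "\<And>S B f. S \<in> sets lebesgue \<Longrightarrow> B \<in> sets lebesgue \<Longrightarrow> S \<subseteq> torus \<Longrightarrow> B \<subseteq> torus \<Longrightarrow>
        continuous_on UNIV f \<Longrightarrow> N S f \<le> ennreal K * (N (S - B) f + N B f)"
    using lattice_norm_split[OF N(1)] by blast
  obtain K' where K': "K' > 0"
    "\<And>S B f. S \<in> sets lebesgue \<Longrightarrow> B \<in> sets lebesgue \<Longrightarrow> S \<subseteq> torus \<Longrightarrow> B \<subseteq> torus \<Longrightarrow>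
        continuous_on UNIV f \<Longrightarrow> N' S f \<le> ennreal K' * (N' (S - B) f + N' B f)"
    using lattice_norm_split[OF N'(1)] by blast
  have "2 * C > 0" "m / 2 > 0" using C by auto
  from \<rho>(1)[unfolded mimicked_def, rule_format, OF this]
  obtain D n0 where n0: "1 \<le> n0" and data: "\<And>n. n0 \<le> n \<Longrightarrow> \<exists>\<tau> \<Lambda> B U Q.
     B \<in> sets lebesgue \<and> B \<subseteq> U \<and> finite_union_of_intervals n U \<and>
     measure lebesgue U \<le> \<tau> \<and> \<tau> \<le> m / 2 \<and> 0 < \<Lambda> \<and> trig_poly (D * n) Q \<and>
     (\<forall>t\<in>B. \<rho> t \<le> \<Lambda> \<and> norm (Q t) \<le> 2 * \<Lambda>) \<and>
     (\<forall>t\<in>torus - B. \<rho> t \<le> 2 * norm (Q t) \<and> norm (Q t) \<le> 2 * \<rho> t) \<and>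
     (\<forall>t\<in>torus - U. \<Lambda> * exp (2 * C * real n * \<tau>) \<le> \<rho> t)"
    by auto
  have tor: "torus \<in> sets lebesgue" by (simp add: torus_def)
  let ?A = "K * (1 + 2 * C\<^sub>0) * 2 * L * (K' * (2 + 2 * C\<^sub>0))"
  have large: "times_norm N \<rho> torus T \<le> ennreal (?A * real (n + D * n) powr \<gamma>) * times_norm N' \<rho> torus T"
    if n: "n0 \<le> n" and T: "trig_poly n T" for n T
  proof -
    have n1: "1 \<le> n" using n n0 by auto
    obtain \<tau> \<Lambda> B U Q where B: "B \<in> sets lebesgue" "B \<subseteq> U" and U: "finite_union_of_intervals n U"
      "measure lebesgue U \<le> \<tau>" "\<tau> \<le> m / 2" and \<Lambda>: "0 < \<Lambda>" and Q: "trig_poly (D * n) Q" and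
      onB: "\<And>t. t\<in>B \<Longrightarrow> \<rho> t \<le> \<Lambda> \<and> norm (Q t) \<le> 2 * \<Lambda>" and
      offB: "\<And>t. t\<in>torus - B \<Longrightarrow> \<rho> t \<le> 2 * norm (Q t) \<and> norm (Q t) \<le> 2 * \<rho> t" and
      offU: "\<And>t. t\<in>torus - U \<Longrightarrow> \<Lambda> * exp (2 * C * real n * \<tau>) \<le> \<rho> t"
      using data[OF n] by auto
    have sub: "B \<subseteq> torus" using U B finite_union_of_intervals_subset by blast
    have \<tau>: "0 \<le> \<tau>" using order_trans[OF measure_nonneg U(2)] .
    have cont: "continuous_on UNIV T" "continuous_on UNIV Q" "continuous_on UNIV (\<lambda>t. complex_of_real (\<rho> t))"
      using T Q \<rho> trig_poly_continuous by (auto intro!: continuous_intros)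
    define F where "F = (\<lambda>t. T t * of_real (\<rho> t))"
    define G where "G = (\<lambda>t. T t * Q t)"
    have cF: "continuous_on UNIV F" and cG: "continuous_on UNIV G"
      unfolding F_def G_def using cont by (auto intro!: continuous_intros)
    have G: "trig_poly (n + D * n) G" unfolding G_def by (rule trig_poly_mult[OF T Q])
    have core: "N B F \<le> ennreal (2 * C\<^sub>0) * N (torus - ({} \<union> B)) F"
      unfolding F_def using onB \<rho>(3) \<Lambda> U \<tau>
      by (intro core_is_negligible[OF N(1) C(4,1,2) n1 T finite_union_of_intervals_empty _ U(1,2) _ B _ _ \<Lambda> \<rho>(2)] cont offU; fastforce)
    have core': "N' B G \<le> ennreal (2 * C\<^sub>0) * N' (torus - ({} \<union> B)) F"
      unfolding F_def G_def using onB \<rho>(3) \<Lambda> U \<tau>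
      by (intro core_is_negligible[OF N'(1) C(5,1,2) n1 T finite_union_of_intervals_empty _ U(1,2) _ B _ _ \<Lambda> \<rho>(2)] cont offU; fastforce)
    have 0: "N torus F \<le> ennreal K * (N (torus - B) F + N B F)" using K(2) tor B sub cF by auto
    have 1: "N torus F \<le> ennreal (K * (1 + 2 * C\<^sub>0)) * N (torus - B) F"
      using core K C by (intro ennreal_split_bound[OF 0]) auto
    have 2: "N (torus - B) F \<le> ennreal 2 * N torus G"
      unfolding F_def G_def using offB tor B \<rho>(3)
      by (intro lattice_norm_mono_mult[OF N(1)] cont; fastforce)
    have 3: "N torus G \<le> ennreal (L * real (n + D * n) powr \<gamma>) * N' torus G"
      using n1 by (intro L(2) G) auto
    have 4: "N' torus G \<le> ennreal K' * (N' (torus - B) G + N' B G)" using K'(2) tor B sub cG by auto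
    have 5: "N' (torus - B) G \<le> ennreal 2 * N' torus F"
      unfolding F_def G_def using offB tor B \<rho>(3)
      by (intro lattice_norm_mono_mult[OF N'(1)] cont; fastforce)
    have 6: "N' (torus - ({} \<union> B)) F \<le> ennreal 1 * N' torus F"
      using tor B cF by (intro lattice_norm_mono[OF N'(1)]) auto
    have 7: "N' B G \<le> ennreal (2 * C\<^sub>0) * N' torus F"
      using ennreal_mult_trans[OF core' 6] C by auto
    have 8: "N' torus G \<le> ennreal (K' * (2 + 2 * C\<^sub>0)) * N' torus F"
      using K' C by (intro ennreal_split_bound[OF 4 5 7]) auto
    have "N torus F \<le> ennreal (K * (1 + 2 * C\<^sub>0) * (2 * (L * real (n + D * n) powr \<gamma> * (K' * (2 + 2 * C\<^sub>0))))) * N' torus F"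
      using C K K' L
      by (intro ennreal_mult_trans[OF 1 ennreal_mult_trans[OF 2 ennreal_mult_trans[OF 3 8]]]) auto
    then show ?thesis unfolding times_norm_def F_def by (simp only: mult_ac)
  qed
  have "times_norm N \<rho> torus T \<le> ennreal (?A * real (n0 * (1 + D)) powr \<gamma> * real n powr \<gamma>) * times_norm N' \<rho> torus T"
    if n: "1 \<le> n" and T: "trig_poly n T" for n T
  proof -
    have "n0 \<le> n0 * n" "n \<le> n0 * n" using n n0 by auto
    then have "times_norm N \<rho> torus T \<le> ennreal (?A * real (n0 * n + D * (n0 * n)) powr \<gamma>) * times_norm N' \<rho> torus T"
      using trig_poly_mono[OF T] by (intro large) auto
    moreover have "real (n0 * n + D * (n0 * n)) = real (n0 * (1 + D)) * real n"
      by (simp add: algebra_simps)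
    moreover have "(real (n0 * (1 + D)) * real n) powr \<gamma> = real (n0 * (1 + D)) powr \<gamma> * real n powr \<gamma>"
      by (rule powr_mult)
    ultimately show ?thesis by (simp only: mult_ac)
  qed
  moreover have "?A * real (n0 * (1 + D)) powr \<gamma> > 0"
  proof -
    have "0 < n0 * (1 + D)" using n0 by simp
    then have "real (n0 * (1 + D)) > 0" by (rule of_nat_0_less_iff[THEN iffD2])
    then have "real (n0 * (1 + D)) powr \<gamma> > 0" by (simp only: powr_gt_zero)
    then show ?thesis using C K K' L by (intro mult_pos_pos) auto
  qed
  ultimately show ?thesis unfolding nikolskii_def by blast
qed

section \<open>Weighted norms\<close>

lemma ennreal_powr_mono:
  assumes "x \<le> y" "0 \<le> a" shows "ennreal_powr x a \<le> ennreal_powr y a"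
proof (cases "y = \<infinity>")
  case False
  then have "x \<noteq> \<infinity>" using assms(1) by (auto simp: top_unique)
  with False assms show ?thesis
    by (auto simp: ennreal_powr_def less_top intro!: ennreal_leI powr_mono2 enn2real_mono)
qed (simp add: ennreal_powr_def)

lemma ennreal_powr_cmult:
  assumes "0 < c" "0 < a" shows "ennreal_powr (ennreal c * x) a = ennreal (c powr a) * ennreal_powr x a"
proof (cases "x = \<infinity>")
  case True
  then show ?thesis using assms by (simp add: ennreal_powr_def ennreal_mult_top)
next
  case False
  then have "ennreal c * x \<noteq> \<infinity>" by (simp add: ennreal_mult_eq_top_iff)
  with False assms show ?thesis
    by (simp add: ennreal_powr_def enn2real_mult powr_mult ennreal_mult)
qed

lemma ennreal_powr_add_le:
  assumes "0 < a" shows "ennreal_powr (x + y) a \<le> ennreal (2 powr a) * (ennreal_powr x a + ennreal_powr y a)"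
proof -
  have "x + y \<le> ennreal 2 * max x y"
    by (metis add_mono ennreal_numeral max.cobounded1 max.cobounded2 mult_2)
  then have "ennreal_powr (x + y) a \<le> ennreal_powr (ennreal 2 * max x y) a"
    using assms by (intro ennreal_powr_mono) auto
  also have "\<dots> = ennreal (2 powr a) * ennreal_powr (max x y) a"
    using assms by (intro ennreal_powr_cmult) auto
  also have "ennreal_powr (max x y) a \<le> ennreal_powr x a + ennreal_powr y a"
    by (simp add: max_def)
  finally show ?thesis by (simp add: mult_left_mono)
qed

lemma lattice_norm_Lp_norm:
  assumes r: "0 < r" and v: "v \<in> borel_measurable (lebesgue_on torus)" "\<And>t. 0 \<le> v t"
  shows "lattice_norm (Lp_norm r v)"
proof -
  have tor: "torus \<in> sets lebesgue" by (simp add: torus_def)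
  have vE: "v \<in> borel_measurable (lebesgue_on E)" if "E \<subseteq> torus" for E
    using measurable_restrict_mono[OF v(1) that] .
  have fE: "f \<in> borel_measurable (lebesgue_on E)" if "continuous_on UNIV f" for f :: "real \<Rightarrow> complex" and E
  proof -
    have "f \<in> borel_measurable lebesgue"
      using that by (simp add: borel_measurable_continuous_onI measurable_completion)
    then show ?thesis by (rule measurable_restrict_space1)
  qed
  show ?thesis
  proof (cases "r = \<infinity>")
    case True
    have m: "(\<lambda>t. ennreal \<bar>norm (f t) * v t\<bar>) \<in> borel_measurable (lebesgue_on E)"
      if "continuous_on UNIV f" "E \<subseteq> torus" for f :: "real \<Rightarrow> complex" and E
      using vE[OF that(2)] fE[OF that(1), of E] by measurable
    have AE: "AE t in lebesgue. t \<in> E \<longrightarrow> ennreal \<bar>norm (f t) * v t\<bar> \<le> Lp_norm r v E f"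
      if "E \<in> sets lebesgue" for E and f :: "real \<Rightarrow> complex"
      using esssup_AE[where M = "lebesgue_on E" and f = "\<lambda>t. ennreal \<bar>norm (f t) * v t\<bar>"] that True
      by (subst (asm) AE_restrict_space_iff) (auto simp: Lp_norm_def)
    have le: "Lp_norm r v E f \<le> c"
      if "E \<in> sets lebesgue" "continuous_on UNIV f" "E \<subseteq> torus" "AE t in lebesgue. t \<in> E \<longrightarrow> ennreal \<bar>norm (f t) * v t\<bar> \<le> c"
      for E c and f :: "real \<Rightarrow> complex"
    proof -
      have "esssup (lebesgue_on E) (\<lambda>t. ennreal \<bar>norm (f t) * v t\<bar>) \<le> c"
        using that by (intro esssup_I m) (auto simp: AE_restrict_space_iff)
      then show ?thesis using True by (simp add: Lp_norm_def)
    qed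
    show ?thesis unfolding lattice_norm_def
    proof (intro conjI allI impI)
      fix E E' and f h :: "real \<Rightarrow> complex" and c :: real
      assume *: "c > 0" "E \<in> sets lebesgue" "E' \<in> sets lebesgue" "E \<subseteq> E'" "E' \<subseteq> torus"
        "continuous_on UNIV f" "continuous_on UNIV h" "\<forall>t\<in>E. norm (f t) \<le> c * norm (h t)"
      have "AE t in lebesgue. t \<in> E \<longrightarrow> ennreal \<bar>norm (f t) * v t\<bar> \<le> ennreal c * Lp_norm r v E' h"
        using AE[OF *(3), of h]
      proof eventually_elim
        case (elim t)
        show ?case
        proof
          assume t: "t \<in> E"
          then have "\<bar>norm (f t) * v t\<bar> \<le> c * \<bar>norm (h t) * v t\<bar>"
            using *(8) v(2)[of t] by (auto simp: abs_mult mult.assoc[symmetric] intro!: mult_right_mono)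
          then have "ennreal \<bar>norm (f t) * v t\<bar> \<le> ennreal c * ennreal \<bar>norm (h t) * v t\<bar>"
            using *(1) by (simp add: ennreal_mult[symmetric] ennreal_leI)
          also have "\<dots> \<le> ennreal c * Lp_norm r v E' h"
            using elim t *(4) by (intro mult_left_mono) auto
          finally show "ennreal \<bar>norm (f t) * v t\<bar> \<le> ennreal c * Lp_norm r v E' h" .
        qed
      qed
      then show "Lp_norm r v E f \<le> ennreal c * Lp_norm r v E' h" using * by (intro le) auto
    next
      show "\<exists>K>0. \<forall>E E' f. E \<in> sets lebesgue \<longrightarrow> E' \<in> sets lebesgue \<longrightarrow> E \<subseteq> torus \<longrightarrow> E' \<subseteq> torus \<longrightarrow>
        continuous_on UNIV f \<longrightarrow> Lp_norm r v (E \<union> E') f \<le> ennreal K * (Lp_norm r v E f + Lp_norm r v E' f)"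
      proof (intro exI[of _ 1] conjI allI impI)
        fix E E' and f :: "real \<Rightarrow> complex"
        assume *: "E \<in> sets lebesgue" "E' \<in> sets lebesgue" "E \<subseteq> torus" "E' \<subseteq> torus" "continuous_on UNIV f"
        have "AE t in lebesgue. t \<in> E \<union> E' \<longrightarrow> ennreal \<bar>norm (f t) * v t\<bar> \<le> Lp_norm r v E f + Lp_norm r v E' f"
          using AE[OF *(1), of f] AE[OF *(2), of f]
          by eventually_elim (auto intro: add_increasing add_increasing2)
        then have "Lp_norm r v (E \<union> E') f \<le> Lp_norm r v E f + Lp_norm r v E' f" using * by (intro le) auto
        then show "Lp_norm r v (E \<union> E') f \<le> ennreal 1 * (Lp_norm r v E f + Lp_norm r v E' f)" by simp
      qed simp
    qed
  next
    case False
    define p where "p = enn2real r"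
    have p: "0 < p" using r False unfolding p_def by (simp add: enn2real_positive_iff less_top)
    define I where "I = (\<lambda>E (f :: real \<Rightarrow> complex). \<integral>\<^sup>+ t. ennreal (norm (f t) powr p * v t) * indicator E t \<partial>lebesgue)"
    have Lp: "Lp_norm r v E f = ennreal_powr (I E f) (1 / p)" if "E \<in> sets lebesgue" for E f
      using False that unfolding Lp_norm_def I_def p_def by (simp add: nn_integral_restrict_space)
    have m: "(\<lambda>t. ennreal (norm (f t) powr p * v t) * indicator E t) \<in> borel_measurable lebesgue"
      if "E \<in> sets lebesgue" "continuous_on UNIV f" "E \<subseteq> torus" for E and f :: "real \<Rightarrow> complex"
    proof -
      have "(\<lambda>t. ennreal (norm (f t) powr p * v t)) \<in> borel_measurable (lebesgue_on E)"
        using vE[OF that(3)] fE[OF that(2), of E] by measurable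
      then show ?thesis using that(1) by (subst (asm) borel_measurable_restrict_space_iff_ennreal) auto
    qed
    show ?thesis unfolding lattice_norm_def
    proof (intro conjI allI impI)
      fix E E' and f h :: "real \<Rightarrow> complex" and c :: real
      assume *: "c > 0" "E \<in> sets lebesgue" "E' \<in> sets lebesgue" "E \<subseteq> E'" "E' \<subseteq> torus"
        "continuous_on UNIV f" "continuous_on UNIV h" "\<forall>t\<in>E. norm (f t) \<le> c * norm (h t)"
      have "I E f \<le> (\<integral>\<^sup>+ t. ennreal (c powr p) * (ennreal (norm (h t) powr p * v t) * indicator E' t) \<partial>lebesgue)"
        unfolding I_def
      proof (intro nn_integral_mono)
        fix t
        show "ennreal (norm (f t) powr p * v t) * indicator E t
            \<le> ennreal (c powr p) * (ennreal (norm (h t) powr p * v t) * indicator E' t)"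
        proof (cases "t \<in> E")
          case True
          have "norm (f t) powr p \<le> (c * norm (h t)) powr p"
            using *(8) True p by (intro powr_mono2) auto
          also have "\<dots> = c powr p * norm (h t) powr p" by (rule powr_mult)
          finally have "norm (f t) powr p * v t \<le> c powr p * (norm (h t) powr p * v t)"
            using v(2)[of t] by (simp add: mult.assoc[symmetric] mult_right_mono)
          then show ?thesis using True *(4) v(2)[of t]
            by (auto simp: ennreal_mult[symmetric] ennreal_leI)
        qed simp
      qed
      also have "\<dots> = ennreal (c powr p) * I E' h"
        unfolding I_def using m[OF *(3,7,5)] by (rule nn_integral_cmult)
      finally have "ennreal_powr (I E f) (1 / p) \<le> ennreal_powr (ennreal (c powr p) * I E' h) (1 / p)"
        using p by (intro ennreal_powr_mono) auto
      also have "\<dots> = ennreal c * ennreal_powr (I E' h) (1 / p)"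
        using p *(1) by (subst ennreal_powr_cmult) (auto simp: powr_powr)
      finally show "Lp_norm r v E f \<le> ennreal c * Lp_norm r v E' h" using Lp * by simp
    next
      show "\<exists>K>0. \<forall>E E' f. E \<in> sets lebesgue \<longrightarrow> E' \<in> sets lebesgue \<longrightarrow> E \<subseteq> torus \<longrightarrow> E' \<subseteq> torus \<longrightarrow>
        continuous_on UNIV f \<longrightarrow> Lp_norm r v (E \<union> E') f \<le> ennreal K * (Lp_norm r v E f + Lp_norm r v E' f)"
      proof (intro exI[of _ "2 powr (1 / p)"] conjI allI impI)
        fix E E' and f :: "real \<Rightarrow> complex"
        assume *: "E \<in> sets lebesgue" "E' \<in> sets lebesgue" "E \<subseteq> torus" "E' \<subseteq> torus" "continuous_on UNIV f"
        have "I (E \<union> E') f \<le> (\<integral>\<^sup>+ t. ennreal (norm (f t) powr p * v t) * indicator E t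
            + ennreal (norm (f t) powr p * v t) * indicator E' t \<partial>lebesgue)"
          unfolding I_def by (intro nn_integral_mono) (auto simp: indicator_def)
        also have "\<dots> = I E f + I E' f" unfolding I_def using m * by (intro nn_integral_add) auto
        finally have "ennreal_powr (I (E \<union> E') f) (1 / p) \<le> ennreal_powr (I E f + I E' f) (1 / p)"
          using p by (intro ennreal_powr_mono) auto
        also have "\<dots> \<le> ennreal (2 powr (1 / p)) * (ennreal_powr (I E f) (1 / p) + ennreal_powr (I E' f) (1 / p))"
          using p by (intro ennreal_powr_add_le) auto
        finally show "Lp_norm r v (E \<union> E') f \<le> ennreal (2 powr (1 / p)) * (Lp_norm r v E f + Lp_norm r v E' f)"
          using Lp * by simp
      qed simp
    qed
  qed
qed

lemma weight_measurable:
  assumes "weight w" shows "w \<in> borel_measurable (lebesgue_on torus)"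
proof -
  have "(\<lambda>x. indicator torus x *\<^sub>R w x) \<in> borel_measurable lebesgue"
    using assms unfolding weight_def set_integrable_def by (auto dest: borel_measurable_integrable)
  then show ?thesis by (subst borel_measurable_restrict_space_iff) (auto simp: torus_def)
qed

lemma R_int_remez:
  assumes "u \<in> R_int p" shows "remez (Lp_norm p u)"
proof -
  obtain C where C: "C > 0" "\<And>n T E. 1 \<le> n \<Longrightarrow> trig_poly n T \<Longrightarrow> finite_union_of_intervals n E \<Longrightarrow>
      measure lebesgue E \<le> 1 \<Longrightarrow>
      Lp_norm p u torus T \<le> ennreal (exp (C * real n * measure lebesgue E)) * Lp_norm p u (torus - E) T"
    using assms unfolding R_int_def by blast
  then have "remez_with (Lp_norm p u) 1 C 1" by (simp add: remez_with_def)
  then show ?thesis using C(1) unfolding remez_def by (meson zero_less_one)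
qed

lemma R_int_lattice_norm:
  assumes "u \<in> R_int p" "0 < p" shows "lattice_norm (Lp_norm p u)"
proof -
  have "weight u" using assms by (simp add: R_int_def)
  then show ?thesis using weight_measurable assms(2) by (intro lattice_norm_Lp_norm) (auto simp: weight_def)
qed

text \<open>A factor of the weight enters the norm to the power \<open>1 / q\<close>; for \<open>q = \<infinity>\<close> it enters to the first power.
  In these identities the same function multiplies the polynomial in the \<open>q\<close>-norm and in the \<open>p\<close>-norm with
  weight raised to the power \<open>p / q\<close>.\<close>

lemma Lp_norm_times_weight:
  assumes "0 < q" "q < \<infinity>" "\<And>t. 0 \<le> \<omega> t" "\<And>t. 0 \<le> u t"
  shows "Lp_norm q (\<lambda>t. \<omega> t * u t) = times_norm (Lp_norm q u) (\<lambda>t. \<omega> t powr (1 / enn2real q))"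
proof -
  have q: "0 < enn2real q" using assms(1,2) by (simp add: enn2real_positive_iff)
  have "norm (f t) powr enn2real q * (\<omega> t * u t)
      = norm (f t * of_real (\<omega> t powr (1 / enn2real q))) powr enn2real q * u t" for f :: "real \<Rightarrow> complex" and t
    using q assms(3)[of t] by (simp add: norm_mult powr_mult powr_powr)
  moreover have "q \<noteq> \<infinity>" using assms(2) by auto
  ultimately show ?thesis unfolding fun_eq_iff Lp_norm_def times_norm_def by (simp only: if_False) simp
qed

lemma Lp_norm_times_weight_powr:
  assumes "0 < p" "p < \<infinity>" "\<And>t. 0 \<le> \<omega> t" "\<And>t. 0 \<le> u t"
  shows "Lp_norm p (\<lambda>t. (\<omega> t * u t) powr (enn2real p * a))
    = times_norm (Lp_norm p (\<lambda>t. u t powr (enn2real p * a))) (\<lambda>t. \<omega> t powr a)"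
proof -
  have p: "0 < enn2real p" using assms(1,2) by (simp add: enn2real_positive_iff)
  have "norm (f t) powr enn2real p * ((\<omega> t * u t) powr (enn2real p * a))
      = norm (f t * of_real (\<omega> t powr a)) powr enn2real p * u t powr (enn2real p * a)" for f :: "real \<Rightarrow> complex" and t
    using p assms(3)[of t] assms(4)[of t] by (simp add: norm_mult powr_mult powr_powr mult_ac)
  moreover have "p \<noteq> \<infinity>" using assms(2) by auto
  ultimately show ?thesis unfolding fun_eq_iff Lp_norm_def times_norm_def by (simp only: if_False) simp
qed

lemma Lp_norm_infinity_times_weight:
  assumes "\<And>t. 0 \<le> \<omega> t"
  shows "Lp_norm \<infinity> (\<lambda>t. \<omega> t * u t) = times_norm (Lp_norm \<infinity> u) \<omega>"
  using assms by (simp add: fun_eq_iff Lp_norm_def times_norm_def norm_mult mult.assoc)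

section \<open>Approximating smooth periodic functions by Fourier sums\<close>

definition fourier_integral :: "(real \<Rightarrow> complex) \<Rightarrow> int \<Rightarrow> complex" where
  "fourier_integral f m = integral {0..2 * pi} (\<lambda>t. f t * cis (- (of_int m * t)))"

lemma cis_int_2pi: "cis (- (of_int m * (2 * pi))) = 1"
proof -
  have "cis (2 * pi * of_int (- m)) = 1" by (rule cis_multiple_2pi) auto
  then show ?thesis by (simp add: mult_ac)
qed

lemma fourier_integral_has_integral:
  assumes "continuous_on {0..2 * pi} f"
  shows "((\<lambda>t. f t * cis (- (of_int m * t))) has_integral fourier_integral f m) {0..2 * pi}"
  unfolding fourier_integral_def
  by (intro integrable_integral integrable_continuous_real continuous_intros assms)

lemma fourier_integral_by_parts:
  assumes f: "\<And>t. t \<in> {0..2 * pi} \<Longrightarrow> (f has_vector_derivative f' t) (at t within {0..2 * pi})"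
    and f': "continuous_on {0..2 * pi} f'" and m: "m \<noteq> 0"
  shows "fourier_integral f m = (\<i> / of_int m) * (f (2 * pi) - f 0 - fourier_integral f' m)"
proof -
  let ?e = "\<lambda>t. cis (- (of_int m * t))"
  have e: "(?e has_vector_derivative (- \<i> * of_int m) * ?e t) (at t within {0..2 * pi})" for t
  proof -
    have "((\<lambda>t. exp (t *\<^sub>R (- \<i> * of_int m))) has_vector_derivative exp (t *\<^sub>R (- \<i> * of_int m)) * (- \<i> * of_int m)) (at t within {0..2 * pi})"
      by (rule exp_scaleR_has_vector_derivative_right)
    moreover have "exp (t *\<^sub>R (- \<i> * of_int m)) = ?e t" for t
      by (simp add: cis_conv_exp scaleR_conv_of_real mult_ac)
    ultimately show ?thesis by (simp add: mult_ac)
  qed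
  have "((\<lambda>t. f t * ?e t) has_vector_derivative (f t * ((- \<i> * of_int m) * ?e t) + f' t * ?e t)) (at t within {0..2 * pi})"
    if "t \<in> {0..2 * pi}" for t
    by (rule has_vector_derivative_mult[OF f[OF that] e])
  from fundamental_theorem_of_calculus[OF _ this]
  have 1: "((\<lambda>t. f t * ((- \<i> * of_int m) * ?e t) + f' t * ?e t) has_integral
      f (2 * pi) * ?e (2 * pi) - f 0 * ?e 0) {0..2 * pi}" by simp
  have cf: "continuous_on {0..2 * pi} f"
    using f by (meson continuous_on_eq_continuous_within has_vector_derivative_continuous)
  have 2: "((\<lambda>t. (- \<i> * of_int m) * (f t * ?e t) + f' t * ?e t) has_integral
      (- \<i> * of_int m) * fourier_integral f m + fourier_integral f' m) {0..2 * pi}"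
    by (intro has_integral_add has_integral_mult_right fourier_integral_has_integral cf f')
  have "(- \<i> * of_int m) * fourier_integral f m + fourier_integral f' m = f (2 * pi) - f 0"
  proof -
    have "(\<lambda>t. f t * ((- \<i> * of_int m) * ?e t) + f' t * ?e t) = (\<lambda>t. (- \<i> * of_int m) * (f t * ?e t) + f' t * ?e t)"
      by (simp add: mult_ac)
    from has_integral_unique[OF 1[unfolded this] 2] show ?thesis by (simp only: cis_int_2pi) simp
  qed
  then have "f (2 * pi) - f 0 - fourier_integral f' m = (- \<i> * of_int m) * fourier_integral f m" by (simp add: algebra_simps)
  then show ?thesis using m by (simp only:) (simp add: field_simps)
qed

lemma fourier_integral_norm_le:
  assumes "continuous_on {0..2 * pi} f" "\<And>t. t \<in> {0..2 * pi} \<Longrightarrow> norm (f t) \<le> B"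
  shows "norm (fourier_integral f m) \<le> 2 * pi * B"
proof -
  have "norm (fourier_integral f m) \<le> B * measure lborel (cbox 0 (2 * pi))"
  proof (rule has_integral_bound)
    show "0 \<le> B" using order_trans[OF norm_ge_zero assms(2)[of 0]] by simp
    show "((\<lambda>t. f t * cis (- (of_int m * t))) has_integral fourier_integral f m) (cbox 0 (2 * pi))"
      using fourier_integral_has_integral[OF assms(1)] by simp
  qed (use assms(2) in \<open>auto simp: norm_mult\<close>)
  then show ?thesis by (simp add: mult_ac)
qed

text \<open>Algebraic polynomials on the interval suffice as approximants: integration by parts gives them decay
  of order \<open>1 / m\<close>, and periodicity is not needed for that.\<close>

lemma riemann_lebesgue:
  assumes h: "continuous_on {0..2 * pi} h" and e: "0 < e"
  obtains M where "\<And>m. M \<le> \<bar>real_of_int m\<bar> \<Longrightarrow> norm (fourier_integral h m) \<le> e"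
proof -
  have "0 < e / (4 * pi)" using e by auto
  then obtain g where g: "polynomial_function g" "\<And>t. t \<in> {0..2 * pi} \<Longrightarrow> norm (h t - g t) < e / (4 * pi)"
    using Stone_Weierstrass_polynomial_function[OF compact_Icc h, of "e / (4 * pi)"] by blast
  obtain g' where g': "polynomial_function g'" "\<And>t. (g has_vector_derivative g' t) (at t)"
    using has_vector_derivative_polynomial_function[OF g(1)] by blast
  have cg: "continuous_on {0..2 * pi} g" "continuous_on {0..2 * pi} g'"
    using g g' continuous_on_polymonial_function by auto
  have "bounded (g' ` {0..2 * pi})" using compact_continuous_image[OF cg(2) compact_Icc] by (rule compact_imp_bounded)
  then obtain B where "\<forall>x\<in>g' ` {0..2 * pi}. norm x \<le> B" unfolding bounded_iff by blast
  then have B: "\<And>t. t \<in> {0..2 * pi} \<Longrightarrow> norm (g' t) \<le> B" by auto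
  define L where "L = norm (g (2 * pi)) + norm (g 0) + 2 * pi * B"
  show thesis
  proof (rule that)
    fix m :: int assume m: "max 1 (2 * L / e) \<le> \<bar>of_int m\<bar>"
    then have m0: "m \<noteq> 0" by auto
    have "norm (fourier_integral g m) = norm (g (2 * pi) - g 0 - fourier_integral g' m) / \<bar>of_int m\<bar>"
      using fourier_integral_by_parts[OF _ cg(2) m0, of g] g'(2)
      by (simp add: has_vector_derivative_at_within norm_mult norm_divide)
    also have "norm (g (2 * pi) - g 0 - fourier_integral g' m) \<le> L"
      unfolding L_def using fourier_integral_norm_le[OF cg(2) B, of m]
      by (smt (verit) norm_triangle_ineq4)
    finally have 1: "norm (fourier_integral g m) \<le> L / \<bar>of_int m\<bar>" using m0 by (simp add: divide_right_mono)
    have "2 * L / e \<le> \<bar>of_int m\<bar>" using m by simp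
    then have 2: "L / \<bar>of_int m\<bar> \<le> e / 2" using e m0 by (simp add: field_simps)
    have "((\<lambda>t. h t * cis (- (of_int m * t)) - g t * cis (- (of_int m * t))) has_integral
        fourier_integral h m - fourier_integral g m) {0..2 * pi}"
      by (intro has_integral_diff fourier_integral_has_integral h cg)
    moreover have "continuous_on {0..2 * pi} (\<lambda>t. h t - g t)" using h cg by (intro continuous_intros)
    from fourier_integral_has_integral[OF this]
    have "((\<lambda>t. h t * cis (- (of_int m * t)) - g t * cis (- (of_int m * t))) has_integral
        fourier_integral (\<lambda>t. h t - g t) m) {0..2 * pi}" by (simp add: algebra_simps)
    ultimately have "fourier_integral h m - fourier_integral g m = fourier_integral (\<lambda>t. h t - g t) m"
      by (rule has_integral_unique)
    moreover have "norm (fourier_integral (\<lambda>t. h t - g t) m) \<le> 2 * pi * (e / (4 * pi))"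
      using h cg g(2) by (intro fourier_integral_norm_le continuous_intros) (auto intro: less_imp_le)
    ultimately have "norm (fourier_integral h m - fourier_integral g m) \<le> e / 2" by simp
    then show "norm (fourier_integral h m) \<le> e" using 1 2 norm_triangle_sub[of "fourier_integral h m" "fourier_integral g m"] by linarith
  qed
qed

lemma sum_symmetric_Suc:
  fixes a :: "int \<Rightarrow> 'a :: ab_group_add"
  shows "(\<Sum>m = - int (Suc N)..int (Suc N). a m) = (\<Sum>m = - int N..int N. a m) + (a (int (Suc N)) + a (- int (Suc N)))"
proof -
  have "{- int (Suc N)..int (Suc N)} = insert (int (Suc N)) (insert (- int (Suc N)) {- int N..int N})" by auto
  then show ?thesis by (simp add: algebra_simps)
qed

definition fourier_sum :: "(real \<Rightarrow> complex) \<Rightarrow> nat \<Rightarrow> real \<Rightarrow> complex" where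
  "fourier_sum f N t = (\<Sum>m = - int N..int N. fourier_integral f m / (2 * pi) * cis (of_int m * t))"

lemma trig_poly_fourier_sum: "trig_poly N (fourier_sum f N)"
  unfolding fourier_sum_def trig_poly_def by (rule exI[of _ "\<lambda>m. fourier_integral f m / (2 * pi)"]) simp

lemma fourier_integral_const:
  fixes a :: complex
  shows "fourier_integral (\<lambda>t. a) m = (if m = 0 then 2 * pi * a else 0)"
proof (cases "m = 0")
  case False
  have "fourier_integral (\<lambda>t. a) m = (\<i> / of_int m) * (a - a - fourier_integral (\<lambda>t. 0) m)"
    using False by (intro fourier_integral_by_parts) (auto intro!: derivative_eq_intros)
  moreover have "fourier_integral (\<lambda>t. 0) m = 0" by (simp add: fourier_integral_def)
  ultimately show ?thesis using False by simp
next
  case True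
  then show ?thesis by (simp add: fourier_integral_def scaleR_conv_of_real)
qed

text \<open>Chernoff's argument: \<open>f t - f t0 = h t * (cis (t - t0) - 1)\<close> with a continuous \<open>h\<close>, so the error of
  the \<open>N\<close>-th partial sum telescopes to two Fourier coefficients of \<open>h\<close>, which vanish in the limit by the
  Riemann-Lebesgue lemma.\<close>

lemma fourier_sum_tendsto:
  fixes \<phi> \<phi>' :: "real \<Rightarrow> real"
  assumes per: "\<And>t. \<phi> (t + 2 * pi) = \<phi> t" and \<phi>': "\<And>t. (\<phi> has_real_derivative \<phi>' t) (at t)"
  shows "(\<lambda>N. fourier_sum (\<lambda>t. of_real (\<phi> t)) N t0) \<longlonglongrightarrow> of_real (\<phi> t0)"
proof -
  define f where "f = (\<lambda>t. complex_of_real (\<phi> t))"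
  have c\<phi>: "continuous_on S \<phi>" for S
    using \<phi>' by (meson continuous_at_imp_continuous_on DERIV_isCont)
  then have cf: "continuous_on S f" for S unfolding f_def by (intro continuous_intros)
  have per_nat: "f (t + 2 * pi * of_nat n) = f t" for t n
  proof (induction n)
    case (Suc n)
    then show ?case using per[of "t + 2 * pi * of_nat n"] by (simp add: algebra_simps f_def)
  qed simp
  have per_int: "f (t + 2 * pi * of_int k) = f t" for t and k :: int
  proof (cases k)
    case (nonneg n) then show ?thesis using per_nat by simp
  next
    case (neg n)
    then have "real_of_int k = - real (Suc n)" by (simp only: of_int_minus of_int_of_nat_eq)
    then have "t + 2 * pi * of_int k + 2 * pi * of_nat (Suc n) = t" by (simp only:)
    with per_nat[of "t + 2 * pi * of_int k" "Suc n"] show ?thesis by (simp only:)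
  qed
  have cis1: "f t = f t1" if c: "cis (t - t1) = 1" for t t1
  proof -
    have "cos (t - t1) = 1" using c by (metis cis.sel(1) one_complex.sel(1))
    then obtain k :: int where "t - t1 = of_int k * 2 * pi" by (auto simp: cos_one_2pi_int)
    then have "t = t1 + 2 * pi * of_int k" by (simp add: algebra_simps)
    then show ?thesis using per_int[of t1 k] by simp
  qed
  define h where "h = (\<lambda>t. if cis (t - t0) = 1 then of_real (\<phi>' t) / \<i> else (f t - f t0) / (cis (t - t0) - 1))"
  \<comment> \<open>Where \<open>cis (t - t0) = 1\<close> the function \<open>h\<close> is the limit of a quotient of difference quotients; the one of
  \<open>cis\<close> tends to \<open>\<i>\<close>, so the quotient converges.\<close>
  have quot: "((\<lambda>t. (cis (t - t1) - 1) / of_real (t - t1)) \<longlongrightarrow> \<i>) (at t1)" for t1 :: real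
  proof -
    have "filterlim (\<lambda>t. \<i> * of_real (t - t1)) (at 0) (at t1)"
    proof (rule filterlim_atI)
      have "((\<lambda>t. \<i> * of_real (t - t1)) \<longlongrightarrow> \<i> * of_real (t1 - t1)) (at t1)" by (intro tendsto_intros)
      then show "((\<lambda>t. \<i> * of_real (t - t1)) \<longlongrightarrow> 0) (at t1)" by simp
      show "\<forall>\<^sub>F t in at t1. \<i> * of_real (t - t1) \<noteq> 0" by (auto simp: eventually_at intro: exI[of _ 1])
    qed
    from filterlim_compose[OF lim_exp_minus_1 this]
    have "((\<lambda>t. \<i> * ((exp (\<i> * of_real (t - t1)) - 1) / (\<i> * of_real (t - t1)))) \<longlongrightarrow> \<i> * 1) (at t1)"
      by (intro tendsto_mult tendsto_const)
    then show ?thesis by (simp add: cis_conv_exp)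
  qed
  have h0: "isCont h t1" for t1
  proof (cases "cis (t1 - t0) = 1")
    case True
    have sh: "cis (t - t0) = cis (t - t1)" for t
      using True cis_mult[of "t - t1" "t1 - t0"] by simp
    have "((\<lambda>t. of_real ((\<phi> t - \<phi> t1) / (t - t1)) / ((cis (t - t1) - 1) / of_real (t - t1))) \<longlongrightarrow> of_real (\<phi>' t1) / \<i>) (at t1)"
      using \<phi>'[of t1] by (intro tendsto_divide tendsto_of_real quot) (auto simp: has_field_derivative_iff)
    moreover have "\<forall>\<^sub>F t in at t1. of_real ((\<phi> t - \<phi> t1) / (t - t1)) / ((cis (t - t1) - 1) / of_real (t - t1)) = h t"
    proof -
      have "\<forall>\<^sub>F t in at t1. (cis (t - t1) - 1) / of_real (t - t1) \<noteq> 0"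
        using tendsto_imp_eventually_ne[OF quot, of 0] by simp
      moreover have "\<forall>\<^sub>F t in at t1. t \<noteq> t1" by (auto simp: eventually_at intro: exI[of _ 1])
      ultimately show ?thesis
      proof eventually_elim
        case (elim t)
        have "f t1 = f t0" using cis1 True by blast
        then show ?case using elim unfolding h_def sh by (auto simp: f_def)
      qed
    qed
    ultimately have "(h \<longlongrightarrow> of_real (\<phi>' t1) / \<i>) (at t1)" by (rule Lim_transform_eventually)
    moreover have "h t1 = of_real (\<phi>' t1) / \<i>" using True by (simp add: h_def)
    ultimately show ?thesis unfolding isCont_def by simp
  next
    case False
    have "((\<lambda>t. cis (t - t0)) \<longlongrightarrow> cis (t1 - t0)) (at t1)" by (intro tendsto_intros)
    from tendsto_imp_eventually_ne[OF this False]
    have "\<forall>\<^sub>F t in at t1. (f t - f t0) / (cis (t - t0) - 1) = h t"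
      by eventually_elim (simp add: h_def)
    moreover have "(f \<longlongrightarrow> f t1) (at t1)" using cf[of UNIV] by (simp add: continuous_on_def)
    then have "((\<lambda>t. (f t - f t0) / (cis (t - t0) - 1)) \<longlongrightarrow> (f t1 - f t0) / (cis (t1 - t0) - 1)) (at t1)"
      using False by (intro tendsto_intros) auto
    ultimately have "(h \<longlongrightarrow> (f t1 - f t0) / (cis (t1 - t0) - 1)) (at t1)" by (rule Lim_transform_eventually[rotated])
    then show ?thesis using False by (simp add: isCont_def h_def)
  qed
  then have ch: "continuous_on S h" for S by (meson continuous_at_imp_continuous_on)
  have fh: "f t - f t0 = h t * (cis (t - t0) - 1)" for t
    using cis1[of t t0] by (auto simp: h_def)
  have coef: "fourier_integral f m - fourier_integral (\<lambda>t. f t0) m = cis (- t0) * fourier_integral h (m - 1) - fourier_integral h m" for m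
  proof -
    have 1: "((\<lambda>t. f t * cis (- (of_int m * t)) - f t0 * cis (- (of_int m * t))) has_integral
        fourier_integral f m - fourier_integral (\<lambda>t. f t0) m) {0..2 * pi}"
      by (intro has_integral_diff fourier_integral_has_integral cf continuous_intros)
    have 2: "((\<lambda>t. cis (- t0) * (h t * cis (- (of_int (m - 1) * t))) - h t * cis (- (of_int m * t))) has_integral
        cis (- t0) * fourier_integral h (m - 1) - fourier_integral h m) {0..2 * pi}"
      by (intro has_integral_diff has_integral_mult_right fourier_integral_has_integral ch)
    have "f t * cis (- (of_int m * t)) - f t0 * cis (- (of_int m * t))
        = cis (- t0) * (h t * cis (- (of_int (m - 1) * t))) - h t * cis (- (of_int m * t))" for t
    proof -
      have "f t * cis (- (of_int m * t)) - f t0 * cis (- (of_int m * t)) = (f t - f t0) * cis (- (of_int m * t))"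
        by (simp add: algebra_simps)
      also have "\<dots> = h t * (cis (t - t0) * cis (- (of_int m * t))) - h t * cis (- (of_int m * t))"
        unfolding fh by (simp add: algebra_simps)
      also have "cis (t - t0) * cis (- (of_int m * t)) = cis (- t0) * cis (- (of_int (m - 1) * t))"
        by (simp add: cis_mult algebra_simps)
      finally show ?thesis by (simp add: mult_ac)
    qed
    then show ?thesis using has_integral_unique[OF 1] 2 by simp
  qed
  have telescope: "(\<Sum>m = - int N..int N. (fourier_integral f m - fourier_integral (\<lambda>t. f t0) m) * cis (of_int m * t0))
      = cis (of_int (- int N - 1) * t0) * fourier_integral h (- int N - 1) - cis (of_int (int N) * t0) * fourier_integral h (int N)" for N
  proof -
    define b where "b = (\<lambda>m. cis (of_int m * t0) * fourier_integral h m)"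
    have "(fourier_integral f m - fourier_integral (\<lambda>t. f t0) m) * cis (of_int m * t0) = b (m - 1) - b m" for m
    proof -
      have "cis (of_int m * t0) * cis (- t0) = cis (of_int (m - 1) * t0)" by (simp add: cis_mult algebra_simps)
      then show ?thesis unfolding b_def coef by (simp add: algebra_simps)
    qed
    then have "(\<Sum>m = - int N..int N. (fourier_integral f m - fourier_integral (\<lambda>t. f t0) m) * cis (of_int m * t0))
        = (\<Sum>m = - int N..int N. b (m - 1) - b m)" by simp
    also have "\<dots> = b (- int N - 1) - b (int N)"
    proof (induction N)
      case (Suc N)
      have "int (Suc N) - 1 = int N" "- int (Suc N) = - int N - 1" by auto
      then have "b (int (Suc N) - 1) = b (int N)" "b (- int (Suc N)) = b (- int N - 1)" by (simp_all only:)
      then show ?case unfolding sum_symmetric_Suc Suc.IH by (simp only: \<open>_ = b (int N)\<close>) (simp del: of_nat_Suc)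
    qed simp
    finally show ?thesis unfolding b_def .
  qed
  have const: "(\<Sum>m = - int N..int N. fourier_integral (\<lambda>t. f t0) m * cis (of_int m * t0)) = 2 * pi * f t0" for N
  proof -
    have "(\<Sum>m = - int N..int N. fourier_integral (\<lambda>t. f t0) m * cis (of_int m * t0))
        = (\<Sum>m = - int N..int N. if m = 0 then 2 * pi * f t0 else 0)"
      by (intro sum.cong) (auto simp: fourier_integral_const)
    then show ?thesis by (simp add: sum.delta)
  qed
  have err: "fourier_sum f N t0 - f t0
      = (cis (of_int (- int N - 1) * t0) * fourier_integral h (- int N - 1) - cis (of_int (int N) * t0) * fourier_integral h (int N)) / (2 * pi)" for N
    unfolding telescope[symmetric] left_diff_distrib sum_subtractf const fourier_sum_def
    by (simp add: diff_divide_distrib sum_divide_distrib)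
  have "(\<lambda>N. fourier_sum f N t0) \<longlonglongrightarrow> f t0"
  proof (rule LIMSEQ_I)
    fix e :: real assume e: "0 < e"
    obtain M where M: "\<And>m. M \<le> \<bar>real_of_int m\<bar> \<Longrightarrow> norm (fourier_integral h m) \<le> e"
      using riemann_lebesgue[OF ch e] by blast
    obtain n0 :: nat where n0: "M \<le> of_nat n0" using real_arch_simple by blast
    have "norm (fourier_sum f N t0 - f t0) < e" if N: "n0 \<le> N" for N
    proof -
      have "norm (fourier_integral h (- int N - 1)) \<le> e" "norm (fourier_integral h (int N)) \<le> e"
        using N n0 by (auto intro!: M)
      moreover have "norm (fourier_sum f N t0 - f t0)
          \<le> (norm (fourier_integral h (- int N - 1)) + norm (fourier_integral h (int N))) / (2 * pi)"
        unfolding err norm_divide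
        by (intro divide_mono order_trans[OF norm_triangle_ineq4]) (auto simp: norm_mult)
      moreover have "(norm (fourier_integral h (- int N - 1)) + norm (fourier_integral h (int N))) / (2 * pi) \<le> (e + e) / (2 * pi)"
        using calculation by (intro divide_right_mono add_mono) auto
      moreover have "(e + e) / (2 * pi) < e" using e pi_gt3 by (simp add: field_simps)
      ultimately show ?thesis by linarith
    qed
    then show "\<exists>no. \<forall>n\<ge>no. norm (fourier_sum f n t0 - f t0) < e" by blast
  qed
  then show ?thesis unfolding f_def .
qed

lemma fourier_integral_decay:
  fixes d :: "nat \<Rightarrow> real \<Rightarrow> real"
  assumes der: "\<And>j t. (d j has_real_derivative d (Suc j) t) (at t)"
    and per: "\<And>j t. d j (t + 2 * pi) = d j t" and m: "m \<noteq> 0"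
    and S: "\<And>t. \<bar>d k t\<bar> \<le> S"
  shows "norm (fourier_integral (\<lambda>t. of_real (d 0 t)) m) \<le> 2 * pi * S / \<bar>of_int m\<bar> ^ k"
proof -
  have c: "continuous_on X (\<lambda>t. complex_of_real (d j t))" for X j
    using der by (intro continuous_intros) (meson continuous_at_imp_continuous_on DERIV_isCont)
  have step: "norm (fourier_integral (\<lambda>t. of_real (d j t)) m) = norm (fourier_integral (\<lambda>t. of_real (d (Suc j) t)) m) / \<bar>of_int m\<bar>" for j
  proof -
    have "fourier_integral (\<lambda>t. of_real (d j t)) m = (\<i> / of_int m) * (of_real (d j (2 * pi)) - of_real (d j 0)
        - fourier_integral (\<lambda>t. of_real (d (Suc j) t)) m)"
    proof (rule fourier_integral_by_parts[OF _ c m])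
      show "((\<lambda>t. complex_of_real (d j t)) has_vector_derivative of_real (d (Suc j) t)) (at t within {0..2 * pi})" for t
        using der[of j t] by (intro has_vector_derivative_of_real has_vector_derivative_at_within)
          (simp only: has_real_derivative_iff_has_vector_derivative)
    qed
    then show ?thesis using per[of j 0] by (simp add: norm_mult norm_divide)
  qed
  have eq: "norm (fourier_integral (\<lambda>t. of_real (d 0 t)) m) = norm (fourier_integral (\<lambda>t. of_real (d j t)) m) / \<bar>of_int m\<bar> ^ j" for j
  proof (induction j)
    case (Suc j)
    show ?case unfolding Suc.IH step[of j] by simp
  qed simp
  have "norm (fourier_integral (\<lambda>t. of_real (d k t)) m) \<le> 2 * pi * S"
    using S by (intro fourier_integral_norm_le c) auto
  then show ?thesis unfolding eq[of k] by (intro divide_right_mono) auto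
qed

text \<open>The coefficients of frequency \<open>m\<close> are at most \<open>S / m ^ k\<close>. Two of the \<open>k\<close> factors \<open>1 / m\<close> make the
  tail of the series telescope, the others are bounded by \<open>1 / N\<close>.\<close>

theorem fourier_sum_error:
  fixes d :: "nat \<Rightarrow> real \<Rightarrow> real"
  assumes der: "\<And>j t. (d j has_real_derivative d (Suc j) t) (at t)"
    and per: "\<And>j t. d j (t + 2 * pi) = d j t"
    and S: "\<And>t. \<bar>d k t\<bar> \<le> S" and k: "2 \<le> k" and N: "1 \<le> N"
  shows "norm (fourier_sum (\<lambda>t. of_real (d 0 t)) N t - of_real (d 0 t)) \<le> 2 * S * real N / real N ^ k"
proof -
  define f where "f = (\<lambda>t. complex_of_real (d 0 t))"
  have S0: "0 \<le> S" using S[of 0] by linarith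
  have inc: "norm (fourier_sum f (N + i) t - fourier_sum f N t) \<le> 2 * S * (real N ^ 2 / real N ^ k) * (1 / real N - 1 / real (N + i))" for i
  proof (induction i)
    case (Suc i)
    let ?m = "N + Suc i"
    have co: "norm (fourier_integral f m / (2 * pi) * cis (of_int m * t)) \<le> S / real ?m ^ k" if "\<bar>m\<bar> = int ?m" for m :: int
    proof -
      have "\<bar>real_of_int m\<bar> = real ?m" using that by linarith
      then have "norm (fourier_integral f m) \<le> 2 * pi * S / real ?m ^ k"
        using fourier_integral_decay[OF der per _ S, of m] that unfolding f_def by force
      then show ?thesis by (simp add: norm_mult norm_divide field_simps)
    qed
    have "fourier_sum f ?m t - fourier_sum f (N + i) t
        = fourier_integral f (int ?m) / (2 * pi) * cis (of_int (int ?m) * t)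
        + fourier_integral f (- int ?m) / (2 * pi) * cis (of_int (- int ?m) * t)"
      unfolding fourier_sum_def add_Suc_right sum_symmetric_Suc by simp
    moreover have "norm (\<dots>) \<le> S / real ?m ^ k + S / real ?m ^ k"
      by (intro norm_triangle_mono co) (simp_all only: abs_minus_cancel abs_of_nat)
    ultimately have "norm (fourier_sum f ?m t - fourier_sum f (N + i) t) \<le> S / real ?m ^ k + S / real ?m ^ k"
      by (simp only:)
    also have "\<dots> = 2 * S * (1 / real ?m ^ k)" by simp
    also have "1 / real ?m ^ k \<le> (real N ^ 2 / real N ^ k) * (1 / real (N + i) - 1 / real ?m)"
    proof -
      obtain l where l: "k = 2 + l" using k le_Suc_ex by blast
      have "1 / real ?m ^ k = 1 / real ?m ^ l * (1 / real ?m ^ 2)" unfolding l power_add by (simp only: times_divide_times_eq mult_1 mult.commute)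
      also have "\<dots> \<le> 1 / real N ^ l * (1 / real (N + i) - 1 / real ?m)"
      proof (intro mult_mono)
        show "1 / real ?m ^ l \<le> 1 / real N ^ l" using N by (intro divide_left_mono power_mono) auto
        have "1 / real (N + i) - 1 / real ?m = 1 / (real (N + i) * real ?m)" using N by (simp add: field_simps)
        moreover have "1 / real ?m ^ 2 \<le> 1 / (real (N + i) * real ?m)"
          using N unfolding power2_eq_square by (intro divide_left_mono mult_right_mono mult_pos_pos) auto
        ultimately show "1 / real ?m ^ 2 \<le> 1 / real (N + i) - 1 / real ?m" by simp
      qed (use N in auto)
      also have "1 / real N ^ l = real N ^ 2 / real N ^ k" using N by (simp add: l power_add power2_eq_square)
      finally show ?thesis .
    qed
    finally have "norm (fourier_sum f ?m t - fourier_sum f (N + i) t)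
      \<le> 2 * S * ((real N ^ 2 / real N ^ k) * (1 / real (N + i) - 1 / real ?m))" using S0 by (simp add: mult_left_mono)
    with Suc have "norm (fourier_sum f ?m t - fourier_sum f N t)
      \<le> 2 * S * ((real N ^ 2 / real N ^ k) * (1 / real (N + i) - 1 / real ?m))
        + 2 * S * (real N ^ 2 / real N ^ k) * (1 / real N - 1 / real (N + i))"
      using norm_triangle_ineq[of "fourier_sum f ?m t - fourier_sum f (N + i) t" "fourier_sum f (N + i) t - fourier_sum f N t"] by simp
    then show ?case by (simp add: right_diff_distrib mult.assoc)
  qed simp
  have "norm (fourier_sum f (N + i) t - fourier_sum f N t) \<le> 2 * S * real N / real N ^ k" for i
  proof -
    have "2 * S * (real N ^ 2 / real N ^ k) * (1 / real N - 1 / real (N + i)) \<le> 2 * S * (real N ^ 2 / real N ^ k) * (1 / real N)"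
      using S0 by (intro mult_left_mono) auto
    also have "\<dots> = 2 * S * real N / real N ^ k" using N by (simp add: power2_eq_square)
    finally show ?thesis using inc[of i] by linarith
  qed
  moreover have "(\<lambda>M. fourier_sum f M t) \<longlonglongrightarrow> f t"
    unfolding f_def by (rule fourier_sum_tendsto[OF per der])
  then have "(\<lambda>i. norm (fourier_sum f (N + i) t - fourier_sum f N t)) \<longlonglongrightarrow> norm (f t - fourier_sum f N t)"
    using LIMSEQ_ignore_initial_segment[of "\<lambda>M. fourier_sum f M t" "f t" N]
    by (intro tendsto_intros) (simp add: add.commute)
  ultimately have "norm (f t - fourier_sum f N t) \<le> 2 * S * real N / real N ^ k"
    by (intro LIMSEQ_le_const2) auto
  then show ?thesis unfolding f_def by (simp add: norm_minus_commute)
qed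

section \<open>Weights in Omega are smooth, with Cauchy estimates\<close>

lemma power_le_fact_exp: "0 \<le> (x::real) \<Longrightarrow> x ^ n \<le> fact n * exp x"
proof -
  assume x: "0 \<le> x"
  have "(\<Sum>k\<in>{n}. x ^ k /\<^sub>R fact k) \<le> (\<Sum>k. x ^ k /\<^sub>R fact k)"
    using x summable_exp_generic[of x] by (intro sum_le_suminf) auto
  then show ?thesis by (simp add: exp_def field_simps)
qed

text \<open>The condition \<open>L * r \<le> 1 / 2\<close> keeps the geometric series below twice its first term.\<close>

lemma power_series_on_ball:
  fixes a :: "nat \<Rightarrow> real" and z\<^sub>0 :: complex
  assumes a: "\<And>n. 1 \<le> n \<Longrightarrow> \<bar>a n\<bar> \<le> K * L ^ n" and KL: "0 \<le> K" "0 < L" "L * r \<le> 1 / 2"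
  obtains \<Phi> where "\<Phi> holomorphic_on ball z\<^sub>0 r"
    "\<And>w. w \<in> ball z\<^sub>0 r \<Longrightarrow> (\<lambda>n. of_real (a n) * (w - z\<^sub>0) ^ n) sums \<Phi> w"
    "\<And>w. w \<in> ball z\<^sub>0 r \<Longrightarrow> norm (\<Phi> w - of_real (a 0)) \<le> 2 * K * L * norm (w - z\<^sub>0)"
proof -
  define \<Phi> where "\<Phi> w = (\<Sum>n. of_real (a n) * (w - z\<^sub>0) ^ n)" for w
  have *: "(\<lambda>n. of_real (a n) * (w - z\<^sub>0) ^ n) sums \<Phi> w \<and> norm (\<Phi> w - of_real (a 0)) \<le> 2 * K * L * norm (w - z\<^sub>0)"
    if w: "w \<in> ball z\<^sub>0 r" for w
  proof -
    define x where "x = L * norm (w - z\<^sub>0)"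
    have "norm (w - z\<^sub>0) < r" using w by (simp add: dist_norm norm_minus_commute)
    then have "x < L * r" using KL unfolding x_def by simp
    then have "x \<le> 1 / 2" using KL by linarith
    moreover have "0 \<le> x" using KL by (simp add: x_def)
    ultimately have x: "0 \<le> x" "x \<le> 1 / 2" by auto
    have t: "norm (of_real (a n) * (w - z\<^sub>0) ^ n) \<le> K * x ^ n" if "1 \<le> n" for n
      using mult_right_mono[OF a[OF that], of "norm (w - z\<^sub>0) ^ n"]
      by (simp add: norm_mult norm_power x_def power_mult_distrib mult.assoc)
    have sK: "summable (\<lambda>n. K * x ^ n)" using x by (intro summable_mult summable_geometric) auto
    have s: "summable (\<lambda>n. of_real (a n) * (w - z\<^sub>0) ^ n)"
      using t by (intro summable_comparison_test[OF _ sK]) auto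
    have "norm (\<Phi> w - of_real (a 0)) = norm (\<Sum>n. of_real (a (Suc n)) * (w - z\<^sub>0) ^ Suc n)"
      using suminf_split_head[OF s] unfolding \<Phi>_def by simp
    also have "\<dots> \<le> (\<Sum>n. K * x ^ Suc n)"
      using t sK by (intro norm_suminf_le) (auto simp: summable_Suc_iff simp del: power_Suc)
    also have "\<dots> = (\<Sum>n. (K * x) * x ^ n)" by (simp add: mult.assoc)
    also have "\<dots> = K * x / (1 - x)" using x by (subst suminf_mult) (auto simp: suminf_geometric summable_geometric)
    also have "\<dots> \<le> K * x / (1 / 2)" using x KL by (intro divide_left_mono) auto
    finally have "norm (\<Phi> w - of_real (a 0)) \<le> 2 * K * L * norm (w - z\<^sub>0)" by (simp add: x_def)
    moreover have "(\<lambda>n. of_real (a n) * (w - z\<^sub>0) ^ n) sums \<Phi> w" unfolding \<Phi>_def using s by (rule summable_sums)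
    ultimately show ?thesis by blast
  qed
  show thesis
  proof (rule that)
    show "\<Phi> holomorphic_on ball z\<^sub>0 r" using * by (intro power_series_holomorphic[of z\<^sub>0 r "\<lambda>n. of_real (a n)"]) blast
  qed (use * in blast)+
qed

text \<open>Derivatives are taken within \<open>S\<close> because the outer function of a weight in \<open>Omega\<close> has only one-sided
  derivatives at the right end of its domain, and the inner function may attain that end.\<close>

lemma taylor_sums:
  fixes d :: "nat \<Rightarrow> real \<Rightarrow> real"
  assumes S: "convex S" and d: "\<And>n x. x \<in> S \<Longrightarrow> (d n has_real_derivative d (Suc n) x) (at x within S)"
    and w: "w \<in> S" "z \<in> S"
    and b: "\<And>n x. 1 \<le> n \<Longrightarrow> x \<in> S \<Longrightarrow> \<bar>d n x\<bar> \<le> K * L ^ n * fact n"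
    and L: "0 \<le> L" "L * \<bar>z - w\<bar> < 1"
  shows "(\<lambda>n. d n w / fact n * (z - w) ^ n) sums d 0 z"
proof -
  define q where "q = L * \<bar>z - w\<bar>"
  have q: "0 \<le> q" "q < 1" using L by (auto simp: q_def)
  have e: "norm ((\<Sum>i\<le>n. d i w / fact i * (z - w) ^ i) - d 0 z) \<le> K * (real (Suc n) * q ^ Suc n)" for n
  proof -
    have "norm (d 0 z - (\<Sum>i\<le>n. d i w * (z - w) ^ i / fact i)) \<le> (K * L ^ Suc n * fact (Suc n)) * norm (z - w) ^ Suc n / fact n"
      using b[of "Suc n"] by (intro field_Taylor[OF S _ _ w] d) auto
    also have "\<dots> = K * (real (Suc n) * q ^ Suc n)"
      by (simp add: q_def power_mult_distrib field_simps)
    finally show ?thesis by (simp add: abs_minus_commute)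
  qed
  have "(\<lambda>n. real n * q ^ n) \<longlonglongrightarrow> 0" using q by (intro powser_times_n_limit_0) simp
  then have "(\<lambda>n. real (Suc n) * q ^ Suc n) \<longlonglongrightarrow> 0" by (rule LIMSEQ_Suc)
  then have "(\<lambda>n. K * (real (Suc n) * q ^ Suc n)) \<longlonglongrightarrow> 0" by (rule tendsto_mult_right_zero)
  then have "(\<lambda>n. (\<Sum>i\<le>n. d i w / fact i * (z - w) ^ i) - d 0 z) \<longlonglongrightarrow> 0"
    by (rule Lim_null_comparison[OF always_eventually[OF allI[OF e]]])
  then show ?thesis unfolding sums_def_le by (rule LIM_zero_cancel)
qed

lemma Omega_inner_bounded: "Omega_inner A g \<Longrightarrow> \<bar>g t\<bar> \<le> A"
  unfolding Omega_inner_def by (auto simp: abs_le_iff) (metis neg_le_iff_le minus_minus)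

lemma Omega_outer_abs:
  assumes "Omega_outer A F" "0 < \<bar>x\<bar>" "\<bar>x\<bar> \<le> A" shows "F \<bar>x\<bar> = F x" "0 < F x"
proof -
  have "x \<in> {-A..A} - {0}" using assms(2,3) by auto
  then have "F (- x) = F x" "0 < F x" using assms(1) unfolding Omega_outer_def by blast+
  then show "F \<bar>x\<bar> = F x" "0 < F x" by (auto simp: abs_if)
qed

text \<open>Since \<open>n ^ n \<le> exp n * fact n\<close>, the hypotheses on the outer function say that its Taylor series at
  \<open>x\<^sub>0 = \<bar>g t\<^sub>0\<bar>\<close> converges on a disc of radius proportional to \<open>x\<^sub>0\<close>, to values that differ from \<open>F x\<^sub>0\<close> by at
  most half of \<open>F x\<^sub>0\<close>. The Taylor series of \<open>g\<close> maps a disc of radius proportional to \<open>x\<^sub>0\<close> around \<open>t\<^sub>0\<close>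
  into this disc. The sign of \<open>g t\<^sub>0\<close> is moved into \<open>g\<close>, as the outer function is even.\<close>

lemma Omega_local_holomorphic:
  assumes A: "0 < A" and g: "Omega_inner A g" and F: "Omega_outer A F"
  obtains c where "0 < c" "\<And>t\<^sub>0. g t\<^sub>0 \<noteq> 0 \<Longrightarrow> \<exists>H. H holomorphic_on ball (of_real t\<^sub>0) (c * \<bar>g t\<^sub>0\<bar>) \<and>
      (\<forall>z\<in>ball (of_real t\<^sub>0) (c * \<bar>g t\<^sub>0\<bar>). norm (H z) \<le> exp (- F (g t\<^sub>0) / 2)) \<and>
      (\<forall>t. \<bar>t - t\<^sub>0\<bar> < c * \<bar>g t\<^sub>0\<bar> \<longrightarrow> g t \<noteq> 0 \<and> H (of_real t) = of_real (exp (- F (g t))))"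
proof -
  obtain dg where sd: "successive_derivs_on UNIV g dg" and "\<exists>D>0. \<forall>t. \<forall>n\<ge>1. \<bar>dg n t\<bar> \<le> D ^ n * fact n"
    using g unfolding Omega_inner_def by blast
  then obtain D where D: "0 < D" "\<And>n t. 1 \<le> n \<Longrightarrow> \<bar>dg n t\<bar> \<le> D ^ n * fact n" by blast
  have dg: "\<And>t. dg 0 t = g t" "\<And>n t. (dg n has_real_derivative dg (Suc n) t) (at t)"
    using sd unfolding successive_derivs_on_def by auto
  obtain dF B where dF: "\<And>x. x \<in> {0<..A} \<Longrightarrow> dF 0 x = F x"
      "\<And>n x. x \<in> {0<..A} \<Longrightarrow> (dF n has_real_derivative dF (Suc n) x) (at x within {0<..A})"
    and B: "0 < B" "\<And>n x. 1 \<le> n \<Longrightarrow> x \<in> {0<..A} \<Longrightarrow> \<bar>dF n x\<bar> \<le> B ^ n * real n ^ n * F x / x ^ n"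
    using F unfolding Omega_outer_def successive_derivs_on_def by blast
  have anti: "F y \<le> F x" if "0 < x" "x \<le> y" "y \<le> A" for x y
    using F that unfolding Omega_outer_def monotone_on_def by auto
  define E where "E = exp 1 * B"
  have E: "0 < E" unfolding E_def using B by simp
  have dFE: "\<bar>dF n x\<bar> \<le> F x * (E / x) ^ n * fact n" if n: "1 \<le> n" and x: "x \<in> {0<..A}" for n x
  proof -
    have Fx: "0 \<le> F x" using Omega_outer_abs(2)[OF F, of x] x by auto
    have "real n ^ n \<le> fact n * exp 1 ^ n"
      using power_le_fact_exp[of "real n" n] by (simp add: exp_of_nat_mult[symmetric])
    then have "B ^ n * F x / x ^ n * real n ^ n \<le> B ^ n * F x / x ^ n * (fact n * exp 1 ^ n)"
      using Fx x B by (intro mult_left_mono) auto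
    then show ?thesis using B(2)[OF n x] by (simp add: E_def power_mult_distrib power_divide mult_ac)
  qed
  \<comment> \<open>\<open>\<epsilon> * x\<^sub>0\<close> is the radius for the outer series, \<open>c * x\<^sub>0\<close> the radius for the inner one.\<close>
  define \<epsilon> where "\<epsilon> = 1 / (4 * E + 2)"
  have \<epsilon>: "0 < \<epsilon>" "\<epsilon> \<le> 1 / 2" "E * \<epsilon> \<le> 1 / 4" using E unfolding \<epsilon>_def by (auto simp: field_simps)
  define c where "c = \<epsilon> / (2 * D * (1 + A))"
  have c: "0 < c" "D * c * A \<le> 1 / 2" "2 * D * c \<le> \<epsilon>"
  proof -
    show "0 < c" unfolding c_def using \<epsilon>(1) D(1) A by (intro divide_pos_pos mult_pos_pos) auto
    have e: "2 * D * c = \<epsilon> / (1 + A)" using D(1) A by (simp add: c_def)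
    also have "\<dots> \<le> \<epsilon> / 1" using \<epsilon>(1) A by (intro divide_left_mono) auto
    finally show "2 * D * c \<le> \<epsilon>" by simp
    have "D * c * A = (2 * D * c) * A / 2" by simp
    also have "\<dots> = \<epsilon> * (A / (1 + A)) / 2" unfolding e by simp
    also have "\<dots> \<le> 1 * 1 / 2" using \<epsilon>(1,2) A by (intro divide_right_mono mult_mono) auto
    finally show "D * c * A \<le> 1 / 2" by simp
  qed
  show thesis
  proof (rule that[OF c(1)])
    fix t\<^sub>0 assume gt0: "g t\<^sub>0 \<noteq> 0"
    define x\<^sub>0 where "x\<^sub>0 = \<bar>g t\<^sub>0\<bar>"
    define \<sigma> where "\<sigma> = sgn (g t\<^sub>0)"
    have \<sigma>: "\<bar>\<sigma>\<bar> = 1" "\<sigma> * g t\<^sub>0 = x\<^sub>0" using gt0 by (auto simp: \<sigma>_def x\<^sub>0_def abs_sgn mult.commute sgn_if)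
    have x0: "0 < x\<^sub>0" "x\<^sub>0 \<le> A" using gt0 Omega_inner_bounded[OF g] by (auto simp: x\<^sub>0_def)
    have Fx0: "0 < F x\<^sub>0" "F x\<^sub>0 = F (g t\<^sub>0)" using Omega_outer_abs[OF F] x0 by (auto simp: x\<^sub>0_def)
    define r where "r = c * x\<^sub>0"
    have "D * r \<le> D * c * A" using x0 D c unfolding r_def by (simp add: mult.assoc)
    then have Dr: "D * r \<le> 1 / 2" using c by linarith
    obtain G where G: "G holomorphic_on ball (of_real t\<^sub>0) r"
        "\<And>w. w \<in> ball (of_real t\<^sub>0) r \<Longrightarrow> (\<lambda>n. of_real (\<sigma> * (dg n t\<^sub>0 / fact n)) * (w - of_real t\<^sub>0) ^ n) sums G w"
        "\<And>w. w \<in> ball (of_real t\<^sub>0) r \<Longrightarrow> norm (G w - of_real (\<sigma> * (dg 0 t\<^sub>0 / fact 0))) \<le> 2 * 1 * D * norm (w - of_real t\<^sub>0)"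
    proof (rule power_series_on_ball[of "\<lambda>n. \<sigma> * (dg n t\<^sub>0 / fact n)" 1 D r "of_real t\<^sub>0"])
      show "\<bar>\<sigma> * (dg n t\<^sub>0 / fact n)\<bar> \<le> 1 * D ^ n" if "1 \<le> n" for n
        using D(2)[OF that, of t\<^sub>0] \<sigma> by (simp add: abs_mult field_simps)
    qed (use D Dr in auto)
    have G3: "G w \<in> ball (of_real x\<^sub>0) (\<epsilon> * x\<^sub>0)" if "w \<in> ball (of_real t\<^sub>0) r" for w
    proof -
      have "norm (G w - of_real x\<^sub>0) \<le> 2 * D * norm (w - of_real t\<^sub>0)" using G(3)[OF that] \<sigma> dg(1) by simp
      also have "\<dots> < 2 * D * r" using that D by (simp add: dist_norm norm_minus_commute)
      also have "\<dots> \<le> \<epsilon> * x\<^sub>0" using c(3) x0 by (simp add: r_def mult.assoc[symmetric] mult_right_mono)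
      finally show ?thesis by (simp add: dist_norm norm_minus_commute)
    qed
    obtain \<Phi> where \<Phi>: "\<Phi> holomorphic_on ball (of_real x\<^sub>0) (\<epsilon> * x\<^sub>0)"
        "\<And>w. w \<in> ball (of_real x\<^sub>0) (\<epsilon> * x\<^sub>0) \<Longrightarrow> (\<lambda>n. of_real (dF n x\<^sub>0 / fact n) * (w - of_real x\<^sub>0) ^ n) sums \<Phi> w"
        "\<And>w. w \<in> ball (of_real x\<^sub>0) (\<epsilon> * x\<^sub>0) \<Longrightarrow> norm (\<Phi> w - of_real (dF 0 x\<^sub>0 / fact 0)) \<le> 2 * F x\<^sub>0 * (E / x\<^sub>0) * norm (w - of_real x\<^sub>0)"
    proof (rule power_series_on_ball[of "\<lambda>n. dF n x\<^sub>0 / fact n" "F x\<^sub>0" "E / x\<^sub>0" "\<epsilon> * x\<^sub>0" "of_real x\<^sub>0"])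
      show "\<bar>dF n x\<^sub>0 / fact n\<bar> \<le> F x\<^sub>0 * (E / x\<^sub>0) ^ n" if "1 \<le> n" for n
        using dFE[OF that, of x\<^sub>0] x0 by (simp add: field_simps)
    qed (use Fx0 E x0 \<epsilon> in auto)
    have \<Phi>3: "F x\<^sub>0 / 2 \<le> Re (\<Phi> w)" if "w \<in> ball (of_real x\<^sub>0) (\<epsilon> * x\<^sub>0)" for w
    proof -
      have "norm (w - of_real x\<^sub>0) \<le> \<epsilon> * x\<^sub>0" using that by (simp add: dist_norm norm_minus_commute)
      then have "2 * F x\<^sub>0 * (E / x\<^sub>0) * norm (w - of_real x\<^sub>0) \<le> 2 * F x\<^sub>0 * (E / x\<^sub>0) * (\<epsilon> * x\<^sub>0)"
        using Fx0 E x0 by (intro mult_left_mono) auto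
      also have "\<dots> = 2 * F x\<^sub>0 * (E * \<epsilon>)" using x0 by simp
      also have "\<dots> \<le> 2 * F x\<^sub>0 * (1 / 4)" using \<epsilon> Fx0 by (intro mult_left_mono) auto
      finally have "norm (\<Phi> w - of_real (F x\<^sub>0)) \<le> F x\<^sub>0 / 2" using \<Phi>(3)[OF that] x0 dF(1) by simp
      then show ?thesis using abs_Re_le_cmod[of "\<Phi> w - of_real (F x\<^sub>0)"] by simp
    qed
    have realG: "G (of_real t) = of_real (\<sigma> * g t)" if "\<bar>t - t\<^sub>0\<bar> < r" for t
    proof -
      have "D * \<bar>t - t\<^sub>0\<bar> < D * r" using that D by simp
      then have "D * \<bar>t - t\<^sub>0\<bar> < 1" using Dr by linarith
      then have "(\<lambda>n. dg n t\<^sub>0 / fact n * (t - t\<^sub>0) ^ n) sums dg 0 t"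
        using D Dr dg by (intro taylor_sums[of UNIV dg t\<^sub>0 t 1 D]) auto
      then have "(\<lambda>n. \<sigma> * (dg n t\<^sub>0 / fact n * (t - t\<^sub>0) ^ n)) sums (\<sigma> * dg 0 t)" by (rule sums_mult)
      then have "(\<lambda>n. complex_of_real (\<sigma> * (dg n t\<^sub>0 / fact n * (t - t\<^sub>0) ^ n))) sums of_real (\<sigma> * dg 0 t)" by (rule sums_of_real)
      then have "(\<lambda>n. complex_of_real (\<sigma> * (dg n t\<^sub>0 / fact n)) * (of_real t - of_real t\<^sub>0) ^ n) sums of_real (\<sigma> * dg 0 t)"
        by (simp add: mult.assoc)
      moreover have "complex_of_real t \<in> ball (of_real t\<^sub>0) r"
        using that by (simp add: dist_norm norm_minus_commute flip: of_real_diff)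
      ultimately show ?thesis using G(2) sums_unique2 dg(1) by metis
    qed
    have real\<Phi>: "\<Phi> (of_real y) = of_real (F y)" if y: "\<bar>y - x\<^sub>0\<bar> < \<epsilon> * x\<^sub>0" "y \<le> A" for y
    proof -
      define S where "S = {(1 - \<epsilon>) * x\<^sub>0..min A ((1 + \<epsilon>) * x\<^sub>0)}"
      have pos: "0 < (1 - \<epsilon>) * x\<^sub>0" using \<epsilon> x0 by auto
      have SA: "S \<subseteq> {0<..A}" using pos unfolding S_def by auto
      have xS: "x\<^sub>0 \<in> S" "y \<in> S" using x0 \<epsilon> y unfolding S_def by (auto simp: algebra_simps abs_if split: if_splits)
      have "(\<lambda>n. dF n x\<^sub>0 / fact n * (y - x\<^sub>0) ^ n) sums dF 0 y"
      proof (rule taylor_sums[of S dF x\<^sub>0 y "F ((1 - \<epsilon>) * x\<^sub>0)" "E / ((1 - \<epsilon>) * x\<^sub>0)"])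
        show "convex S" unfolding S_def by simp
        show "(dF n has_real_derivative dF (Suc n) x) (at x within S)" if "x \<in> S" for n x
          using dF(2)[of x n] SA that DERIV_subset by blast
        show "\<bar>dF n x\<bar> \<le> F ((1 - \<epsilon>) * x\<^sub>0) * (E / ((1 - \<epsilon>) * x\<^sub>0)) ^ n * fact n" if "1 \<le> n" "x \<in> S" for n x
        proof -
          have x: "0 < x" "x \<le> A" "(1 - \<epsilon>) * x\<^sub>0 \<le> x" using that(2) SA by (auto simp: S_def)
          have "F x \<le> F ((1 - \<epsilon>) * x\<^sub>0)" using x pos anti by blast
          moreover have "(E / x) ^ n \<le> (E / ((1 - \<epsilon>) * x\<^sub>0)) ^ n"
            using x pos E by (intro power_mono divide_left_mono) auto
          moreover have "0 \<le> F x" using Omega_outer_abs(2)[OF F, of x] x by auto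
          ultimately have "F x * (E / x) ^ n \<le> F ((1 - \<epsilon>) * x\<^sub>0) * (E / ((1 - \<epsilon>) * x\<^sub>0)) ^ n"
            using x E by (intro mult_mono) auto
          then have m: "F x * (E / x) ^ n * fact n \<le> F ((1 - \<epsilon>) * x\<^sub>0) * (E / ((1 - \<epsilon>) * x\<^sub>0)) ^ n * fact n"
            by (intro mult_right_mono) auto
          have "x \<in> {0<..A}" using x by simp
          from order_trans[OF dFE[OF that(1) this] m] show ?thesis .
        qed
        have "E * \<bar>y - x\<^sub>0\<bar> \<le> E * (\<epsilon> * x\<^sub>0)" using y E by (intro mult_left_mono) auto
        also have "\<dots> \<le> 1 / 4 * x\<^sub>0" using \<epsilon>(3) x0 by (simp add: mult.assoc[symmetric] mult_right_mono)
        also have "\<dots> < (1 / 2) * x\<^sub>0" using x0 by simp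
        also have "\<dots> \<le> (1 - \<epsilon>) * x\<^sub>0" using \<epsilon> x0 by (intro mult_right_mono) auto
        finally show "E / ((1 - \<epsilon>) * x\<^sub>0) * \<bar>y - x\<^sub>0\<bar> < 1" using pos by (simp add: field_simps)
      qed (use xS pos E in auto)
      then have "(\<lambda>n. complex_of_real (dF n x\<^sub>0 / fact n * (y - x\<^sub>0) ^ n)) sums of_real (dF 0 y)" by (rule sums_of_real)
      then have "(\<lambda>n. complex_of_real (dF n x\<^sub>0 / fact n) * (of_real y - of_real x\<^sub>0) ^ n) sums of_real (dF 0 y)" by simp
      moreover have "complex_of_real y \<in> ball (of_real x\<^sub>0) (\<epsilon> * x\<^sub>0)"
        using y by (simp add: dist_norm norm_minus_commute flip: of_real_diff)
      ultimately have "\<Phi> (of_real y) = of_real (dF 0 y)" using \<Phi>(2) sums_unique2 by metis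
      then show ?thesis using dF(1) xS SA by auto
    qed
    define H where "H z = exp (- \<Phi> (G z))" for z
    have "H holomorphic_on ball (of_real t\<^sub>0) r"
    proof -
      have "(\<Phi> \<circ> G) holomorphic_on ball (of_real t\<^sub>0) r"
        using G3 by (intro holomorphic_on_compose_gen[OF G(1) \<Phi>(1)]) auto
      then show ?thesis unfolding H_def by (intro holomorphic_intros) (simp add: o_def)
    qed
    moreover have "norm (H z) \<le> exp (- F (g t\<^sub>0) / 2)" if "z \<in> ball (of_real t\<^sub>0) r" for z
      using \<Phi>3[OF G3[OF that]] Fx0 unfolding H_def by simp
    moreover have "g t \<noteq> 0 \<and> H (of_real t) = of_real (exp (- F (g t)))" if t: "\<bar>t - t\<^sub>0\<bar> < r" for t
    proof -
      have "complex_of_real t \<in> ball (of_real t\<^sub>0) r"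
        using t by (simp add: dist_norm norm_minus_commute flip: of_real_diff)
      then have "\<bar>\<sigma> * g t - x\<^sub>0\<bar> < \<epsilon> * x\<^sub>0" using G3 realG[OF t]
        by (metis dist_norm mem_ball norm_minus_commute norm_of_real of_real_diff)
      note y = this
      have "\<epsilon> * x\<^sub>0 \<le> x\<^sub>0" using \<epsilon> x0 by auto
      then have pos: "0 < \<sigma> * g t" using y by linarith
      have abs: "\<sigma> * g t = \<bar>g t\<bar>" using pos \<sigma>(1) by (metis abs_mult abs_of_pos mult_1)
      have gA: "\<bar>g t\<bar> \<le> A" by (rule Omega_inner_bounded[OF g])
      have "\<Phi> (G (of_real t)) = of_real (F \<bar>g t\<bar>)" using realG[OF t] real\<Phi>[OF y] abs gA by simp
      moreover have "F \<bar>g t\<bar> = F (g t)" using pos abs gA by (intro Omega_outer_abs(1)[OF F]) auto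
      moreover have "g t \<noteq> 0" using pos by auto
      ultimately show ?thesis unfolding H_def by (simp flip: exp_of_real)
    qed
    ultimately show "\<exists>H. H holomorphic_on ball (of_real t\<^sub>0) (c * \<bar>g t\<^sub>0\<bar>) \<and>
      (\<forall>z\<in>ball (of_real t\<^sub>0) (c * \<bar>g t\<^sub>0\<bar>). norm (H z) \<le> exp (- F (g t\<^sub>0) / 2)) \<and>
      (\<forall>t. \<bar>t - t\<^sub>0\<bar> < c * \<bar>g t\<^sub>0\<bar> \<longrightarrow> g t \<noteq> 0 \<and> H (of_real t) = of_real (exp (- F (g t))))"
      unfolding r_def x\<^sub>0_def by (intro exI[of _ H]) blast
  qed
qed

text \<open>By the lower bound in the fourth condition on \<open>F\<close>, the function \<open>ln (F t) + \<alpha> * ln t\<close> is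
  nonincreasing; the sign of the derivative comes from monotonicity.\<close>

lemma Omega_outer_growth:
  assumes A: "0 < A" and F: "Omega_outer A F"
  obtains \<alpha> where "0 < \<alpha>" "\<And>x y. 0 < x \<Longrightarrow> x \<le> y \<Longrightarrow> y \<le> A \<Longrightarrow> F y * (y / x) powr \<alpha> \<le> F x"
proof -
  obtain dF where sd: "successive_derivs_on {0<..A} F dF"
    and "\<exists>A1>0. \<exists>A2>0. \<forall>x\<in>{0<..A}. A2 \<le> \<bar>dF 1 x\<bar> * x / F x \<and> \<bar>dF 1 x\<bar> * x / F x \<le> A1"
    using F unfolding Omega_outer_def by blast
  then obtain \<alpha> where \<alpha>: "0 < \<alpha>" "\<And>x. x \<in> {0<..A} \<Longrightarrow> \<alpha> \<le> \<bar>dF 1 x\<bar> * x / F x" by blast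
  have anti: "F y \<le> F x" if "0 < x" "x \<le> y" "y \<le> A" for x y
    using F that unfolding Omega_outer_def monotone_on_def by auto
  have pos: "0 < F x" if "0 < x" "x \<le> A" for x using Omega_outer_abs(2)[OF F, of x] that by auto
  have dF: "(F has_real_derivative dF 1 x) (at x within {0<..A})" if "x \<in> {0<..A}" for x
  proof (rule has_field_derivative_transform_within[of "dF 0"])
    show "(dF 0 has_real_derivative dF 1 x) (at x within {0<..A})" "\<And>y. y \<in> {0<..A} \<Longrightarrow> dist y x < 1 \<Longrightarrow> dF 0 y = F y"
      using sd that unfolding successive_derivs_on_def by auto
  qed (use that in auto)
  have der: "dF 1 x \<le> - \<alpha> * F x / x" if x: "0 < x" "x < A" for x
  proof -
    have "(F has_real_derivative dF 1 x) (at x)"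
    proof -
      have "at x within {0<..A} = at x" using x by (intro at_within_open_subset[of x "{0<..<A}"]) auto
      then show ?thesis using dF[of x] x by simp
    qed
    have "\<not> 0 < dF 1 x"
    proof
      assume "0 < dF 1 x"
      from DERIV_pos_inc_right[OF \<open>(F has_real_derivative dF 1 x) (at x)\<close> this]
      obtain \<delta> where \<delta>: "0 < \<delta>" "\<And>h. 0 < h \<Longrightarrow> h < \<delta> \<Longrightarrow> F x < F (x + h)" by blast
      define h where "h = min (\<delta> / 2) (A - x)"
      have "0 < h" "h < \<delta>" "x + h \<le> A" using \<delta>(1) x by (auto simp: h_def)
      then show False using \<delta>(2)[of h] anti[of x "x + h"] x by simp
    qed
    then have "\<alpha> \<le> - dF 1 x * x / F x" using \<alpha>(2)[of x] x by (auto simp: abs_if split: if_splits)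
    then show ?thesis using pos[of x] x by (simp add: field_simps)
  qed
  show thesis
  proof (rule that[OF \<alpha>(1)])
    fix x y assume xy: "0 < x" "x \<le> y" "y \<le> A"
    show "F y * (y / x) powr \<alpha> \<le> F x"
    proof (cases "x = y")
      case False
      then have lt: "x < y" using xy by simp
      let ?\<phi> = "\<lambda>t. ln (F t) + \<alpha> * ln t" and ?\<phi>' = "\<lambda>t. dF 1 t / F t + \<alpha> / t"
      have d: "(?\<phi> has_real_derivative ?\<phi>' t) (at t within {x..y})" if "t \<in> {x..y}" for t
      proof -
        have "(F has_real_derivative dF 1 t) (at t within {x..y})"
          using dF[of t] that xy by (auto intro: DERIV_subset)
        then show ?thesis using pos[of t] that xy
          by (auto intro!: derivative_eq_intros simp: divide_inverse)
      qed
      from mvt_simple[OF lt d[unfolded has_field_derivative_def]]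
      obtain \<xi> where \<xi>: "\<xi> \<in> {x<..<y}" "?\<phi> y - ?\<phi> x = ?\<phi>' \<xi> * (y - x)" by auto
      have \<xi>0: "0 < \<xi>" "\<xi> < A" using \<xi> xy by auto
      have "dF 1 \<xi> / F \<xi> \<le> (- \<alpha> * F \<xi> / \<xi>) / F \<xi>" using der[OF \<xi>0] pos[of \<xi>] \<xi>0 by (intro divide_right_mono) auto
      then have "?\<phi>' \<xi> \<le> 0" using pos[of \<xi>] \<xi>0 by simp
      then have "?\<phi> y - ?\<phi> x \<le> 0" unfolding \<xi>(2) using lt by (intro mult_nonpos_nonneg) auto
      then have "ln (F y) + \<alpha> * ln (y / x) \<le> ln (F x)" using xy lt by (simp add: ln_div algebra_simps)
      then have "exp (ln (F y) + \<alpha> * ln (y / x)) \<le> F x" using pos[of x] xy by (simp add: ln_ge_iff)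
      then show ?thesis using pos[of y] xy lt by (simp add: exp_add powr_def)
    qed (use xy in simp)
  qed
qed

lemma real_derivative_of_complex:
  assumes "(H has_field_derivative H') (at (complex_of_real t))"
  shows "((\<lambda>s. Re (H (of_real s))) has_real_derivative Re H') (at t)"
proof -
  have "((\<lambda>s. H (of_real s)) has_vector_derivative H') (at t)"
    using assms by (rule has_vector_derivative_real_field)
  from bounded_linear.has_vector_derivative[OF bounded_linear_Re this]
  show ?thesis by (simp add: has_real_derivative_iff_has_vector_derivative)
qed

lemma iterated_deriv_of_real_part:
  assumes H: "H holomorphic_on ball (of_real t\<^sub>0) r"
    and eq: "\<And>t. \<bar>t - t\<^sub>0\<bar> < r \<Longrightarrow> \<omega> t = Re (H (of_real t))" and t: "\<bar>t - t\<^sub>0\<bar> < r"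
  shows "(deriv ^^ k) \<omega> t = Re ((deriv ^^ k) H (of_real t))"
    "((deriv ^^ k) \<omega> has_real_derivative (deriv ^^ Suc k) \<omega> t) (at t)"
proof -
  have loc: "((deriv ^^ k) \<omega> has_real_derivative Re ((deriv ^^ Suc k) H (of_real t))) (at t)"
    if IH: "\<And>t. \<bar>t - t\<^sub>0\<bar> < r \<Longrightarrow> (deriv ^^ k) \<omega> t = Re ((deriv ^^ k) H (of_real t))" and t: "\<bar>t - t\<^sub>0\<bar> < r" for k t
  proof -
    have "complex_of_real t \<in> ball (of_real t\<^sub>0) r"
      using t by (simp add: dist_norm norm_minus_commute flip: of_real_diff)
    then have "((deriv ^^ k) H has_field_derivative (deriv ^^ Suc k) H (of_real t)) (at (of_real t))"
      using holomorphic_derivI[OF holomorphic_higher_deriv[OF H open_ball, of k] open_ball] by simp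
    from real_derivative_of_complex[OF this]
    show ?thesis
    proof (rule has_field_derivative_transform_within_open)
      show "t \<in> {t\<^sub>0 - r<..<t\<^sub>0 + r}" using t by auto
      show "Re ((deriv ^^ k) H (of_real s)) = (deriv ^^ k) \<omega> s" if "s \<in> {t\<^sub>0 - r<..<t\<^sub>0 + r}" for s
        using IH[of s] that by auto
    qed simp
  qed
  have main: "(deriv ^^ k) \<omega> t = Re ((deriv ^^ k) H (of_real t))" if "\<bar>t - t\<^sub>0\<bar> < r" for k t
    using that
  proof (induction k arbitrary: t)
    case (Suc k)
    show ?case using DERIV_imp_deriv[OF loc[OF Suc.IH Suc.prems]] by simp
  qed (simp add: eq)
  show "(deriv ^^ k) \<omega> t = Re ((deriv ^^ k) H (of_real t))" using main t by blast
  show "((deriv ^^ k) \<omega> has_real_derivative (deriv ^^ Suc k) \<omega> t) (at t)"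
    using loc[OF main t, of k] main[OF t, of "Suc k"] by simp
qed

lemma derivative_zero_if_quadratic:
  fixes f :: "real \<Rightarrow> real"
  assumes "\<And>t. \<bar>f t\<bar> \<le> M * (t - a)\<^sup>2"
  shows "(f has_real_derivative 0) (at a)"
proof -
  have fa: "f a = 0" using assms[of a] by simp
  have "((\<lambda>t. M * \<bar>t - a\<bar>) \<longlongrightarrow> M * \<bar>a - a\<bar>) (at a)" by (intro tendsto_intros)
  then have l: "((\<lambda>t. M * \<bar>t - a\<bar>) \<longlongrightarrow> 0) (at a)" by simp
  have "norm ((f t - f a) / (t - a)) \<le> M * \<bar>t - a\<bar>" if "t \<noteq> a" for t
    using assms[of t] that by (simp add: fa divide_simps power2_eq_square abs_mult mult.assoc split: abs_split)
  then have "\<forall>\<^sub>F t in at a. norm ((f t - f a) / (t - a)) \<le> M * \<bar>t - a\<bar>"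
    unfolding eventually_at by (intro exI[of _ 1]) auto
  from Lim_null_comparison[OF this l] show ?thesis by (simp add: has_field_derivative_iff)
qed

text \<open>Away from the zeros of \<open>g\<close> the bounds are Cauchy's estimates for the local extensions. At a zero all
  derivatives vanish: \<open>exp (- F / 2)\<close> decays faster than any power of its argument and therefore beats
  the factor \<open>1 / \<bar>g\<bar> ^ k\<close> with two powers of \<open>g\<close> to spare, and \<open>g\<close> is Lipschitz, so each iterated
  derivative is quadratically small near the zero.\<close>

theorem Omega_smooth:
  assumes A: "0 < A" and g: "Omega_inner A g" and F: "Omega_outer A F"
  defines "\<omega> \<equiv> \<lambda>t. if g t = 0 then 0 else exp (- F (g t))"
  obtains c where "0 < c"
    "\<And>k t. ((deriv ^^ k) \<omega> has_real_derivative (deriv ^^ Suc k) \<omega> t) (at t)"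
    "\<And>k t. g t = 0 \<Longrightarrow> (deriv ^^ k) \<omega> t = 0"
    "\<And>k t. g t \<noteq> 0 \<Longrightarrow> \<bar>(deriv ^^ k) \<omega> t\<bar> \<le> fact k / (c * \<bar>g t\<bar>) ^ k * exp (- F (g t) / 2)"
proof -
  obtain c where c: "0 < c" and loc: "\<And>t\<^sub>0. g t\<^sub>0 \<noteq> 0 \<Longrightarrow> \<exists>H. H holomorphic_on ball (of_real t\<^sub>0) (c * \<bar>g t\<^sub>0\<bar>) \<and>
      (\<forall>z\<in>ball (of_real t\<^sub>0) (c * \<bar>g t\<^sub>0\<bar>). norm (H z) \<le> exp (- F (g t\<^sub>0) / 2)) \<and>
      (\<forall>t. \<bar>t - t\<^sub>0\<bar> < c * \<bar>g t\<^sub>0\<bar> \<longrightarrow> g t \<noteq> 0 \<and> H (of_real t) = of_real (exp (- F (g t))))"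
    using Omega_local_holomorphic[OF A g F] by blast
  have off: "((deriv ^^ k) \<omega> has_real_derivative (deriv ^^ Suc k) \<omega> t) (at t) \<and>
      \<bar>(deriv ^^ k) \<omega> t\<bar> \<le> fact k / (c / 2 * \<bar>g t\<bar>) ^ k * exp (- F (g t) / 2)" if gt: "g t \<noteq> 0" for k t
  proof -
    define r where "r = c * \<bar>g t\<bar>"
    have r: "0 < r" using gt c by (simp add: r_def)
    obtain H where H: "H holomorphic_on ball (of_real t) r"
      "\<And>z. z \<in> ball (of_real t) r \<Longrightarrow> norm (H z) \<le> exp (- F (g t) / 2)"
      "\<And>s. \<bar>s - t\<bar> < r \<Longrightarrow> g s \<noteq> 0 \<and> H (of_real s) = of_real (exp (- F (g s)))"
      using loc[OF gt] unfolding r_def by blast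
    have eq: "\<omega> s = Re (H (of_real s))" if "\<bar>s - t\<bar> < r" for s
      using H(3)[OF that] by (simp add: \<omega>_def)
    have "norm ((deriv ^^ k) H (of_real t)) \<le> fact k * exp (- F (g t) / 2) / (r / 2) ^ k"
    proof (rule Cauchy_inequality)
      show "H holomorphic_on ball (of_real t) (r / 2)" using H(1) r by (auto elim!: holomorphic_on_subset)
      show "continuous_on (cball (of_real t) (r / 2)) H"
        using H(1) r by (auto intro!: holomorphic_on_imp_continuous_on elim!: holomorphic_on_subset)
      show "norm (H z) \<le> exp (- F (g t) / 2)" if "norm (of_real t - z) = r / 2" for z
        using that r by (intro H(2)) (auto simp: dist_norm)
    qed (use r in simp)
    moreover have "\<bar>(deriv ^^ k) \<omega> t\<bar> \<le> norm ((deriv ^^ k) H (of_real t))"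
      using iterated_deriv_of_real_part(1)[OF H(1) eq, of t k] r abs_Re_le_cmod by simp
    ultimately have "\<bar>(deriv ^^ k) \<omega> t\<bar> \<le> fact k / (c / 2 * \<bar>g t\<bar>) ^ k * exp (- F (g t) / 2)"
      unfolding r_def by (simp add: mult.assoc)
    moreover have "((deriv ^^ k) \<omega> has_real_derivative (deriv ^^ Suc k) \<omega> t) (at t)"
      using iterated_deriv_of_real_part(2)[OF H(1) eq, of t k] r by simp
    ultimately show ?thesis by blast
  qed
  obtain \<alpha> where \<alpha>: "0 < \<alpha>" "\<And>x y. 0 < x \<Longrightarrow> x \<le> y \<Longrightarrow> y \<le> A \<Longrightarrow> F y * (y / x) powr \<alpha> \<le> F x"
    using Omega_outer_growth[OF A F] by blast
  have FA: "0 < F A" using Omega_outer_abs(2)[OF F, of A] A by auto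
  have decay: "\<exists>M\<ge>0. \<forall>t. g t \<noteq> 0 \<longrightarrow> \<bar>(deriv ^^ k) \<omega> t\<bar> \<le> M * (g t)\<^sup>2" for k
  proof -
    \<comment> \<open>The \<open>j\<close>-th term of the series for \<open>exp (F / 2)\<close> bounds \<open>exp (- F / 2)\<close> by a multiple of \<open>x ^ (k + 2)\<close>.\<close>
    define j where "j = nat \<lceil>(real k + 2) / \<alpha>\<rceil>"
    have j: "real k + 2 \<le> \<alpha> * real j"
    proof -
      have "(real k + 2) / \<alpha> \<le> real j" unfolding j_def by (rule real_nat_ceiling_ge)
      then show ?thesis using \<alpha>(1) by (simp add: pos_divide_le_eq mult.commute)
    qed
    define M where "M = fact k / (c / 2) ^ k * (fact j * (2 / F A) ^ j / A ^ (k + 2))"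
    have M: "0 \<le> M" unfolding M_def using c FA A by simp
    have "\<bar>(deriv ^^ k) \<omega> t\<bar> \<le> M * (g t)\<^sup>2" if gt: "g t \<noteq> 0" for t
    proof -
      define x where "x = \<bar>g t\<bar>"
      have x: "0 < x" "x \<le> A" using gt Omega_inner_bounded[OF g] by (auto simp: x_def)
      have Fx: "F (g t) = F x" "0 < F x" using Omega_outer_abs[OF F, of "g t"] x by (auto simp: x_def)
      have "exp (- F x / 2) \<le> fact j * (2 / F x) ^ j"
        using power_le_fact_exp[of "F x / 2" j] Fx by (simp add: exp_minus power_divide field_simps)
      also have "\<dots> \<le> fact j * (2 / (F A * (A / x) powr \<alpha>)) ^ j"
        using \<alpha>(2)[OF x order_refl] FA x A Fx by (intro mult_left_mono power_mono divide_left_mono mult_pos_pos) auto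
      also have "2 / (F A * (A / x) powr \<alpha>) = 2 / F A * (x / A) powr \<alpha>"
        using x A by (simp add: powr_divide)
      also have "(2 / F A * (x / A) powr \<alpha>) ^ j = (2 / F A) ^ j * (x / A) powr (\<alpha> * real j)"
        unfolding power_mult_distrib using x A by (simp add: powr_powr[symmetric] powr_realpow)
      also have "(x / A) powr (\<alpha> * real j) \<le> (x / A) powr (real (k + 2))"
        using j x A by (intro powr_mono') auto
      also have "(x / A) powr (real (k + 2)) = (x / A) ^ (k + 2)" using x A by (intro powr_realpow) auto
      finally have e: "exp (- F x / 2) \<le> fact j * ((2 / F A) ^ j * (x / A) ^ (k + 2))"
        using FA by (simp add: mult_left_mono)
      have "\<bar>(deriv ^^ k) \<omega> t\<bar> \<le> fact k / (c / 2 * x) ^ k * exp (- F x / 2)"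
        using off[OF gt, of k] by (simp add: x_def Fx(1)[unfolded x_def])
      also have "\<dots> \<le> fact k / (c / 2 * x) ^ k * (fact j * ((2 / F A) ^ j * (x / A) ^ (k + 2)))"
        using e c x by (intro mult_left_mono) auto
      also have "\<dots> = M * x\<^sup>2" unfolding M_def power_mult_distrib power_divide power_add using x A by (simp add: field_simps)
      finally show ?thesis by (simp add: x_def)
    qed
    then show ?thesis using M by blast
  qed
  obtain dg where sd: "successive_derivs_on UNIV g dg" and "\<exists>D>0. \<forall>t. \<forall>n\<ge>1. \<bar>dg n t\<bar> \<le> D ^ n * fact n"
    using g unfolding Omega_inner_def by blast
  then obtain D where D: "0 < D" "\<And>n t. 1 \<le> n \<Longrightarrow> \<bar>dg n t\<bar> \<le> D ^ n * fact n" by blast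
  have dg: "(g has_real_derivative dg 1 t) (at t)" for t
  proof -
    have "dg 0 = g" "(dg 0 has_real_derivative dg 1 t) (at t)"
      using sd unfolding successive_derivs_on_def by (auto simp: fun_eq_iff)
    then show ?thesis by simp
  qed
  have lip: "\<bar>g t - g a\<bar> \<le> D * \<bar>t - a\<bar>" for t a
    using field_differentiable_bound[of UNIV g "dg 1" D t a] dg D(2)[of 1] by simp
  have quad: "\<exists>M. \<forall>t. \<bar>(deriv ^^ k) \<omega> t\<bar> \<le> M * (t - a)\<^sup>2"
    if ga: "g a = 0" and z: "\<And>t. g t = 0 \<Longrightarrow> (deriv ^^ k) \<omega> t = 0" for k a
  proof -
    obtain M where M: "0 \<le> M" "\<And>t. g t \<noteq> 0 \<Longrightarrow> \<bar>(deriv ^^ k) \<omega> t\<bar> \<le> M * (g t)\<^sup>2" using decay[of k] by blast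
    have "\<bar>(deriv ^^ k) \<omega> t\<bar> \<le> M * D\<^sup>2 * (t - a)\<^sup>2" for t
    proof -
      have "(g t)\<^sup>2 \<le> (D * \<bar>t - a\<bar>)\<^sup>2" using lip[of t a] ga D by (intro abs_le_square_iff[THEN iffD1]) simp
      then have "M * (g t)\<^sup>2 \<le> M * D\<^sup>2 * (t - a)\<^sup>2" using M by (simp add: power_mult_distrib mult.assoc mult_left_mono)
      moreover have "\<bar>(deriv ^^ k) \<omega> t\<bar> \<le> M * (g t)\<^sup>2" using M z[of t] by (cases "g t = 0") auto
      ultimately show ?thesis by linarith
    qed
    then show ?thesis by blast
  qed
  have zero: "(deriv ^^ k) \<omega> a = 0" if "g a = 0" for k a
    using that
  proof (induction k arbitrary: a)
    case (Suc k)
    obtain M where "\<And>t. \<bar>(deriv ^^ k) \<omega> t\<bar> \<le> M * (t - a)\<^sup>2" using quad[OF Suc.prems Suc.IH] by blast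
    then have "((deriv ^^ k) \<omega> has_real_derivative 0) (at a)" by (rule derivative_zero_if_quadratic)
    then show ?case by (simp add: DERIV_imp_deriv)
  qed (simp add: \<omega>_def)
  have der: "((deriv ^^ k) \<omega> has_real_derivative (deriv ^^ Suc k) \<omega> t) (at t)" for k t
  proof (cases "g t = 0")
    case True
    obtain M where "\<And>s. \<bar>(deriv ^^ k) \<omega> s\<bar> \<le> M * (s - t)\<^sup>2" using quad[OF True zero] by blast
    then have "((deriv ^^ k) \<omega> has_real_derivative 0) (at t)" by (rule derivative_zero_if_quadratic)
    then show ?thesis using zero[OF True, of "Suc k"] by simp
  qed (use off in blast)
  show thesis
  proof (rule that)
    show "0 < c / 2" using c by simp
  qed (use der zero off in blast)+
qed

section \<open>Covering the small values of the inner function\<close>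

text \<open>A form of the simplicity of zeros that treats zeros and other points alike, so that compactness can
  be applied without first showing that there are finitely many zeros.\<close>

lemma local_linear_lower_bound:
  fixes g :: "real \<Rightarrow> real"
  assumes d: "(g has_real_derivative d) (at t)" and simple: "g t = 0 \<Longrightarrow> d \<noteq> 0"
  obtains c r where "0 < c" "0 < r" "\<And>s. s \<in> ball t r \<Longrightarrow> c * \<bar>s - t\<bar> \<le> \<bar>g s\<bar>"
proof (cases "g t = 0")
  case True
  then have d0: "d \<noteq> 0" using simple by simp
  have "((\<lambda>s. \<bar>(g s - g t) / (s - t)\<bar>) \<longlongrightarrow> \<bar>d\<bar>) (at t)"
    using d by (intro tendsto_intros) (simp add: has_field_derivative_iff)
  moreover have "\<bar>d\<bar> / 2 < \<bar>d\<bar>" using d0 by simp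
  ultimately have "\<forall>\<^sub>F s in at t. \<bar>d\<bar> / 2 < \<bar>(g s - g t) / (s - t)\<bar>" by (rule order_tendstoD)
  then obtain r where r: "0 < r" "\<And>s. s \<noteq> t \<Longrightarrow> dist s t < r \<Longrightarrow> \<bar>d\<bar> / 2 < \<bar>(g s - g t) / (s - t)\<bar>"
    unfolding eventually_at by auto
  have "\<bar>d\<bar> / 2 * \<bar>s - t\<bar> \<le> \<bar>g s\<bar>" if "s \<in> ball t r" for s
  proof (cases "s = t")
    case False
    then have "\<bar>d\<bar> / 2 < \<bar>g s\<bar> / \<bar>s - t\<bar>" using r(2)[of s] that True by (simp add: dist_commute abs_divide)
    then show ?thesis using False by (simp add: pos_less_divide_eq less_imp_le)
  qed simp
  then show thesis using that[of "\<bar>d\<bar> / 2" r] d0 r by simp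
next
  case False
  have "((\<lambda>s. \<bar>g s\<bar>) \<longlongrightarrow> \<bar>g t\<bar>) (at t)"
    using DERIV_isCont[OF d] by (intro tendsto_intros) (simp add: isCont_def)
  moreover have "\<bar>g t\<bar> / 2 < \<bar>g t\<bar>" using False by simp
  ultimately have "\<forall>\<^sub>F s in at t. \<bar>g t\<bar> / 2 < \<bar>g s\<bar>" by (rule order_tendstoD)
  then obtain r where r: "0 < r" "\<And>s. s \<noteq> t \<Longrightarrow> dist s t < r \<Longrightarrow> \<bar>g t\<bar> / 2 < \<bar>g s\<bar>"
    unfolding eventually_at by auto
  have "\<bar>g t\<bar> / 2 * \<bar>s - t\<bar> \<le> \<bar>g s\<bar>" if "s \<in> ball t (min r 1)" for s
  proof (cases "s = t")
    case False
    have "\<bar>s - t\<bar> \<le> 1" using that by (simp add: dist_real_def abs_minus_commute)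
    then have "\<bar>g t\<bar> / 2 * \<bar>s - t\<bar> \<le> \<bar>g t\<bar> / 2 * 1" by (intro mult_left_mono) auto
    then show ?thesis using r(2)[of s] that False by (simp add: dist_commute)
  qed simp
  then show thesis using that[of "\<bar>g t\<bar> / 2" "min r 1"] False r by simp
qed

lemma finite_linear_lower_bound:
  fixes g d :: "real \<Rightarrow> real"
  assumes d: "\<And>t. (g has_real_derivative d t) (at t)" and simple: "\<And>t. g t = 0 \<Longrightarrow> d t \<noteq> 0"
  obtains c P where "0 < c" "finite P" "P \<subseteq> {0..2 * pi}" "\<And>s. s \<in> {0..2 * pi} \<Longrightarrow> \<exists>t\<in>P. c * \<bar>s - t\<bar> \<le> \<bar>g s\<bar>"
proof -
  have "\<exists>c r. 0 < c \<and> 0 < r \<and> (\<forall>s\<in>ball t r. c * \<bar>s - t\<bar> \<le> \<bar>g s\<bar>)" for t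
    using local_linear_lower_bound[OF d simple, of t] by metis
  then obtain c r where cr: "\<And>t. 0 < c t" "\<And>t. 0 < r t" "\<And>t s. s \<in> ball t (r t) \<Longrightarrow> c t * \<bar>s - t\<bar> \<le> \<bar>g s\<bar>"
    by metis
  have "{0..2 * pi} \<subseteq> (\<Union>t\<in>{0..2 * pi}. ball t (r t))" using cr(2) by auto
  from compactE_image[OF compact_Icc _ this]
  obtain P where P: "P \<subseteq> {0..2 * pi}" "finite P" "{0..2 * pi} \<subseteq> (\<Union>t\<in>P. ball t (r t))" by auto
  define m where "m = Min (insert 1 (c ` P))"
  have m: "0 < m" "\<And>t. t \<in> P \<Longrightarrow> m \<le> c t" unfolding m_def using P cr by auto
  show thesis
  proof (rule that[OF m(1) P(2,1)])
    fix s assume "s \<in> {0..2 * pi}"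
    then obtain t where t: "t \<in> P" "s \<in> ball t (r t)" using P(3) by blast
    have "m * \<bar>s - t\<bar> \<le> c t * \<bar>s - t\<bar>" using m(2)[OF t(1)] by (intro mult_right_mono) auto
    also have "\<dots> \<le> \<bar>g s\<bar>" by (rule cr(3)[OF t(2)])
    finally show "\<exists>t\<in>P. m * \<bar>s - t\<bar> \<le> \<bar>g s\<bar>" using t(1) by blast
  qed
qed

text \<open>At most three translates of a short interval meet the fundamental domain, which explains the factor 6.\<close>

lemma measure_proj_torus_le:
  assumes t: "t \<in> {0..2 * pi}" and h: "0 < h" "h \<le> 1"
  shows "measure lebesgue (proj_torus {t - h<..<t + h}) \<le> 6 * h"
proof -
  let ?I = "\<lambda>k::int. {t - h - 2 * pi * of_int k<..<t + h - 2 * pi * of_int k}"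
  have sub: "proj_torus {t - h<..<t + h} \<subseteq> ?I (- 1) \<union> (?I 0 \<union> ?I 1)"
  proof
    fix s assume "s \<in> proj_torus {t - h<..<t + h}"
    then obtain k :: int where s: "0 \<le> s" "s < 2 * pi" and k: "s + 2 * pi * of_int k \<in> {t - h<..<t + h}"
      unfolding proj_torus_def torus_def by auto
    have "s + 2 * pi * of_int k < t + h" "t - h < s + 2 * pi * of_int k" "0 \<le> t" "t \<le> 2 * pi" using k t by auto
    then have "2 * pi * of_int k < 2 * pi * 2" "2 * pi * (- 2) < 2 * pi * of_int k"
      using s h pi_gt3 by linarith+
    then have "real_of_int k < 2" "- 2 < real_of_int k" by (simp_all only: mult_less_cancel_left_pos pi_gt_zero mult_pos_pos zero_less_numeral)
    then have "k = - 1 \<or> k = 0 \<or> k = 1" by linarith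
    then show "s \<in> ?I (- 1) \<union> (?I 0 \<union> ?I 1)" using k by auto
  qed
  have "measure lebesgue (proj_torus {t - h<..<t + h}) \<le> measure lebesgue (?I (- 1) \<union> (?I 0 \<union> ?I 1))"
    using sub proj_torus_measurable[of "{t - h<..<t + h}"] by (intro measure_mono_fmeasurable) (auto simp: is_interval_convex)
  also have "\<dots> \<le> measure lebesgue (?I (- 1)) + (measure lebesgue (?I 0) + measure lebesgue (?I 1))"
    by (intro order_trans[OF measure_Un_le] add_left_mono measure_Un_le) auto
  also have "\<dots> = 6 * h" using h by simp
  finally show ?thesis .
qed

lemma small_value_cover:
  assumes "0 < c" "finite P" "P \<subseteq> {0..2 * pi}" "\<And>s. s \<in> {0..2 * pi} \<Longrightarrow> \<exists>t\<in>P. c * \<bar>s - t\<bar> \<le> \<bar>g s\<bar>"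
    and h: "0 < h" "h \<le> 1" "1 / real n \<le> 2 * h"
  obtains U where "finite_union_of_intervals n U" "measure lebesgue U \<le> 6 * real (card P) * h"
    "{s \<in> torus. \<bar>g s\<bar> < c * h} \<subseteq> U"
proof -
  define U where "U = (\<Union>t\<in>P. proj_torus {t - h<..<t + h})"
  show thesis
  proof (rule that)
    show "finite_union_of_intervals n U"
      unfolding finite_union_of_intervals_def U_def using assms h
      by (intro exI[of _ "(\<lambda>t. {t - h<..<t + h}) ` P"]) (auto simp: is_interval_convex)
    have "measure lebesgue U \<le> (\<Sum>t\<in>P. measure lebesgue (proj_torus {t - h<..<t + h}))"
      unfolding U_def using assms proj_torus_measurable by (intro measure_UNION_le) (auto simp: is_interval_convex)
    also have "\<dots> \<le> (\<Sum>t\<in>P. 6 * h)" using assms h by (intro sum_mono measure_proj_torus_le) auto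
    finally show "measure lebesgue U \<le> 6 * real (card P) * h" by (simp add: mult_ac)
    show "{s \<in> torus. \<bar>g s\<bar> < c * h} \<subseteq> U"
    proof clarify
      fix s assume s: "s \<in> torus" "\<bar>g s\<bar> < c * h"
      then obtain t where t: "t \<in> P" "c * \<bar>s - t\<bar> \<le> \<bar>g s\<bar>" using assms(4)[of s] by (auto simp: torus_def)
      then have "c * \<bar>s - t\<bar> < c * h" using s by linarith
      then have "\<bar>s - t\<bar> < h" using assms(1) by simp
      then have "s + 2 * pi * of_int 0 \<in> {t - h<..<t + h}" by auto
      then have "s \<in> proj_torus {t - h<..<t + h}" unfolding proj_torus_def using s(1) by blast
      then show "s \<in> U" unfolding U_def using t by blast
    qed
  qed
qed

section \<open>Weights in Omega are mimicked by polynomials\<close>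

lemma periodic_iterated_deriv:
  fixes f :: "real \<Rightarrow> real"
  assumes per: "\<And>t. f (t + p) = f t"
    and der: "\<And>k t. ((deriv ^^ k) f has_real_derivative (deriv ^^ Suc k) f t) (at t)"
  shows "(deriv ^^ k) f (t + p) = (deriv ^^ k) f t"
proof (induction k arbitrary: t)
  case (Suc k)
  have "((\<lambda>s. (deriv ^^ k) f (s + p)) has_real_derivative (deriv ^^ Suc k) f (t + p)) (at t)"
    using der[of k "t + p"] by (subst (asm) DERIV_shift)
  then have "((deriv ^^ k) f has_real_derivative (deriv ^^ Suc k) f (t + p)) (at t)" by (simp add: Suc.IH)
  then show ?case using der DERIV_unique by blast
qed (simp add: per)

lemma powr_exp_tradeoff:
  fixes \<alpha> :: real
  assumes "0 < \<alpha>"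
  obtains R where "1 \<le> R" "\<And>y. 1 \<le> y \<Longrightarrow> y * exp (- (y powr \<alpha>) / 6) \<le> R"
proof -
  define j where "j = nat \<lceil>1 / \<alpha>\<rceil>"
  have "1 / \<alpha> \<le> real j" unfolding j_def by (rule real_nat_ceiling_ge)
  then have j: "1 \<le> \<alpha> * real j" using assms by (simp add: pos_divide_le_eq mult.commute)
  have "y * exp (- (y powr \<alpha>) / 6) \<le> fact j * 6 ^ j" if y: "1 \<le> y" for y :: real
  proof -
    have "(y powr \<alpha> / 6) ^ j \<le> fact j * exp (y powr \<alpha> / 6)" by (rule power_le_fact_exp) simp
    moreover have "(y powr \<alpha>) ^ j = y powr (\<alpha> * real j)" using y by (simp add: powr_powr[symmetric] powr_realpow)
    moreover have "y powr 1 \<le> y powr (\<alpha> * real j)" using j y by (intro powr_mono) auto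
    ultimately have "y \<le> fact j * exp (y powr \<alpha> / 6) * 6 ^ j" using y by (simp add: power_divide field_simps)
    then have "y * exp (- (y powr \<alpha>) / 6) \<le> fact j * exp (y powr \<alpha> / 6) * 6 ^ j * exp (- (y powr \<alpha>) / 6)"
      by (intro mult_right_mono) auto
    also have "\<dots> = fact j * 6 ^ j * (exp (y powr \<alpha> / 6) * exp (- (y powr \<alpha>) / 6))" by simp
    also have "exp (y powr \<alpha> / 6) * exp (- (y powr \<alpha>) / 6) = 1" by (simp flip: exp_add)
    finally show ?thesis by simp
  qed
  moreover have "1 \<le> fact j * (6::real) ^ j"
    using mult_mono[of 1 "fact j" 1 "(6::real) ^ j"] by (simp add: fact_ge_1)
  ultimately show thesis using that by blast
qed

text \<open>For \<open>x > \<delta>\<close> the power of \<open>x\<close> alone gives the bound. For \<open>x \<le> \<delta>\<close> the growth of \<open>F\<close> supplies a factor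
  \<open>exp (- y powr \<alpha> / 6)\<close> for each of the \<open>k\<close> derivatives, where \<open>y = \<delta> / x\<close>; it compensates \<open>y\<close>
  because \<open>k \<le> 3 * F \<delta>\<close>.\<close>

lemma derivative_bound_at_scale:
  fixes x \<delta> c A Fx F\<delta> \<alpha> R :: real
  assumes x: "0 < x" and \<delta>: "0 < \<delta>" and c: "0 < c" and "0 < \<alpha>" and F: "0 < F\<delta>" "0 < Fx"
    and growth: "x \<le> \<delta> \<Longrightarrow> F\<delta> * (\<delta> / x) powr \<alpha> \<le> Fx"
    and R: "1 \<le> R" "\<And>y. 1 \<le> y \<Longrightarrow> y * exp (- (y powr \<alpha>) / 6) \<le> R"
    and k: "real k \<le> 3 * F\<delta>"
  shows "fact k / (c * x) ^ k * exp (- Fx / 2) \<le> (real k * R / (c * \<delta>)) ^ k"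
proof -
  have "exp (- Fx / 2) / x ^ k \<le> (R / \<delta>) ^ k"
  proof (cases "x \<le> \<delta>")
    case True
    define y where "y = \<delta> / x"
    have y: "1 \<le> y" using True x by (simp add: y_def)
    have "real k * (y powr \<alpha> / 6) \<le> 3 * F\<delta> * (y powr \<alpha> / 6)" using k by (intro mult_right_mono) auto
    also have "\<dots> \<le> Fx / 2" using growth[OF True] by (simp add: y_def)
    finally have "exp (- Fx / 2) \<le> exp (real k * (- (y powr \<alpha>) / 6))" by simp
    also have "\<dots> = exp (- (y powr \<alpha>) / 6) ^ k" by (simp only: exp_of_nat_mult)
    finally have "exp (- Fx / 2) / x ^ k \<le> exp (- (y powr \<alpha>) / 6) ^ k / x ^ k" using x by (intro divide_right_mono) auto
    also have "\<dots> = (y * exp (- (y powr \<alpha>) / 6) / \<delta>) ^ k" using \<delta> x by (simp add: y_def power_divide[symmetric])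
    also have "\<dots> \<le> (R / \<delta>) ^ k" using y \<delta> by (intro power_mono divide_right_mono R(2)) auto
    finally show ?thesis .
  next
    case False
    have "exp (- Fx / 2) / x ^ k \<le> 1 / x ^ k" using F x by (intro divide_right_mono) auto
    also have "\<dots> = (1 / x) ^ k" by (simp add: power_divide)
    also have "\<dots> \<le> (R / \<delta>) ^ k" using False x \<delta> R(1) by (intro power_mono frac_le) auto
    finally show ?thesis .
  qed
  then have "fact k / c ^ k * (exp (- Fx / 2) / x ^ k) \<le> fact k / c ^ k * (R / \<delta>) ^ k"
    using c by (intro mult_left_mono) auto
  also have "\<dots> \<le> real k ^ k / c ^ k * (R / \<delta>) ^ k"
    using c R \<delta> fact_le_power[of k, where 'a = real] by (intro mult_right_mono divide_right_mono) auto
  also have "\<dots> = (real k * R / (c * \<delta>)) ^ k" by (simp add: power_divide power_mult_distrib)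
  finally show ?thesis by (simp add: power_mult_distrib mult_ac)
qed

lemma Omega_outer_continuous:
  assumes "Omega_outer A F" shows "continuous_on {0<..A} F"
proof -
  obtain dF where sd: "successive_derivs_on {0<..A} F dF"
    using assms unfolding Omega_outer_def by blast
  then have "\<forall>x\<in>{0<..A}. (dF 0 has_real_derivative dF (Suc 0) x) (at x within {0<..A})"
    unfolding successive_derivs_on_def by blast
  then have "continuous_on {0<..A} (dF 0)"
    by (meson DERIV_continuous continuous_on_eq_continuous_within)
  then show ?thesis using sd unfolding successive_derivs_on_def by (metis (mono_tags, lifting) continuous_on_cong)
qed

text \<open>\<open>F\<close> exceeds the line \<open>M * n * x\<close> near \<open>0\<close> and lies below it at \<open>\<delta>\<^sub>0\<close>.\<close>

lemma Omega_outer_solve: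
  assumes F: "Omega_outer A F" and M: "0 < M" "0 < \<delta>\<^sub>0" "\<delta>\<^sub>0 \<le> A"
    and n: "F \<delta>\<^sub>0 / (M * \<delta>\<^sub>0) \<le> real n"
  obtains \<delta> where "0 < \<delta>" "\<delta> \<le> \<delta>\<^sub>0" "F \<delta> = M * real n * \<delta>"
proof -
  have "filterlim F at_top (at_right 0)" using F unfolding Omega_outer_def by blast
  then have "eventually (\<lambda>x. M * real n * \<delta>\<^sub>0 \<le> F x) (at_right 0)" unfolding filterlim_at_top by blast
  then obtain b where b: "0 < b" "\<And>x. 0 < x \<Longrightarrow> x < b \<Longrightarrow> M * real n * \<delta>\<^sub>0 \<le> F x"
    unfolding eventually_at_right_field by auto
  define x where "x = min (b / 2) \<delta>\<^sub>0"
  have x: "0 < x" "x < b" "x \<le> \<delta>\<^sub>0" using b M by (auto simp: x_def)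
  have "M * real n * x \<le> M * real n * \<delta>\<^sub>0" using x M by (intro mult_left_mono) auto
  then have 1: "0 \<le> F x - M * real n * x" using b(2)[OF x(1,2)] by linarith
  have "F \<delta>\<^sub>0 \<le> real n * (M * \<delta>\<^sub>0)" using n M by (simp add: pos_divide_le_eq)
  then have 2: "F \<delta>\<^sub>0 - M * real n * \<delta>\<^sub>0 \<le> 0" by (simp add: mult_ac)
  have "continuous_on {x..\<delta>\<^sub>0} (\<lambda>t. F t - M * real n * t)"
    using x M by (intro continuous_intros continuous_on_subset[OF Omega_outer_continuous[OF F]]) auto
  from IVT2'[OF 2 1 x(3) this] obtain \<delta> where "x \<le> \<delta>" "\<delta> \<le> \<delta>\<^sub>0" "F \<delta> - M * real n * \<delta> = 0" by blast
  moreover from this have "0 < \<delta>" "F \<delta> = M * real n * \<delta>" using x by auto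
  ultimately show thesis using that by blast
qed

text \<open>The number \<open>\<delta>\<close> solves \<open>F \<delta> = M' n \<delta>\<close>. The constant \<open>M'\<close> is chosen such that
  \<open>F \<delta> - F (2 \<delta>) \<ge> \<kappa> F \<delta> = M n \<tau>\<close>, which is the gap between \<open>B\<close> and the complement of \<open>U\<close>. The
  polynomial is the Fourier sum of degree \<open>D n\<close>, estimated with \<open>k \<approx> 2 F \<delta>\<close> derivatives.\<close>

theorem Omega_mimicked:
  assumes "\<omega> \<in> Omega"
  shows "mimicked \<omega>"
  unfolding mimicked_def
proof (intro allI impI)
  fix M \<eta> :: real assume M: "0 < M" and \<eta>: "0 < \<eta>"
  obtain A g F where A: "0 < A" and g: "Omega_inner A g" and F: "Omega_outer A F"
    and \<omega>: "\<omega> = (\<lambda>t. if g t = 0 then 0 else exp (- F (g t)))"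
    using assms unfolding Omega_def by blast
  obtain \<alpha> where \<alpha>: "0 < \<alpha>" "\<And>x y. 0 < x \<Longrightarrow> x \<le> y \<Longrightarrow> y \<le> A \<Longrightarrow> F y * (y / x) powr \<alpha> \<le> F x"
    using Omega_outer_growth[OF A F] by blast
  obtain c where c: "0 < c"
    and der: "\<And>k t. ((deriv ^^ k) \<omega> has_real_derivative (deriv ^^ Suc k) \<omega> t) (at t)"
    and zero: "\<And>k t. g t = 0 \<Longrightarrow> (deriv ^^ k) \<omega> t = 0"
    and dbound: "\<And>k t. g t \<noteq> 0 \<Longrightarrow> \<bar>(deriv ^^ k) \<omega> t\<bar> \<le> fact k / (c * \<bar>g t\<bar>) ^ k * exp (- F (g t) / 2)"
    using Omega_smooth[OF A g F] unfolding \<omega>[symmetric] by blast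
  have gper: "g (t + 2 * pi) = g t" for t using g unfolding Omega_inner_def periodic_2pi_def by blast
  have per: "(deriv ^^ k) \<omega> (t + 2 * pi) = (deriv ^^ k) \<omega> t" for k t
    by (rule periodic_iterated_deriv[OF _ der]) (simp add: \<omega> gper)
  have anti: "F y \<le> F x" if "0 < x" "x \<le> y" "y \<le> A" for x y
    using F that unfolding Omega_outer_def monotone_on_def by auto
  have Fpos: "0 < F x" if "0 < x" "x \<le> A" for x using Omega_outer_abs(2)[OF F, of x] that by auto
  have gA: "\<bar>g t\<bar> \<le> A" for t by (rule Omega_inner_bounded[OF g])
  have Fg: "F (g t) = F \<bar>g t\<bar>" if "g t \<noteq> 0" for t using Omega_outer_abs(1)[OF F, of "g t"] that gA by simp
  obtain dg where sd: "successive_derivs_on UNIV g dg" and simple: "\<And>t. g t = 0 \<Longrightarrow> dg 1 t \<noteq> 0"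
    using g unfolding Omega_inner_def by blast
  have dg: "(g has_real_derivative dg 1 t) (at t)" for t
  proof -
    have "dg 0 = g" "(dg 0 has_real_derivative dg 1 t) (at t)"
      using sd unfolding successive_derivs_on_def by (auto simp: fun_eq_iff)
    then show ?thesis by simp
  qed
  have cg: "continuous_on UNIV g" using dg by (meson continuous_at_imp_continuous_on DERIV_isCont)
  obtain c1 P where c1: "0 < c1" and P: "finite P" "P \<subseteq> {0..2 * pi}"
    "\<And>s. s \<in> {0..2 * pi} \<Longrightarrow> \<exists>t\<in>P. c1 * \<bar>s - t\<bar> \<le> \<bar>g s\<bar>"
    using finite_linear_lower_bound[OF dg simple] by blast
  have "P \<noteq> {}" using P(3)[of 0] by auto
  then have cardP: "0 < real (card P)" using P(1) by (simp add: card_gt_0_iff)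
  obtain R where R: "1 \<le> R" "\<And>y. 1 \<le> y \<Longrightarrow> y * exp (- (y powr \<alpha>) / 6) \<le> R"
    using powr_exp_tradeoff[OF \<alpha>(1)] by blast
  \<comment> \<open>\<open>F (2 \<delta>) \<le> (1 - \<kappa>) F \<delta>\<close> if \<open>2 \<delta> \<le> A\<close>, and \<open>C2 * \<delta>\<close> bounds the measure of the cover of \<open>{\<bar>g\<bar> < 2 \<delta>}\<close>.\<close>
  define \<kappa> where "\<kappa> = 1 - 2 powr (- \<alpha>)"
  have \<kappa>: "0 < \<kappa>" unfolding \<kappa>_def using \<alpha>(1) powr_less_cancel_iff[of 2 "- \<alpha>" 0] by simp
  define C2 where "C2 = 12 * real (card P) / c1"
  have C2: "0 < C2" unfolding C2_def using cardP c1 by simp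
  define M' where "M' = M * C2 / \<kappa>"
  have M': "0 < M'" unfolding M'_def using M C2 \<kappa> by simp
  \<comment> \<open>The factor \<open>exp 2\<close> turns the \<open>k\<close>-th power in the Fourier error into at most \<open>exp (- 4 F \<delta>)\<close>.\<close>
  define D where "D = nat \<lceil>exp 2 * 3 * R * M' / c\<rceil> + 1"
  have D: "exp 2 * 3 * R * M' / c \<le> real D" "1 \<le> D"
    unfolding D_def using real_nat_ceiling_ge[of "exp 2 * 3 * R * M' / c"] by auto
  have FA: "0 < F A" using Fpos A by simp
  \<comment> \<open>The degree \<open>D n = D F \<delta> / (M' \<delta>)\<close> is polynomial in \<open>F \<delta>\<close>, since \<open>1 / \<delta>\<close> is at most a power of \<open>F \<delta>\<close>.
  So a factor \<open>exp (2 F \<delta>)\<close> absorbs it.\<close>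
  have "eventually (\<lambda>x. 2 * real D / (M' * A) * x * (x / F A) powr (1 / \<alpha>) \<le> exp (2 * x)) at_top"
  proof -
    have "0 < 2 * real D / (M' * A)" "0 < 1 / \<alpha>" using D M' A \<alpha>(1) by auto
    with FA show ?thesis by real_asymp
  qed
  then obtain F0 where F0: "\<And>x. F0 \<le> x \<Longrightarrow> 2 * real D / (M' * A) * x * (x / F A) powr (1 / \<alpha>) \<le> exp (2 * x)"
    unfolding eventually_at_top_linorder by blast
  \<comment> \<open>Large values of \<open>F \<delta>\<close> make \<open>\<Lambda>\<close> at most \<open>1 / 2\<close>, the covering intervals at least \<open>1 / n\<close> long, and the
  previous estimate valid.\<close>
  define F1 where "F1 = max 1 (max (M' * c1 / 4) F0)"
  have "filterlim F at_top (at_right 0)" using F unfolding Omega_outer_def by blast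
  then have "eventually (\<lambda>x. F1 \<le> F x) (at_right 0)" unfolding filterlim_at_top by blast
  then obtain b where b: "0 < b" "\<And>x. 0 < x \<Longrightarrow> x < b \<Longrightarrow> F1 \<le> F x"
    unfolding eventually_at_right_field by auto
  define \<delta>\<^sub>0 where "\<delta>\<^sub>0 = min (b / 2) (min (A / 2) (min (\<eta> / C2) (c1 / 2)))"
  have \<delta>0: "0 < \<delta>\<^sub>0" "\<delta>\<^sub>0 < b" "\<delta>\<^sub>0 \<le> A / 2" "\<delta>\<^sub>0 \<le> \<eta> / C2" "\<delta>\<^sub>0 \<le> c1 / 2"
  proof -
    show "0 < \<delta>\<^sub>0" unfolding \<delta>\<^sub>0_def using b A \<eta> C2 c1 by auto
    have "\<delta>\<^sub>0 \<le> b / 2" unfolding \<delta>\<^sub>0_def by (simp only: min_le_iff_disj order_refl simp_thms)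
    then show "\<delta>\<^sub>0 < b" using b by linarith
    show "\<delta>\<^sub>0 \<le> A / 2" "\<delta>\<^sub>0 \<le> \<eta> / C2" "\<delta>\<^sub>0 \<le> c1 / 2"
      unfolding \<delta>\<^sub>0_def by (simp_all only: min_le_iff_disj order_refl simp_thms)
  qed
  define n0 where "n0 = nat \<lceil>F \<delta>\<^sub>0 / (M' * \<delta>\<^sub>0)\<rceil> + 1"
  have n0: "F \<delta>\<^sub>0 / (M' * \<delta>\<^sub>0) \<le> real n0" "1 \<le> n0"
    unfolding n0_def using real_nat_ceiling_ge[of "F \<delta>\<^sub>0 / (M' * \<delta>\<^sub>0)"] by auto
  have "\<exists>\<tau> \<Lambda> B U Q. B \<in> sets lebesgue \<and> B \<subseteq> U \<and> finite_union_of_intervals n U \<and>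
     measure lebesgue U \<le> \<tau> \<and> \<tau> \<le> \<eta> \<and> 0 < \<Lambda> \<and> trig_poly (D * n) Q \<and>
     (\<forall>t\<in>B. \<omega> t \<le> \<Lambda> \<and> norm (Q t) \<le> 2 * \<Lambda>) \<and>
     (\<forall>t\<in>torus - B. \<omega> t \<le> 2 * norm (Q t) \<and> norm (Q t) \<le> 2 * \<omega> t) \<and>
     (\<forall>t\<in>torus - U. \<Lambda> * exp (M * real n * \<tau>) \<le> \<omega> t)" if n: "n0 \<le> n" for n
  proof -
    have n1: "1 \<le> n" using n n0 by simp
    have "F \<delta>\<^sub>0 / (M' * \<delta>\<^sub>0) \<le> real n" using n n0 by linarith
    with \<delta>0 obtain \<delta> where \<delta>: "0 < \<delta>" "\<delta> \<le> \<delta>\<^sub>0" and eq: "F \<delta> = M' * real n * \<delta>"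
      using Omega_outer_solve[OF F M', of \<delta>\<^sub>0 n] by (metis A field_sum_of_halves le_add_same_cancel1 less_eq_real_def order_trans half_gt_zero)
    have \<delta>A: "2 * \<delta> \<le> A" "\<delta> \<le> A" using \<delta> \<delta>0 A by auto
    have "F1 \<le> F \<delta>" using b(2)[of \<delta>] \<delta> \<delta>0 by auto
    then have F\<delta>: "1 \<le> F \<delta>" "M' * c1 / 4 \<le> F \<delta>" "F0 \<le> F \<delta>" unfolding F1_def by auto
    define h where "h = 2 * \<delta> / c1"
    have h: "0 < h" "h \<le> 1" "c1 * h = 2 * \<delta>" using \<delta> \<delta>0 c1 by (auto simp: h_def field_simps)
    have h3: "1 / real n \<le> 2 * h"
    proof -
      have "M' * c1 / 4 \<le> M' * (real n * \<delta>)" using F\<delta>(2) eq by (simp add: mult.assoc)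
      then have "M' * (c1 / 4) \<le> M' * (real n * \<delta>)" by simp
      then have "c1 / 4 \<le> real n * \<delta>" using M' by (simp only: mult_le_cancel_left_pos)
      then show ?thesis using n1 c1 by (simp add: h_def field_simps)
    qed
    obtain U where U: "finite_union_of_intervals n U" "measure lebesgue U \<le> 6 * real (card P) * h"
      "{s \<in> torus. \<bar>g s\<bar> < c1 * h} \<subseteq> U"
      using small_value_cover[OF c1 P h(1,2) h3] by blast
    define \<tau> where "\<tau> = C2 * \<delta>"
    have \<tau>: "6 * real (card P) * h = \<tau>" unfolding \<tau>_def C2_def h_def by simp
    have "\<delta> \<le> \<eta> / C2" using \<delta> \<delta>0 by simp
    then have \<tau>\<eta>: "\<tau> \<le> \<eta>" unfolding \<tau>_def using C2 by (simp add: pos_le_divide_eq mult.commute)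
    define B where "B = {s \<in> torus. \<bar>g s\<bar> < \<delta>}"
    have "{s. \<bar>g s\<bar> < \<delta>} \<in> sets borel"
      using cg by (intro borel_open open_Collect_less continuous_intros)
    moreover have "torus \<in> sets borel" by (simp add: torus_def)
    moreover have "B = torus \<inter> {s. \<bar>g s\<bar> < \<delta>}" by (auto simp: B_def)
    ultimately have B: "B \<in> sets lebesgue" by auto
    have BU: "B \<subseteq> U" using U(3) h(3) \<delta>(1) unfolding B_def by auto
    define \<Lambda> where "\<Lambda> = exp (- F \<delta>)"
    define N where "N = D * n"
    define Q where "Q = fourier_sum (\<lambda>t. of_real (\<omega> t)) N"
    have N1: "1 \<le> N" unfolding N_def using D n1 by (simp add: Suc_le_eq)
    define k where "k = nat \<lceil>2 * F \<delta>\<rceil>"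
    have k: "2 * F \<delta> \<le> real k" "real k \<le> 3 * F \<delta>" "2 \<le> k"
      using F\<delta>(1) unfolding k_def by linarith+
    define S where "S = (real k * R / (c * \<delta>)) ^ k"
    have S: "\<bar>(deriv ^^ k) \<omega> t\<bar> \<le> S" for t
    proof (cases "g t = 0")
      case True
      then show ?thesis using zero[OF True, of k] R c \<delta> by (simp add: S_def)
    next
      case False
      have "fact k / (c * \<bar>g t\<bar>) ^ k * exp (- F \<bar>g t\<bar> / 2) \<le> S"
        unfolding S_def
      proof (rule derivative_bound_at_scale[OF _ \<delta>(1) c \<alpha>(1)])
        show "F \<delta> * (\<delta> / \<bar>g t\<bar>) powr \<alpha> \<le> F \<bar>g t\<bar>" if "\<bar>g t\<bar> \<le> \<delta>"
          using \<alpha>(2)[of "\<bar>g t\<bar>" \<delta>] that False \<delta>A by simp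
      qed (use False R k F\<delta> Fpos gA in auto)
      then show ?thesis using dbound[OF False, of k] Fg[OF False] by simp
    qed
    have ratio: "S / real N ^ k \<le> exp (- 4 * F \<delta>)"
    proof -
      have "real k * R / (c * \<delta>) / real N \<le> exp (- 2)"
      proof -
        have "real k * R \<le> 3 * (M' * real n * \<delta>) * R" using k(2) R eq by (intro mult_right_mono) auto
        then have "real k * R / (c * \<delta>) \<le> 3 * (M' * real n * \<delta>) * R / (c * \<delta>)" using c \<delta> by (intro divide_right_mono) auto
        also have "\<dots> = exp (- 2) * ((exp 2 * 3 * R * M' / c) * real n)" using \<delta> by (simp add: exp_minus field_simps)
        also have "\<dots> \<le> exp (- 2) * (real D * real n)" using D by (intro mult_left_mono mult_right_mono) auto
        finally have "real k * R / (c * \<delta>) \<le> exp (- 2) * real N" by (simp add: N_def)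
        then show ?thesis using N1 by (subst pos_divide_le_eq) auto
      qed
      then have "(real k * R / (c * \<delta>) / real N) ^ k \<le> exp (- 2) ^ k"
        using R c \<delta> by (intro power_mono) auto
      also have "\<dots> = exp (real k * (- 2))" by (simp only: exp_of_nat_mult)
      also have "\<dots> \<le> exp (- 4 * F \<delta>)" using k(1) by simp
      finally show ?thesis by (simp add: S_def power_divide power_mult_distrib)
    qed
    have N2: "2 * real N \<le> exp (2 * F \<delta>)"
    proof -
      have "F A * (A / \<delta>) powr \<alpha> \<le> F \<delta>" using \<alpha>(2)[of \<delta> A] \<delta> \<delta>A by simp
      then have "(A / \<delta>) powr \<alpha> \<le> F \<delta> / F A" using FA by (simp add: pos_le_divide_eq mult.commute)
      then have "((A / \<delta>) powr \<alpha>) powr (1 / \<alpha>) \<le> (F \<delta> / F A) powr (1 / \<alpha>)" using \<alpha>(1) by (intro powr_mono2) auto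
      then have "A / \<delta> \<le> (F \<delta> / F A) powr (1 / \<alpha>)" using \<alpha>(1) A \<delta> by (simp add: powr_powr)
      then have "2 * real D / (M' * A) * F \<delta> * (A / \<delta>) \<le> 2 * real D / (M' * A) * F \<delta> * (F \<delta> / F A) powr (1 / \<alpha>)"
        using M' A F\<delta> by (intro mult_left_mono) auto
      also have "\<dots> \<le> exp (2 * F \<delta>)" by (rule F0[OF F\<delta>(3)])
      finally show ?thesis using M' A \<delta> by (simp add: eq N_def field_simps)
    qed
    have err: "norm (Q t - of_real (\<omega> t)) \<le> \<Lambda>\<^sup>2" for t
    proof -
      have "norm (Q t - of_real (\<omega> t)) \<le> 2 * S * real N / real N ^ k"
        using fourier_sum_error[of "\<lambda>k. (deriv ^^ k) \<omega>", OF der per S k(3) N1, of t] unfolding Q_def by simp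
      also have "\<dots> = (2 * real N) * (S / real N ^ k)" by simp
      also have "\<dots> \<le> exp (2 * F \<delta>) * exp (- 4 * F \<delta>)"
        using N2 ratio R c \<delta> by (intro mult_mono) (auto simp: S_def)
      also have "\<dots> = \<Lambda>\<^sup>2" unfolding \<Lambda>_def power2_eq_square by (simp flip: exp_add)
      finally show ?thesis .
    qed
    have "exp (1::real) \<ge> 2" using exp_ge_add_one_self[of 1] by simp
    then have "exp (- 1::real) \<le> 1 / 2" by (simp add: exp_minus field_simps)
    moreover have "\<Lambda> \<le> exp (- 1)" unfolding \<Lambda>_def using F\<delta>(1) by simp
    ultimately have "\<Lambda> \<le> 1 / 2" by linarith
    moreover have "0 < \<Lambda>" by (simp add: \<Lambda>_def)
    ultimately have \<Lambda>: "0 < \<Lambda>" "\<Lambda> \<le> 1 / 2" by auto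
    have \<Lambda>sq: "\<Lambda>\<^sup>2 \<le> \<Lambda> / 2" unfolding power2_eq_square using \<Lambda> by (simp add: mult_left_mono)
    have onB: "\<omega> t \<le> \<Lambda> \<and> norm (Q t) \<le> 2 * \<Lambda>" if t: "t \<in> B" for t
    proof -
      have 1: "0 \<le> \<omega> t" "\<omega> t \<le> \<Lambda>"
        using t anti[of "\<bar>g t\<bar>" \<delta>] \<delta>A Fg[of t] by (auto simp: \<omega> \<Lambda>_def B_def)
      have "norm (Q t) \<le> norm (Q t - of_real (\<omega> t)) + norm (complex_of_real (\<omega> t))"
        using norm_triangle_ineq[of "Q t - of_real (\<omega> t)" "of_real (\<omega> t)"] by simp
      moreover have "norm (complex_of_real (\<omega> t)) = \<omega> t" using 1 by simp
      ultimately show ?thesis using 1 err[of t] \<Lambda>sq \<Lambda> by linarith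
    qed
    have offB: "\<omega> t \<le> 2 * norm (Q t) \<and> norm (Q t) \<le> 2 * \<omega> t" if t: "t \<in> torus - B" for t
    proof -
      have gt: "\<delta> \<le> \<bar>g t\<bar>" using t by (auto simp: B_def)
      then have "F (g t) \<le> F \<delta>" using anti[of \<delta> "\<bar>g t\<bar>"] gA[of t] \<delta> Fg[of t] by auto
      then have "\<Lambda> \<le> \<omega> t" using gt \<delta> by (auto simp: \<omega> \<Lambda>_def)
      then have e: "norm (Q t - of_real (\<omega> t)) \<le> \<omega> t / 2" "0 \<le> \<omega> t" using err[of t] \<Lambda>sq \<Lambda> by linarith+
      have "norm (Q t) \<le> norm (Q t - of_real (\<omega> t)) + norm (complex_of_real (\<omega> t))"
        using norm_triangle_ineq[of "Q t - of_real (\<omega> t)" "of_real (\<omega> t)"] by simp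
      moreover have "norm (complex_of_real (\<omega> t)) \<le> norm (Q t - of_real (\<omega> t)) + norm (Q t)"
        using norm_triangle_ineq4[of "Q t - of_real (\<omega> t)" "Q t"] by simp
      moreover have "norm (complex_of_real (\<omega> t)) = \<omega> t" using e(2) by simp
      ultimately show ?thesis using e by linarith
    qed
    have offU: "\<Lambda> * exp (M * real n * \<tau>) \<le> \<omega> t" if t: "t \<in> torus - U" for t
    proof -
      have gt: "2 * \<delta> \<le> \<bar>g t\<bar>" using t U(3) h(3) by auto
      have "F (2 * \<delta>) * 2 powr \<alpha> \<le> F \<delta>" using \<alpha>(2)[of \<delta> "2 * \<delta>"] \<delta> \<delta>A by simp
      then have "F (2 * \<delta>) \<le> F \<delta> * 2 powr (- \<alpha>)" by (simp add: powr_minus field_simps)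
      moreover have "\<kappa> * F \<delta> = M * real n * \<tau>" using \<kappa> by (simp add: eq M'_def \<tau>_def)
      ultimately have "F (2 * \<delta>) \<le> F \<delta> - M * real n * \<tau>" unfolding \<kappa>_def by (simp add: algebra_simps)
      moreover have "F (g t) \<le> F (2 * \<delta>)" using anti[of "2 * \<delta>" "\<bar>g t\<bar>"] gt gA[of t] \<delta> Fg[of t] by auto
      ultimately have "exp (- F \<delta> + M * real n * \<tau>) \<le> exp (- F (g t))" by simp
      then show ?thesis using gt \<delta> unfolding exp_add by (auto simp: \<omega> \<Lambda>_def)
    qed
    show ?thesis
    proof (intro exI conjI)
      show "measure lebesgue U \<le> \<tau>" using U(2) \<tau> by simp
      show "trig_poly (D * n) Q" unfolding Q_def N_def by (rule trig_poly_fourier_sum)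
    qed (use B BU U(1) \<tau>\<eta> \<Lambda>(1) onB offB offU in blast)+
  qed
  then show "\<exists>D n0. 1 \<le> n0 \<and> (\<forall>n\<ge>n0. \<exists>\<tau> \<Lambda> B U Q. B \<in> sets lebesgue \<and> B \<subseteq> U \<and> finite_union_of_intervals n U \<and>
     measure lebesgue U \<le> \<tau> \<and> \<tau> \<le> \<eta> \<and> 0 < \<Lambda> \<and> trig_poly (D * n) Q \<and>
     (\<forall>t\<in>B. \<omega> t \<le> \<Lambda> \<and> norm (Q t) \<le> 2 * \<Lambda>) \<and>
     (\<forall>t\<in>torus - B. \<omega> t \<le> 2 * norm (Q t) \<and> norm (Q t) \<le> 2 * \<omega> t) \<and>
     (\<forall>t\<in>torus - U. \<Lambda> * exp (M * real n * \<tau>) \<le> \<omega> t))"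
    using n0(2) by (intro exI[of _ D] exI[of _ n0]) blast
qed

lemma Omega_nonneg: "\<omega> \<in> Omega \<Longrightarrow> 0 \<le> \<omega> t"
  unfolding Omega_def by auto

lemma Omega_continuous:
  assumes "\<omega> \<in> Omega" shows "continuous_on UNIV \<omega>"
proof -
  obtain A g F where A: "0 < A" and g: "Omega_inner A g" and F: "Omega_outer A F"
    and \<omega>: "\<omega> = (\<lambda>t. if g t = 0 then 0 else exp (- F (g t)))"
    using assms unfolding Omega_def by blast
  have "\<And>k t. ((deriv ^^ k) \<omega> has_real_derivative (deriv ^^ Suc k) \<omega> t) (at t)"
    using Omega_smooth[OF A g F] unfolding \<omega>[symmetric] by blast
  from this[of 0] have "(\<omega> has_real_derivative deriv \<omega> t) (at t)" for t by simp
  then show ?thesis by (meson continuous_at_imp_continuous_on DERIV_isCont)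
qed

lemma Omega_powr:
  assumes "\<omega> \<in> Omega" "0 < \<theta>" shows "(\<lambda>t. \<omega> t powr \<theta>) \<in> Omega"
proof -
  obtain A g F where A: "0 < A" and g: "Omega_inner A g" and F: "Omega_outer A F"
    and \<omega>: "\<omega> = (\<lambda>t. if g t = 0 then 0 else exp (- F (g t)))"
    using assms unfolding Omega_def by blast
  obtain d where d: "successive_derivs_on {0<..A} F d"
    and B: "\<exists>B>0. \<forall>x\<in>{0<..A}. \<forall>n\<ge>1. \<bar>d n x\<bar> \<le> B ^ n * real n ^ n * F x / x ^ n"
    and A12: "\<exists>A1>0. \<exists>A2>0. \<forall>x\<in>{0<..A}. A2 \<le> \<bar>d 1 x\<bar> * x / F x \<and> \<bar>d 1 x\<bar> * x / F x \<le> A1"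
    using F unfolding Omega_outer_def by blast
  have "Omega_outer A (\<lambda>x. \<theta> * F x)"
    unfolding Omega_outer_def
  proof (intro conjI exI[of _ "\<lambda>n x. \<theta> * d n x"])
    show "\<forall>x\<in>{- A..A} - {0}. 0 < \<theta> * F x \<and> \<theta> * F (- x) = \<theta> * F x"
      using F assms(2) unfolding Omega_outer_def by auto
    have "filterlim F at_top (at_right 0)" using F unfolding Omega_outer_def by blast
    then show "filterlim (\<lambda>x. \<theta> * F x) at_top (at_right 0)"
      using assms(2) by (intro filterlim_tendsto_pos_mult_at_top[OF tendsto_const])
    show "antimono_on {0<..A} (\<lambda>x. \<theta> * F x)"
      using F assms(2) unfolding Omega_outer_def monotone_on_def by (auto intro: mult_left_mono)
    show "successive_derivs_on {0<..A} (\<lambda>x. \<theta> * F x) (\<lambda>n x. \<theta> * d n x)"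
      using d unfolding successive_derivs_on_def by (auto intro: DERIV_cmult)
    obtain B where "B > 0" "\<And>x n. x\<in>{0<..A} \<Longrightarrow> 1 \<le> n \<Longrightarrow> \<bar>d n x\<bar> \<le> B ^ n * real n ^ n * F x / x ^ n"
      using B by blast
    then have "\<bar>\<theta> * d n x\<bar> \<le> B ^ n * real n ^ n * (\<theta> * F x) / x ^ n" if "x\<in>{0<..A}" "1 \<le> n" for x n
      using mult_left_mono[of "\<bar>d n x\<bar>" "B ^ n * real n ^ n * F x / x ^ n" \<theta>] that assms(2) by (simp add: abs_mult mult_ac)
    then show "\<exists>B>0. \<forall>x\<in>{0<..A}. \<forall>n\<ge>1. \<bar>\<theta> * d n x\<bar> \<le> B ^ n * real n ^ n * (\<theta> * F x) / x ^ n"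
      using \<open>B > 0\<close> by blast
    show "\<exists>A1>0. \<exists>A2>0. \<forall>x\<in>{0<..A}. A2 \<le> \<bar>\<theta> * d 1 x\<bar> * x / (\<theta> * F x) \<and> \<bar>\<theta> * d 1 x\<bar> * x / (\<theta> * F x) \<le> A1"
      using A12 assms(2) by (simp add: abs_mult)
  qed
  moreover have "\<omega> t powr \<theta> = (if g t = 0 then 0 else exp (- (\<theta> * F (g t))))" for t
    using assms(2) by (simp add: \<omega> powr_def)
  ultimately show ?thesis unfolding Omega_def using A g by blast
qed

section \<open>Products of weights in Omega\<close>

lemma times_norm_times_norm: "times_norm (times_norm N a) b = times_norm N (\<lambda>t. a t * b t)"
  by (simp add: fun_eq_iff times_norm_def mult_ac)

text \<open>The Remez inequalities for the partial products have to be carried along in the induction, since each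
  further factor needs them.\<close>

lemma nikolskii_times_prod:
  fixes s :: nat
  assumes N: "lattice_norm N" "remez N" and N': "lattice_norm N'" "remez N'"
    and nik: "nikolskii N N' \<gamma>" "0 \<le> \<gamma>"
    and \<rho>: "\<And>i. i \<in> {1..s} \<Longrightarrow> \<rho> i \<in> Omega"
  shows "nikolskii (times_norm N (\<lambda>t. \<Prod>i = 1..s. \<rho> i t)) (times_norm N' (\<lambda>t. \<Prod>i = 1..s. \<rho> i t)) \<gamma>"
proof -
  have "lattice_norm (times_norm N (\<lambda>t. \<Prod>i = 1..s. \<rho> i t)) \<and> remez (times_norm N (\<lambda>t. \<Prod>i = 1..s. \<rho> i t)) \<and>
    lattice_norm (times_norm N' (\<lambda>t. \<Prod>i = 1..s. \<rho> i t)) \<and> remez (times_norm N' (\<lambda>t. \<Prod>i = 1..s. \<rho> i t)) \<and>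
    nikolskii (times_norm N (\<lambda>t. \<Prod>i = 1..s. \<rho> i t)) (times_norm N' (\<lambda>t. \<Prod>i = 1..s. \<rho> i t)) \<gamma>"
    using \<rho>
  proof (induction s)
    case 0
    have "times_norm L (\<lambda>t. 1) = L" for L by (simp add: fun_eq_iff times_norm_def)
    then show ?case using N N' nik by simp
  next
    case (Suc s)
    have \<omega>: "\<rho> (Suc s) \<in> Omega" using Suc.prems by simp
    note * = Omega_mimicked[OF \<omega>] Omega_continuous[OF \<omega>] Omega_nonneg[OF \<omega>]
    have eq: "times_norm L (\<lambda>t. \<Prod>i = 1..Suc s. \<rho> i t)
      = times_norm (times_norm L (\<lambda>t. \<Prod>i = 1..s. \<rho> i t)) (\<rho> (Suc s))" for L
      by (simp add: times_norm_times_norm)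
    have IH: "lattice_norm (times_norm N (\<lambda>t. \<Prod>i = 1..s. \<rho> i t))" "remez (times_norm N (\<lambda>t. \<Prod>i = 1..s. \<rho> i t))"
      "lattice_norm (times_norm N' (\<lambda>t. \<Prod>i = 1..s. \<rho> i t))" "remez (times_norm N' (\<lambda>t. \<Prod>i = 1..s. \<rho> i t))"
      "nikolskii (times_norm N (\<lambda>t. \<Prod>i = 1..s. \<rho> i t)) (times_norm N' (\<lambda>t. \<Prod>i = 1..s. \<rho> i t)) \<gamma>"
      using Suc by auto
    show ?case unfolding eq
      using lattice_norm_times_norm[OF IH(1) *(2)] lattice_norm_times_norm[OF IH(3) *(2)]
        remez_times_norm[OF IH(1,2) *] remez_times_norm[OF IH(3,4) *]
        nikolskii_times_norm[OF IH nik(2) *] by blast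
  qed
  then show ?thesis by blast
qed

lemma nikolskii_times_prod_powr:
  fixes s :: nat
  assumes N: "lattice_norm N" "remez N" and N': "lattice_norm N'" "remez N'"
    and nik: "nikolskii N N' \<gamma>" "0 \<le> \<gamma>"
    and \<omega>: "\<And>i. i \<in> {1..s} \<Longrightarrow> \<omega>s i \<in> Omega" "\<And>t. \<omega> t = (\<Prod>i = 1..s. \<omega>s i t)" and \<theta>: "0 < \<theta>"
  shows "nikolskii (times_norm N (\<lambda>t. \<omega> t powr \<theta>)) (times_norm N' (\<lambda>t. \<omega> t powr \<theta>)) \<gamma>"
proof -
  have "\<omega> t powr \<theta> = (\<Prod>i = 1..s. \<omega>s i t powr \<theta>)" for t
    unfolding \<omega>(2) by (rule prod_powr_distrib)
  then show ?thesis
    using nikolskii_times_prod[OF N N' nik, of s "\<lambda>i t. \<omega>s i t powr \<theta>"] Omega_powr[OF \<omega>(1) \<theta>] by simp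
qed

theorem theorem8p1:
  fixes p q :: ennreal
    and s :: nat
    and \<omega>s :: "nat \<Rightarrow> real \<Rightarrow> real"
    and \<omega> u :: "real \<Rightarrow> real"
  assumes "0 < p" and "p \<le> q"
    and "1 \<le> s"
    and "\<And>i. i \<in> {1..s} \<Longrightarrow> \<omega>s i \<in> Omega"
    and "\<And>t. \<omega> t = (\<Prod>i = 1..s. \<omega>s i t)"
    and "u \<in> R_int q"
  shows
    "(q < \<infinity> \<longrightarrow>
      (\<lambda>t. u t powr (enn2real p / enn2real q)) \<in> R_int p \<longrightarrow>
      (\<exists>C\<^sub>0>0. \<forall>n\<ge>1. \<forall>T. trig_poly n T \<longrightarrow>
         Lp_norm q u torus T
           \<le> ennreal (C\<^sub>0 * real n powr (1 / enn2real p - 1 / enn2real q)) *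
             Lp_norm p (\<lambda>t. u t powr (enn2real p / enn2real q)) torus T) \<longrightarrow>
      (\<exists>C>0. \<forall>n\<ge>1. \<forall>T. trig_poly n T \<longrightarrow>
         Lp_norm q (\<lambda>t. \<omega> t * u t) torus T
           \<le> ennreal (C * real n powr (1 / enn2real p - 1 / enn2real q)) *
             Lp_norm p (\<lambda>t. (\<omega> t * u t) powr (enn2real p / enn2real q)) torus T))
   \<and>
    (p < q \<longrightarrow> q = \<infinity> \<longrightarrow>
      (\<lambda>t. u t powr enn2real p) \<in> R_int p \<longrightarrow>
      (\<exists>C\<^sub>0>0. \<forall>n\<ge>1. \<forall>T. trig_poly n T \<longrightarrow>
         Lp_norm \<infinity> u torus T
           \<le> ennreal (C\<^sub>0 * real n powr (1 / enn2real p)) *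
             Lp_norm p (\<lambda>t. u t powr enn2real p) torus T) \<longrightarrow>
      (\<exists>C>0. \<forall>n\<ge>1. \<forall>T. trig_poly n T \<longrightarrow>
         Lp_norm \<infinity> (\<lambda>t. \<omega> t * u t) torus T
           \<le> ennreal (C * real n powr (1 / enn2real p)) *
             Lp_norm p (\<lambda>t. (\<omega> t * u t) powr enn2real p) torus T))"
proof (intro conjI impI)
  have \<omega>0: "0 \<le> \<omega> t" for t
    unfolding assms(5) using Omega_nonneg[OF assms(4)] by (intro prod_nonneg) auto
  have u0: "0 \<le> u t" for t using assms(6) by (simp add: R_int_def weight_def)
  have q0: "0 < q" using assms(1,2) by (rule less_le_trans)
  note N = R_int_lattice_norm[OF assms(6) q0] R_int_remez[OF assms(6)]
  {
    let ?v = "\<lambda>t. u t powr (enn2real p / enn2real q)"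
    let ?\<gamma> = "1 / enn2real p - 1 / enn2real q"
    assume q: "q < \<infinity>" and v: "?v \<in> R_int p"
      and nik: "\<exists>C\<^sub>0>0. \<forall>n\<ge>1. \<forall>T. trig_poly n T \<longrightarrow>
         Lp_norm q u torus T \<le> ennreal (C\<^sub>0 * real n powr ?\<gamma>) * Lp_norm p ?v torus T"
    have p: "p < \<infinity>" using assms(2) q by (rule le_less_trans)
    have pq: "0 < enn2real p" "enn2real p \<le> enn2real q"
      using assms(1,2) p q by (auto simp: enn2real_positive_iff intro: enn2real_mono)
    then have \<gamma>: "0 \<le> ?\<gamma>" by (simp add: frac_le)
    have \<theta>: "0 < 1 / enn2real q" using pq by simp
    have "nikolskii (times_norm (Lp_norm q u) (\<lambda>t. \<omega> t powr (1 / enn2real q)))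
        (times_norm (Lp_norm p ?v) (\<lambda>t. \<omega> t powr (1 / enn2real q))) ?\<gamma>"
      using nik by (intro nikolskii_times_prod_powr[OF N R_int_lattice_norm[OF v assms(1)] R_int_remez[OF v] _ \<gamma> assms(4,5) \<theta>])
        (auto simp: nikolskii_def)
    moreover have "times_norm (Lp_norm q u) (\<lambda>t. \<omega> t powr (1 / enn2real q)) = Lp_norm q (\<lambda>t. \<omega> t * u t)"
      by (rule Lp_norm_times_weight[OF q0 q \<omega>0 u0, symmetric])
    moreover have "times_norm (Lp_norm p ?v) (\<lambda>t. \<omega> t powr (1 / enn2real q))
        = Lp_norm p (\<lambda>t. (\<omega> t * u t) powr (enn2real p / enn2real q))"
      using Lp_norm_times_weight_powr[OF assms(1) p \<omega>0 u0, where a = "1 / enn2real q"] by simp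
    ultimately show "\<exists>C>0. \<forall>n\<ge>1. \<forall>T. trig_poly n T \<longrightarrow>
         Lp_norm q (\<lambda>t. \<omega> t * u t) torus T
           \<le> ennreal (C * real n powr ?\<gamma>) * Lp_norm p (\<lambda>t. (\<omega> t * u t) powr (enn2real p / enn2real q)) torus T"
      unfolding nikolskii_def by simp
  next
    let ?v = "\<lambda>t. u t powr enn2real p"
    assume pq: "p < q" and q: "q = \<infinity>" and v: "?v \<in> R_int p"
      and nik: "\<exists>C\<^sub>0>0. \<forall>n\<ge>1. \<forall>T. trig_poly n T \<longrightarrow>
         Lp_norm \<infinity> u torus T \<le> ennreal (C\<^sub>0 * real n powr (1 / enn2real p)) * Lp_norm p ?v torus T"
    have p: "p < \<infinity>" using pq q by simp
    have \<gamma>: "0 \<le> 1 / enn2real p" by simp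
    have "nikolskii (times_norm (Lp_norm \<infinity> u) (\<lambda>t. \<omega> t powr 1)) (times_norm (Lp_norm p ?v) (\<lambda>t. \<omega> t powr 1)) (1 / enn2real p)"
      using nik by (intro nikolskii_times_prod_powr[OF N[unfolded q] R_int_lattice_norm[OF v assms(1)] R_int_remez[OF v] _ \<gamma> assms(4,5)])
        (auto simp: nikolskii_def)
    moreover have "times_norm (Lp_norm \<infinity> u) (\<lambda>t. \<omega> t powr 1) = Lp_norm \<infinity> (\<lambda>t. \<omega> t * u t)"
      using Lp_norm_infinity_times_weight[OF \<omega>0] \<omega>0 by simp
    moreover have "times_norm (Lp_norm p ?v) (\<lambda>t. \<omega> t powr 1) = Lp_norm p (\<lambda>t. (\<omega> t * u t) powr enn2real p)"
      using Lp_norm_times_weight_powr[OF assms(1) p \<omega>0 u0, where a = 1] by simp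
    ultimately show "\<exists>C>0. \<forall>n\<ge>1. \<forall>T. trig_poly n T \<longrightarrow>
         Lp_norm \<infinity> (\<lambda>t. \<omega> t * u t) torus T
           \<le> ennreal (C * real n powr (1 / enn2real p)) * Lp_norm p (\<lambda>t. (\<omega> t * u t) powr enn2real p) torus T"
      unfolding nikolskii_def by simp
  }
qed

end
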